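(* Consider the repeated play of the two-agent matrix game with finite action sets $A^1,A^2$ and payoff matrices $R^1\in\mathbb{R}^{|A^1|\times|A^2|}$, $R^2\in\mathbb{R}^{|A^2|\times|A^1|}$ (not necessarily zero-sum), where each agent $i\in\{1,2\}$ follows a learning dynamic from Algorithm Family 1 (described in the context) with step sizes $(\alpha_k^i)_{k\ge0}$ satisfying Assumption 1. Suppose that $\alpha_k^1/\alpha_k^2\to d\in(0,1]$ as $k\to\infty$. For $i\in\{1,2\}$, $j\ne i$, let $\pi_k^i\in\Delta^i$ be the weighted empirical average of agent $i$'s past actions, defined by an arbitrary $\pi_0^i\in\Delta^i$ and $\pi_{k+1}^i=\pi_k^i+\alpha_k^j(a_k^i-\pi_k^i)$ (with $a_k^i$ identified with the corresponding vertex of $\Delta^i$). Define $$\delta_k^i:=(\mu_k^i)^Tq_k^i+\tau^iH^i(\mu_k^i)-\tau^jH^j(\pi_k^j)-\underline{\mathrm{val}}^i(R^i),$$ $$c:=\lambda\|R^1+(R^2)^T\|_{\max}-\big(\underline{\mathrm{val}}^1(R^1)+\underline{\mathrm{val}}^2(R^2)\big)$$ for some $\lambda>1$. Then, almost surely, $\|q_k^i-R^i\pi_k^j\|_2\to0$ as $k\to\infty$ for each $i$, and $$\limsup_{k\to\infty}\big(\delta_k^1+d\,\delta_k^2\big)\le c;$$ moreover $\delta_k^i\ge\|q_k^i-R^i\pi_k^j\|_2$.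
   Context: Notation: $\Delta^i$ is the probability simplex over $A^i$; actions are identified with vertices of $\Delta^i$; $r^i(a^i,a^j)$ is the $(a^i,a^j)$ entry of $R^i$. $\|M\|_{\max}$ is the maximum absolute entry of a matrix $M$. $H^i(\mu)=-\sum_{a}\mu(a)\log\mu(a)$. The best response set is $\mathrm{br}^i(q)=\{a^i\in A^i: q(a^i)\ge q(\tilde a^i)\ \forall\tilde a^i\}$ for $q\in\mathbb{R}^{|A^i|}$; for temperature $\tau^i>0$ the smoothed best response is $\underline{\mathrm{br}}^i(q)(a^i)=\exp(q(a^i)/\tau^i)/\sum_{\tilde a^i}\exp(q(\tilde a^i)/\tau^i)$, i.e. the maximizer of $\mu^Tq+\tau^iH^i(\mu)$ over $\Delta^i$. For $i\neq j$: $\underline{\mathrm{val}}^i(R^i)=\max_{\mu^i\in\Delta^i}\min_{\mu^j\in\Delta^j}\{(\mu^i)^TR^i\mu^j+\tau^iH^i(\mu^i)-\tau^jH^j(\mu^j)\}$. Algorithm Family 1 (for agent $i$, opponent $j$): the agent is either of best-response type (then set $\tau^i:=0$; such an agent knows $R^i$ and has $\theta^i=1$) or of smoothed-best-response type with temperature $\tau^i>0$ (it may or may not know $R^i$ and has any $\theta^i\in[0,1]$). Initialize $q_0^i\in\mathbb{R}^{|A^i|}$ arbitrarily. At each stage $k=0,1,\dots$, independently of the history, with probability $\theta^i$ the agent has access to the opponent's current action. If the agent knows $R^i$ and has access: it plays $a_k^i\in\mathrm{br}^i(q_k^i)$ (best-response type, any selection) or $a_k^i\sim\underline{\mathrm{br}}^i(q_k^i)$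 (smoothed type), observes $a_k^j$, and updates $q_{k+1}^i=q_k^i+\alpha_k^i(R^ia_k^j-q_k^i)$. Otherwise: it plays $a_k^i\sim\underline{\mathrm{br}}^i(q_k^i)$, observes its reward $r_k^i=r^i(a_k^i,a_k^j)$, and updates $q_{k+1}^i(\tilde a)=q_k^i(\tilde a)+\bar\alpha_k^i(\tilde a)(r_k^i-q_k^i(\tilde a))$ for all $\tilde a\in A^i$, where $\bar\alpha_k^i(\tilde a)=\mathbb{I}_{\{\tilde a=a_k^i\}}\min\{1,\alpha_k^i/\underline{\mathrm{br}}^i(q_k^i)(\tilde a)\}$. Both agents act simultaneously. Let $\mu_k^i=a_k^i$ if agent $i$ is of best-response type and $\mu_k^i=\underline{\mathrm{br}}^i(q_k^i)$ if of smoothed type. Assumption 1: for each $i$, $\alpha_k^i\in(0,1)$ decreases monotonically to $0$, $\sum_k\alpha_k^i=\infty$, and additionally $\sum_k(\alpha_k^i)^2<\infty$ if agent $i$ is of smoothed-best-response type.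
   Formalization: The final inequality is proved as δ_k^i ≥ −‖q_k^i − R^iπ_k^j‖_2; without the minus sign it is false, e.g. for one action each and q_0^i < R^i, where δ_0^i = q_0^i − R^i < 0. *)

theory Defs
  imports "HOL-Probability.Probability"
begin

text \<open>Finite action sets are finite types; vectors over an action set are functions
  into real; a payoff matrix of agent i is a function own action => opponent action => real.\<close>

definition prob_simplex :: "('a::finite \<Rightarrow> real) set" where
  "prob_simplex = {\<mu>. (\<forall>a. 0 \<le> \<mu> a) \<and> (\<Sum>a\<in>UNIV. \<mu> a) = 1}"

definition vertex :: "'a \<Rightarrow> 'a \<Rightarrow> real" where
  "vertex a = (\<lambda>x. if x = a then 1 else 0)"

definition entropy :: "('a::finite \<Rightarrow> real) \<Rightarrow> real" where
  "entropy \<mu> = - (\<Sum>a\<in>UNIV. \<mu> a * ln (\<mu> a))"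

definition br_set :: "('a::finite \<Rightarrow> real) \<Rightarrow> 'a set" where
  "br_set q = {a. \<forall>a'. q a' \<le> q a}"

definition sbr :: "real \<Rightarrow> ('a::finite \<Rightarrow> real) \<Rightarrow> 'a \<Rightarrow> real" where
  "sbr \<tau> q = (\<lambda>a. exp (q a / \<tau>) / (\<Sum>a'\<in>UNIV. exp (q a' / \<tau>)))"

definition bil :: "('a::finite \<Rightarrow> real) \<Rightarrow> ('a \<Rightarrow> 'b::finite \<Rightarrow> real) \<Rightarrow> ('b \<Rightarrow> real) \<Rightarrow> real" where
  "bil \<mu> R \<nu> = (\<Sum>a\<in>UNIV. \<Sum>b\<in>UNIV. \<mu> a * R a b * \<nu> b)"

definition mv :: "('a \<Rightarrow> 'b::finite \<Rightarrow> real) \<Rightarrow> ('b \<Rightarrow> real) \<Rightarrow> 'a \<Rightarrow> real" where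
  "mv R \<nu> = (\<lambda>a. \<Sum>b\<in>UNIV. R a b * \<nu> b)"

definition l2norm :: "('a::finite \<Rightarrow> real) \<Rightarrow> real" where
  "l2norm x = sqrt (\<Sum>a\<in>UNIV. (x a)\<^sup>2)"

definition maxnorm :: "('a::finite \<Rightarrow> 'b::finite \<Rightarrow> real) \<Rightarrow> real" where
  "maxnorm M = Max (range (\<lambda>(a, b). \<bar>M a b\<bar>))"

definition sval :: "real \<Rightarrow> real \<Rightarrow> ('a::finite \<Rightarrow> 'b::finite \<Rightarrow> real) \<Rightarrow> real" where
  "sval \<tau>i \<tau>j R = (SUP \<mu>\<in>prob_simplex. INF \<nu>\<in>prob_simplex.
      bil \<mu> R \<nu> + \<tau>i * entropy \<mu> - \<tau>j * entropy \<nu>)"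

text \<open>One update of the q-estimate: with knowledge of R and access, move toward R a^j;
  otherwise the importance-weighted payoff-based update.\<close>
definition q_update :: "real \<Rightarrow> ('a::finite \<Rightarrow> 'b \<Rightarrow> real) \<Rightarrow> real \<Rightarrow> bool \<Rightarrow>
    ('a \<Rightarrow> real) \<Rightarrow> bool \<Rightarrow> 'a \<Rightarrow> 'b \<Rightarrow> ('a \<Rightarrow> real)" where
  "q_update \<alpha> R \<tau> kn q acc x y =
     (if kn \<and> acc then (\<lambda>z. q z + \<alpha> * (R z y - q z))
      else (\<lambda>z. q z + (if z = x then min 1 (\<alpha> / sbr \<tau> q z) else 0) * (R x y - q z)))"

primrec qseq :: "(nat \<Rightarrow> real) \<Rightarrow> ('a::finite \<Rightarrow> 'b \<Rightarrow> real) \<Rightarrow> real \<Rightarrow> bool \<Rightarrow>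
    ('a \<Rightarrow> real) \<Rightarrow> (nat \<Rightarrow> bool) \<Rightarrow> (nat \<Rightarrow> 'a) \<Rightarrow> (nat \<Rightarrow> 'b) \<Rightarrow> nat \<Rightarrow> ('a \<Rightarrow> real)" where
  "qseq \<alpha> R \<tau> kn q0 acc a b 0 = q0"
| "qseq \<alpha> R \<tau> kn q0 acc a b (Suc k) =
     q_update (\<alpha> k) R \<tau> kn (qseq \<alpha> R \<tau> kn q0 acc a b k) (acc k) (a k) (b k)"

text \<open>Weighted empirical average of own actions (with the opponent's step sizes).\<close>
primrec empseq :: "(nat \<Rightarrow> real) \<Rightarrow> ('a \<Rightarrow> real) \<Rightarrow> (nat \<Rightarrow> 'a) \<Rightarrow> nat \<Rightarrow> ('a \<Rightarrow> real)" where
  "empseq \<alpha> \<pi>0 a 0 = \<pi>0"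
| "empseq \<alpha> \<pi>0 a (Suc k) =
     (\<lambda>z. empseq \<alpha> \<pi>0 a k z + \<alpha> k * (vertex (a k) z - empseq \<alpha> \<pi>0 a k z))"

text \<open>Agent type: best-response type (brt) forces tau = 0, knows R, theta = 1;
  smoothed type: tau > 0, theta in [0,1], knowledge of R arbitrary.\<close>
definition agent_ok :: "bool \<Rightarrow> real \<Rightarrow> real \<Rightarrow> bool \<Rightarrow> bool" where
  "agent_ok brt \<tau> \<theta> kn =
     (if brt then \<tau> = 0 \<and> kn \<and> \<theta> = 1 else 0 < \<tau> \<and> 0 \<le> \<theta> \<and> \<theta> \<le> 1)"

definition step_ok :: "bool \<Rightarrow> (nat \<Rightarrow> real) \<Rightarrow> bool" where
  "step_ok brt \<alpha> =
     ((\<forall>k. 0 < \<alpha> k \<and> \<alpha> k < 1) \<and> decseq \<alpha> \<and> \<alpha> \<longlonglongrightarrow> 0 \<and> \<not> summable \<alpha> \<and>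
      (\<not> brt \<longrightarrow> summable (\<lambda>k. (\<alpha> k)\<^sup>2)))"

definition bern :: "real \<Rightarrow> bool \<Rightarrow> real" where
  "bern \<theta> b = (if b then \<theta> else 1 - \<theta>)"


definition qproc :: "(nat \<Rightarrow> real) \<Rightarrow> ('a::finite \<Rightarrow> 'b \<Rightarrow> real) \<Rightarrow> real \<Rightarrow> bool \<Rightarrow>
    ('a \<Rightarrow> real) \<Rightarrow> (nat \<Rightarrow> 'm \<Rightarrow> bool) \<Rightarrow> (nat \<Rightarrow> 'm \<Rightarrow> 'a) \<Rightarrow> (nat \<Rightarrow> 'm \<Rightarrow> 'b) \<Rightarrow>
    nat \<Rightarrow> 'm \<Rightarrow> ('a \<Rightarrow> real)" where
  "qproc \<alpha> R \<tau> kn q0 acc a b k \<omega> =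
     qseq \<alpha> R \<tau> kn q0 (\<lambda>t. acc t \<omega>) (\<lambda>t. a t \<omega>) (\<lambda>t. b t \<omega>) k"

definition empproc :: "(nat \<Rightarrow> real) \<Rightarrow> ('a \<Rightarrow> real) \<Rightarrow> (nat \<Rightarrow> 'm \<Rightarrow> 'a) \<Rightarrow> nat \<Rightarrow> 'm \<Rightarrow> ('a \<Rightarrow> real)" where
  "empproc \<alpha> \<pi>0 a k \<omega> = empseq \<alpha> \<pi>0 (\<lambda>t. a t \<omega>) k"

definition hist :: "(nat \<Rightarrow> 'm \<Rightarrow> bool) \<Rightarrow> (nat \<Rightarrow> 'm \<Rightarrow> bool) \<Rightarrow> (nat \<Rightarrow> 'm \<Rightarrow> 'a) \<Rightarrow>
    (nat \<Rightarrow> 'm \<Rightarrow> 'b) \<Rightarrow> nat \<Rightarrow> 'm \<Rightarrow> (bool \<times> bool \<times> 'a \<times> 'b) list" where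
  "hist acc1 acc2 a1 a2 k \<omega> = map (\<lambda>t. (acc1 t \<omega>, acc2 t \<omega>, a1 t \<omega>, a2 t \<omega>)) [0..<k]"

definition strat :: "bool \<Rightarrow> real \<Rightarrow> ('a::finite \<Rightarrow> real) \<Rightarrow> 'a \<Rightarrow> ('a \<Rightarrow> real)" where
  "strat brt \<tau> q a = (if brt then vertex a else sbr \<tau> q)"

text \<open>Conditional probability of the action given the history: the selection kernel
  (supported on br) for best-response type, the smoothed best response otherwise.\<close>
definition policy :: "bool \<Rightarrow> real \<Rightarrow> ('a::finite \<Rightarrow> real) \<Rightarrow> ('a \<Rightarrow> real) \<Rightarrow> ('a \<Rightarrow> real)" where
  "policy brt \<tau> q sel = (if brt then sel else sbr \<tau> q)"

definition delta :: "real \<Rightarrow> real \<Rightarrow> ('a::finite \<Rightarrow> 'b::finite \<Rightarrow> real) \<Rightarrow> ('a \<Rightarrow> real) \<Rightarrow>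
    ('a \<Rightarrow> real) \<Rightarrow> ('b \<Rightarrow> real) \<Rightarrow> real" where
  "delta \<tau>i \<tau>j R \<mu> q \<pi>j =
     (\<Sum>x\<in>UNIV. \<mu> x * q x) + \<tau>i * entropy \<mu> - \<tau>j * entropy \<pi>j - sval \<tau>i \<tau>j R"

end

theory Submission
  imports Defs
begin

text \<open>The noise in the estimates and in the empirical averages is a Robbins--Monro average of bounded
  martingale differences and vanishes almost surely, so along almost every path \<open>\<pi>\<close> follows
  \<open>x\<^sub>k\<^sub>+\<^sub>1 = x\<^sub>k + d \<alpha>\<^sub>k (\<nu>\<^sub>k - x\<^sub>k)\<close>, \<open>y\<^sub>k\<^sub>+\<^sub>1 = y\<^sub>k + \<alpha>\<^sub>k (\<mu>\<^sub>k - y\<^sub>k)\<close>, with \<open>\<mu>\<^sub>k\<close>, \<open>\<nu>\<^sub>k\<close>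
  asymptotically optimal against \<open>x\<^sub>k\<close>, \<open>y\<^sub>k\<close>. In continuous time the Lyapunov function
  \<open>\<Lambda> = \<delta>\<^sup>1 + d \<delta>\<^sup>2\<close> satisfies \<open>\<Lambda>' \<le> d (\<mu>\<^sup>T (R\<^sup>1 + (R\<^sup>2)\<^sup>T) \<nu> - v\<^sup>1 - v\<^sup>2 - \<Lambda>)\<close>, where \<open>v\<^sup>i\<close> is the value.
  In discrete time the best payoff has kinks, and its increments pair current strategies with past
  ones. Increments are therefore taken over \<open>H\<close> blocks of equal duration: the error is controlled by
  the difference of neighbouring local averages of \<open>\<nu>\<close> at scale \<open>H\<close>, and among many dyadic scales
  one makes it small.\<close>

section \<open>Dyadic scales\<close>

text \<open>The best payoff is a convex, nonsmooth function of the opponent's average, and the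
  current strategy is a subgradient. An increment is thus bounded above by the slope at its later
  end, which pairs the new strategy with the opponent's earlier play. A best-response strategy may
  jump at every stage, however small the steps, so this lag cannot be removed stage by stage, only
  after summation over a window. The weight \<open>d\<close> on player 2 is forced by the clocks: it
  gives both bilinear payoffs the same coefficient, so that they add up to the cross term and the
  entropy bonuses of the two players cancel. That \<open>\<Lambda>\<close> decays at rate
  \<open>d\<close> then uses \<open>d \<le> 1\<close> and the fact that
  \<open>\<delta>\<^sup>2\<close> is nonnegative on the noise-free path. All window estimates are
  implicit, with the value at the end of the window on the right: a negative entropy can fall
  arbitrarily steeply at the boundary of the simplex, so only its rise is controlled.\<close>

definition shifted_sum :: "(nat \<Rightarrow> real) \<Rightarrow> nat \<Rightarrow> nat \<Rightarrow> real" where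
  "shifted_sum f H b = (\<Sum>i<H. f (b + i))"

lemma sum_lessThan_add:
  fixes f :: "nat \<Rightarrow> real"
  shows "(\<Sum>i<m + n. f i) = (\<Sum>i<m. f i) + (\<Sum>i<n. f (m + i))"
  by (induction n) auto

lemma sum_shift_diff:
  fixes c :: "nat \<Rightarrow> real"
  shows "(\<Sum>b<N. c (b + H)) - (\<Sum>b<N. c b) = (\<Sum>i<H. c (N + i)) - (\<Sum>i<H. c i)"
  using sum_lessThan_add[of c H N] sum_lessThan_add[of c N H] by (simp add: add.commute)

lemma abs_shifted_sum_le:
  assumes "\<And>b. \<bar>f b\<bar> \<le> 1"
  shows "\<bar>shifted_sum f H b\<bar> \<le> real H"
proof -
  have "\<bar>shifted_sum f H b\<bar> \<le> (\<Sum>i<H. \<bar>f (b + i)\<bar>)"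
    unfolding shifted_sum_def by (rule sum_abs)
  also have "\<dots> \<le> (\<Sum>i<H. 1)" using assms by (intro sum_mono)
  finally show ?thesis by simp
qed

text \<open>The parallelogram identity for two neighbouring averages at scale \<open>H\<close>,
  whose mean is the average at scale \<open>2 * H\<close>. Shifting the window by \<open>H\<close>
  changes a sum of squares by at most \<open>H\<close>, which enters with factor 2.\<close>

lemma energy_step:
  fixes f :: "nat \<Rightarrow> real"
  assumes f: "\<And>b. \<bar>f b\<bar> \<le> 1" and H: "0 < H"
  shows "(\<Sum>b<N. ((shifted_sum f H b - shifted_sum f H (b + H)) / H)\<^sup>2)
    \<le> 4 * ((\<Sum>b<N. (shifted_sum f H b / H)\<^sup>2) - (\<Sum>b<N. (shifted_sum f (2 * H) b / (2 * H))\<^sup>2)) + 2 * H"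
proof -
  define G where "G b = shifted_sum f H b / H" for b
  have G2: "shifted_sum f (2 * H) b / (2 * H) = (G b + G (b + H)) / 2" for b
  proof -
    have "shifted_sum f (2 * H) b = shifted_sum f H b + shifted_sum f H (b + H)"
      using sum_lessThan_add[of "\<lambda>i. f (b + i)" H H] by (simp add: shifted_sum_def mult_2 add.assoc)
    then show ?thesis using H by (simp add: G_def field_simps)
  qed
  have G1: "(G b)\<^sup>2 \<le> 1" for b
    using abs_shifted_sum_le[OF f, where H = H and b = b] H by (simp add: G_def abs_square_le_1)
  have "(\<Sum>b<N. (G (b + H))\<^sup>2) - (\<Sum>b<N. (G b)\<^sup>2) = (\<Sum>i<H. (G (N + i))\<^sup>2) - (\<Sum>i<H. (G i)\<^sup>2)"
    by (rule sum_shift_diff)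
  also have "\<dots> \<le> (\<Sum>i<H. 1) - 0"
    by (intro diff_mono sum_mono G1 sum_nonneg) auto
  finally have shift: "(\<Sum>b<N. (G (b + H))\<^sup>2) \<le> (\<Sum>b<N. (G b)\<^sup>2) + H" by simp
  have "((shifted_sum f H b - shifted_sum f H (b + H)) / H)\<^sup>2
      = 2 * (G b)\<^sup>2 + 2 * (G (b + H))\<^sup>2 - 4 * (shifted_sum f (2 * H) b / (2 * H))\<^sup>2" for b
  proof -
    have "(shifted_sum f H b - shifted_sum f H (b + H)) / H = G b - G (b + H)"
      by (simp add: G_def diff_divide_distrib)
    then show ?thesis unfolding G2 by (simp only:) (simp add: power2_eq_square field_simps)
  qed
  then have "(\<Sum>b<N. ((shifted_sum f H b - shifted_sum f H (b + H)) / H)\<^sup>2)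
     = 2 * (\<Sum>b<N. (G b)\<^sup>2) + 2 * (\<Sum>b<N. (G (b + H))\<^sup>2)
       - 4 * (\<Sum>b<N. (shifted_sum f (2 * H) b / (2 * H))\<^sup>2)"
    by (simp add: sum.distrib sum_subtractf sum_distrib_left)
  with shift show ?thesis by (simp add: G_def algebra_simps)
qed

text \<open>Passing from scale \<open>H\<close> to \<open>2 H\<close>, the mean square of the local averages drops by a quarter of
  the mean square difference of neighbouring averages. These drops have a bounded sum,
  so among many dyadic scales one has a small drop.\<close>

lemma good_scale:
  fixes \<zeta> :: real
  assumes "0 < \<zeta>"
  shows "\<exists>Hm. \<forall>N\<ge>Hm. \<forall>f :: 'z::finite \<Rightarrow> nat \<Rightarrow> real. (\<forall>z b. \<bar>f z b\<bar> \<le> 1) \<longrightarrow>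
    (\<exists>H. 2 ^ J0 \<le> H \<and> H \<le> Hm \<and>
      (\<Sum>b<N. \<Sum>z\<in>UNIV. \<bar>shifted_sum (f z) H b - shifted_sum (f z) H (b + H)\<bar>) \<le> \<zeta> * N * H)"
proof -
  define c where "c = real CARD('z)"
  have c: "0 < c" by (simp add: c_def)
  \<comment> \<open>Over \<open>J\<close> scales the square differences add up to at most
    \<open>6 * c * N\<close>: four parts from the telescoping energy, two from boundary terms. Some
    scale has at most the share \<open>6 * c * N / J\<close>, and this \<open>J\<close> makes it
    small enough for the last estimate with \<open>k = \<zeta> / c\<close>.\<close>
  obtain J :: nat where J: "6 * c\<^sup>2 / \<zeta>\<^sup>2 < J" using reals_Archimedean2 by blast
  have J0: "0 < J"
    using J c assms by (metis divide_pos_pos gr0I less_asym of_nat_0 zero_less_mult_iff zero_less_numeral zero_less_power)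
  define Hm :: nat where "Hm = 2 ^ (J0 + J)"
  show ?thesis
  proof (rule exI[of _ Hm], intro allI impI)
    fix N :: nat and f :: "'z \<Rightarrow> nat \<Rightarrow> real"
    assume N: "Hm \<le> N" and f: "\<forall>z b. \<bar>f z b\<bar> \<le> 1"
    define h where "h j = (2::nat) ^ (J0 + j)" for j
    have h: "0 < h j" "h (Suc j) = 2 * h j" for j by (auto simp: h_def)
    define E where "E H = (\<Sum>z\<in>UNIV. \<Sum>b<N. (shifted_sum (f z) H b / H)\<^sup>2)" for H :: nat
    define Q where "Q H = (\<Sum>z\<in>UNIV. \<Sum>b<N. ((shifted_sum (f z) H b - shifted_sum (f z) H (b + H)) / H)\<^sup>2)"
      for H :: nat
    have E0: "0 \<le> E H" for H unfolding E_def by (intro sum_nonneg) auto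
    have "E H \<le> (\<Sum>z\<in>(UNIV::'z set). \<Sum>b<N. 1)" if "0 < H" for H
      unfolding E_def
    proof (intro sum_mono)
      fix z b
      have "\<bar>shifted_sum (f z) H b\<bar> \<le> H" by (rule abs_shifted_sum_le) (use f in auto)
      then show "(shifted_sum (f z) H b / real H)\<^sup>2 \<le> 1" using that by (simp add: abs_square_le_1)
    qed
    then have E1: "E H \<le> c * N" if "0 < H" for H using that by (simp add: c_def)
    have step: "Q (h j) \<le> 4 * (E (h j) - E (h (Suc j))) + 2 * c * h j" for j
    proof -
      have "Q (h j) \<le> (\<Sum>z\<in>UNIV. 4 * ((\<Sum>b<N. (shifted_sum (f z) (h j) b / h j)\<^sup>2)
          - (\<Sum>b<N. (shifted_sum (f z) (2 * h j) b / (2 * h j))\<^sup>2)) + 2 * h j)"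
        unfolding Q_def by (intro sum_mono energy_step) (use f h in auto)
      also have "\<dots> = 4 * (E (h j) - E (h (Suc j))) + 2 * c * h j"
        by (simp add: E_def sum.distrib sum_subtractf sum_distrib_left[symmetric] c_def h(2))
      finally show ?thesis .
    qed
    \<comment> \<open>\<open>h\<close> doubles, so the boundary terms of all scales together stay
      below \<open>2 * c * h n\<close>.\<close>
    have tot: "(\<Sum>j<n. Q (h j)) \<le> 4 * (E (h 0) - E (h n)) + 2 * c * h n" for n
    proof (induction n)
      case 0 then show ?case using c by simp
    next
      case (Suc n) then show ?case using step[of n] h(2)[of n] by (simp add: algebra_simps)
    qed
    have "(\<Sum>j<J. Q (h j)) \<le> 4 * (c * N) + 2 * c * N"
    proof -
      have "c * real (h J) \<le> c * real N"
        using N c by (intro mult_left_mono) (auto simp: Hm_def h_def)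
      then show ?thesis using tot[of J] E1[OF h(1)[of 0]] E0[of "h J"]
        by (simp add: algebra_simps)
    qed
    then have tot: "(\<Sum>j<J. Q (h j)) \<le> 6 * c * N" by simp
    have "\<exists>j<J. Q (h j) \<le> 6 * c * N / J"
    proof (rule ccontr)
      assume "\<not> ?thesis"
      then have "(\<Sum>j<J. 6 * c * N / J) < (\<Sum>j<J. Q (h j))"
        using J0 by (intro sum_strict_mono) auto
      then show False using tot J0 by simp
    qed
    then obtain j where j: "j < J" "Q (h j) \<le> 6 * c * N / J" by blast
    define H where "H = h j"
    define v where "v z b = (shifted_sum (f z) H b - shifted_sum (f z) H (b + H)) / H" for z b
    define k where "k = \<zeta> / c"
    have k: "0 < k" using assms c by (simp add: k_def)
    \<comment> \<open>The arithmetic-geometric mean inequality turns a mean square bound into one on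
      absolute values; with \<open>k = \<zeta> / c\<close> each half contributes at most
      \<open>\<zeta> * N / 2\<close>.\<close>
    have am: "\<bar>x\<bar> \<le> k / 2 + x\<^sup>2 / (2 * k)" for x
    proof -
      have "0 \<le> (\<bar>x\<bar> - k)\<^sup>2" by simp
      then have "2 * k * \<bar>x\<bar> \<le> k\<^sup>2 + x\<^sup>2" by (simp add: power2_eq_square algebra_simps abs_mult_self)
      then show ?thesis using k by (simp add: field_simps power2_eq_square)
    qed
    have "(\<Sum>z\<in>UNIV. \<Sum>b<N. \<bar>v z b\<bar>) \<le> (\<Sum>z\<in>(UNIV::'z set). \<Sum>b<N. k / 2 + (v z b)\<^sup>2 / (2 * k))"
      by (intro sum_mono am)
    also have "\<dots> = c * N * k / 2 + Q H / (2 * k)"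
      by (simp add: sum.distrib c_def Q_def v_def sum_divide_distrib)
    also have "\<dots> \<le> c * N * k / 2 + (6 * c * N / J) / (2 * k)"
      using j k by (intro add_left_mono divide_right_mono) (auto simp: H_def)
    also have "\<dots> \<le> \<zeta> * N"
    proof -
      have "6 * c\<^sup>2 \<le> J * \<zeta>\<^sup>2" using J assms by (simp add: field_simps)
      then have "6 * c * c \<le> J * \<zeta> * \<zeta>" by (simp add: power2_eq_square)
      then have "3 * c * c / (J * \<zeta>) \<le> \<zeta> / 2" using J0 assms by (simp add: field_simps)
      then have "N * (3 * c * c / (J * \<zeta>)) \<le> N * (\<zeta> / 2)" by (intro mult_left_mono) auto
      then show ?thesis using c J0 assms by (simp add: k_def field_simps)
    qed
    finally have "(\<Sum>z\<in>UNIV. \<Sum>b<N. \<bar>v z b\<bar>) * H \<le> \<zeta> * N * H" by (intro mult_right_mono) auto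
    moreover have "(\<Sum>b<N. \<Sum>z\<in>UNIV. \<bar>shifted_sum (f z) H b - shifted_sum (f z) H (b + H)\<bar>)
        = (\<Sum>z\<in>UNIV. \<Sum>b<N. \<bar>v z b\<bar>) * H"
      using h(1)[of j] by (subst sum.swap) (simp add: v_def sum_distrib_right H_def)
    moreover have "2 ^ J0 \<le> H" "H \<le> Hm"
      using j(1) by (auto simp: H_def h_def Hm_def intro!: power_increasing)
    ultimately show "\<exists>H. 2 ^ J0 \<le> H \<and> H \<le> Hm \<and>
      (\<Sum>b<N. \<Sum>z\<in>UNIV. \<bar>shifted_sum (f z) H b - shifted_sum (f z) H (b + H)\<bar>) \<le> \<zeta> * N * H"
      by auto
  qed
qed

section \<open>One player over a time window\<close>

text \<open>Blocks make the index proportional to elapsed time \<open>sum \<alpha>\<close>, so that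
  equal numbers of blocks are comparable although the steps decay. \<open>\<eta>\<close> bounds the
  overshoot of a block.\<close>

locale block_clock =
  fixes \<alpha> :: "nat \<Rightarrow> real" and \<kappa> :: "nat \<Rightarrow> nat" and \<epsilon> \<eta> :: real
  assumes step_nonneg: "\<And>k. 0 \<le> \<alpha> k"
    and strict: "strict_mono \<kappa>"
    and \<epsilon>_pos: "0 < \<epsilon>" and \<eta>_le: "\<eta> \<le> \<epsilon>"
    and block_ge: "\<And>b. \<epsilon> \<le> sum \<alpha> {\<kappa> b..<\<kappa> (Suc b)}"
    and block_le: "\<And>b. sum \<alpha> {\<kappa> b..<\<kappa> (Suc b)} \<le> \<epsilon> + \<eta>"
begin

definition A :: "nat \<Rightarrow> real" where
  "A b = sum \<alpha> {\<kappa> b..<\<kappa> (Suc b)}"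

definition avg :: "(nat \<Rightarrow> real) \<Rightarrow> nat \<Rightarrow> real" where
  "avg f b = (\<Sum>k\<in>{\<kappa> b..<\<kappa> (Suc b)}. \<alpha> k * f k) / A b"

lemma A_bounds: "\<epsilon> \<le> A b" "A b \<le> \<epsilon> + \<eta>" "A b \<le> 2 * \<epsilon>" "0 < A b"
  using block_ge[of b] block_le[of b] \<epsilon>_pos \<eta>_le by (auto simp: A_def)

lemma \<eta>_nonneg: "0 \<le> \<eta>"
  using A_bounds[of 0] by linarith

lemma A_avg: "A b * avg f b = (\<Sum>k\<in>{\<kappa> b..<\<kappa> (Suc b)}. \<alpha> k * f k)"
  using A_bounds[of b] by (simp add: avg_def)

lemma avg_mono:
  assumes "\<And>k. \<kappa> b \<le> k \<Longrightarrow> k < \<kappa> (Suc b) \<Longrightarrow> f k \<le> g k"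
  shows "avg f b \<le> avg g b"
  unfolding avg_def using assms A_bounds[of b] step_nonneg
  by (intro divide_right_mono sum_mono mult_left_mono) auto

lemma avg_const [simp]: "avg (\<lambda>k. c) b = c"
  using A_bounds(4)[of b] by (simp add: avg_def sum_distrib_right[symmetric] A_def[symmetric])

lemma avg_add: "avg (\<lambda>k. f k + g k) b = avg f b + avg g b"
  by (simp add: avg_def distrib_left sum.distrib add_divide_distrib)

lemma avg_diff: "avg (\<lambda>k. f k - g k) b = avg f b - avg g b"
  by (simp add: avg_def right_diff_distrib sum_subtractf diff_divide_distrib)

lemma avg_cmult: "avg (\<lambda>k. c * f k) b = c * avg f b"
  by (simp add: avg_def sum_distrib_left mult.left_commute)

lemma avg_sum: "avg (\<lambda>k. \<Sum>i\<in>I. f i k) b = (\<Sum>i\<in>I. avg (f i) b)"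
  unfolding avg_def by (simp add: sum_distrib_left sum_divide_distrib) (rule sum.swap)

lemma abs_avg_le:
  assumes "\<And>k. \<kappa> b \<le> k \<Longrightarrow> k < \<kappa> (Suc b) \<Longrightarrow> \<bar>f k\<bar> \<le> c"
  shows "\<bar>avg f b\<bar> \<le> c"
proof -
  have "avg f b \<le> c" using avg_mono[of b f "\<lambda>_. c"] assms by (simp add: abs_le_iff)
  moreover have "- c \<le> avg f b" using avg_mono[of b "\<lambda>_. - c" f] assms by (force simp: abs_le_iff)
  ultimately show ?thesis by linarith
qed

lemma \<kappa>_mono: "b \<le> c \<Longrightarrow> \<kappa> b \<le> \<kappa> c"
  using strict by (simp add: strict_mono_less_eq)

lemma sum_blocks: "(\<Sum>k\<in>{\<kappa> b..<\<kappa> (b + n)}. f k) = (\<Sum>i<n. \<Sum>k\<in>{\<kappa> (b + i)..<\<kappa> (Suc (b + i))}. f k)"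
  for f :: "nat \<Rightarrow> real"
proof (induction n)
  case (Suc n)
  have "(\<Sum>k\<in>{\<kappa> b..<\<kappa> (b + Suc n)}. f k)
     = (\<Sum>k\<in>{\<kappa> b..<\<kappa> (b + n)}. f k) + (\<Sum>k\<in>{\<kappa> (b + n)..<\<kappa> (Suc (b + n))}. f k)"
    using sum.atLeastLessThan_concat[of "\<kappa> b" "\<kappa> (b + n)" "\<kappa> (Suc (b + n))" f]
      \<kappa>_mono[of b "b + n"] \<kappa>_mono[of "b + n" "Suc (b + n)"] by simp
  then show ?case using Suc by simp
qed simp

lemma time_mono: "a \<le> l \<Longrightarrow> m \<le> c \<Longrightarrow> sum \<alpha> {l..<m} \<le> sum \<alpha> {a..<c}"
  using step_nonneg by (intro sum_mono2) auto

lemma time_blocks: "sum \<alpha> {\<kappa> b..<\<kappa> (b + n)} \<le> 2 * \<epsilon> * n"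
proof -
  have "(\<Sum>i<n. A (b + i)) \<le> (\<Sum>i<n. 2 * \<epsilon>)" by (intro sum_mono A_bounds)
  then show ?thesis by (simp add: sum_blocks A_def mult.commute mult.left_commute)
qed

text \<open>Lets every block count as lasting exactly \<open>\<epsilon>\<close>; the excess
  duration, at most \<open>\<eta>\<close>, goes into the error.\<close>

lemma A_mult_le: "\<bar>x\<bar> \<le> c \<Longrightarrow> A b * x \<le> \<epsilon> * x + \<eta> * c"
proof -
  assume x: "\<bar>x\<bar> \<le> c"
  have "(A b - \<epsilon>) * x \<le> (A b - \<epsilon>) * \<bar>x\<bar>" using A_bounds(1)[of b] by (intro mult_left_mono) auto
  also have "\<dots> \<le> \<eta> * c" using A_bounds(2)[of b] x \<eta>_nonneg by (intro mult_mono) auto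
  finally show ?thesis by (simp add: algebra_simps)
qed

end

text \<open>One player, seen through real sequences. In the application, \<open>p\<close> is the best payoff
  including the player's own entropy bonus, \<open>s\<close> the opponent's negative entropy term,
  \<open>U k l\<close> and \<open>W k l\<close> the payoffs of the player's strategy at stage \<open>k\<close> against the
  opponent's strategy and the opponent's empirical average at stage \<open>l\<close>.\<close>

locale player = block_clock +
  fixes d C e :: real and p s g h :: "nat \<Rightarrow> real" and U W :: "nat \<Rightarrow> nat \<Rightarrow> real"
  assumes d: "0 < d" "d \<le> 1" and e: "0 \<le> e"
    and inc: "\<And>k l. \<kappa> 0 \<le> k \<Longrightarrow> \<kappa> 0 \<le> l \<Longrightarrow> p k - p l \<le> W k k - W k l + e"
    and top: "\<And>k. \<kappa> 0 \<le> k \<Longrightarrow> p k \<le> W k k + g k + e"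
    and W_Suc: "\<And>k l. W k (Suc l) = W k l + d * \<alpha> l * (U k l - W k l)"
    and s_Suc: "\<And>k. s (Suc k) \<le> s k - d * \<alpha> k * (s k + h k)"
    and bounds: "\<And>k. \<bar>p k\<bar> \<le> C" "\<And>k. \<bar>s k\<bar> \<le> C" "\<And>k. \<bar>g k\<bar> \<le> C" "\<And>k. \<bar>h k\<bar> \<le> C"
      "\<And>k l. \<bar>U k l\<bar> \<le> C" "\<And>k l. \<bar>W k l\<bar> \<le> C"
begin

lemma C_nonneg: "0 \<le> C"
  using bounds(1)[of 0] by linarith

lemma W_diff:
  "l \<le> m \<Longrightarrow> W k m - W k l = d * (\<Sum>j\<in>{l..<m}. \<alpha> j * (U k j - W k j))"
  by (induction m rule: dec_induct) (auto simp: W_Suc algebra_simps)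

lemma d_mult_le: "x \<le> c \<Longrightarrow> 0 \<le> c \<Longrightarrow> d * x \<le> c"
proof -
  assume x: "x \<le> c" "0 \<le> c"
  have "d * x \<le> d * c" using d x by (intro mult_left_mono) auto
  also have "\<dots> \<le> 1 * c" using d x by (intro mult_right_mono) auto
  finally show ?thesis by simp
qed

lemma UW_bound: "\<bar>U k j - W k l\<bar> \<le> 2 * C"
  using bounds(5)[of k j] bounds(6)[of k l] by linarith

lemma W_lip:
  assumes "l \<le> m"
  shows "\<bar>W k m - W k l\<bar> \<le> 2 * C * sum \<alpha> {l..<m}"
proof -
  have "\<bar>\<Sum>j\<in>{l..<m}. \<alpha> j * (U k j - W k j)\<bar> \<le> (\<Sum>j\<in>{l..<m}. \<bar>\<alpha> j * (U k j - W k j)\<bar>)"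
    by (rule sum_abs)
  also have "\<dots> \<le> (\<Sum>j\<in>{l..<m}. \<alpha> j * (2 * C))"
    using step_nonneg UW_bound by (intro sum_mono) (auto simp: abs_mult intro!: mult_left_mono)
  finally have "\<bar>\<Sum>j\<in>{l..<m}. \<alpha> j * (U k j - W k j)\<bar> \<le> 2 * C * sum \<alpha> {l..<m}"
    by (simp add: sum_distrib_left mult.commute)
  moreover have "\<bar>d * x\<bar> \<le> \<bar>x\<bar>" for x
    using d by (simp add: abs_mult mult_left_le_one_le)
  ultimately show ?thesis unfolding W_diff[OF assms] by (meson order_trans)
qed

text \<open>\<open>inc\<close> is used with either stage in the leading role, which makes
  \<open>p\<close> Lipschitz in elapsed time although its slope jumps.\<close>

lemma p_lip:
  assumes "\<kappa> 0 \<le> l" "l \<le> m"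
  shows "\<bar>p m - p l\<bar> \<le> 2 * C * sum \<alpha> {l..<m} + e"
  using inc[of m l] inc[of l m] W_lip[of l m m] W_lip[of l m l] assms by (auto simp: abs_le_iff)

text \<open>One-sided on purpose: in the application \<open>s\<close> is a negative entropy, whose
  fall is not bounded linearly in time.\<close>

lemma s_upper:
  assumes "l \<le> m"
  shows "s m \<le> s l + 2 * C * sum \<alpha> {l..<m}"
  using assms
proof (induction m rule: dec_induct)
  case (step n)
  have "d * (\<alpha> n * (- s n - h n)) \<le> \<alpha> n * (2 * C)"
    using step_nonneg[of n] bounds(2)[of n] bounds(4)[of n] C_nonneg
    by (intro d_mult_le mult_left_mono) auto
  then show ?case using step s_Suc[of n] by (simp add: algebra_simps)
qed simp

text \<open>For bilinear \<open>U\<close> this is the payoff of the mean strategy on block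
  \<open>b\<close> against the opponent's mean strategy on block \<open>c\<close>.\<close>

definition ub :: "nat \<Rightarrow> nat \<Rightarrow> real" where
  "ub b c = avg (\<lambda>k. avg (U k) c) b"

definition w :: "nat \<Rightarrow> real" where
  "w b = avg (\<lambda>k. W k (\<kappa> b)) b"

lemma block_time:
  assumes "\<kappa> b \<le> l" "l \<le> k" "k < \<kappa> (Suc b)"
  shows "2 * C * sum \<alpha> {l..<k} \<le> 4 * C * \<epsilon>"
proof -
  have "sum \<alpha> {l..<k} \<le> sum \<alpha> {\<kappa> b..<\<kappa> (Suc b)}" using assms by (intro time_mono) auto
  also have "\<dots> \<le> 2 * \<epsilon>" using A_bounds(3)[of b] by (simp add: A_def)
  finally have "2 * C * sum \<alpha> {l..<k} \<le> 2 * C * (2 * \<epsilon>)" using C_nonneg by (intro mult_left_mono) auto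
  then show ?thesis by simp
qed

text \<open>\<open>inc\<close> is applied at every stage \<open>k\<close> of the block that follows
  the \<open>H\<close> blocks and then averaged over \<open>k\<close>; a strategy that may jump is
  thereby replaced by its block average. The errors stem from unequal durations
  (\<open>\<eta>\<close>), from freezing \<open>W k\<close> over the \<open>H\<close> blocks
  (\<open>\<epsilon>\<^sup>2\<close>), and from moving the endpoint within one block.\<close>

lemma increment_over_blocks:
  "p (\<kappa> (b + H)) - p (\<kappa> b) \<le> d * \<epsilon> * (\<Sum>i<H. ub (b + H) (b + i) - w (b + H))
     + (2 * C * \<eta> * H + 8 * C * \<epsilon>\<^sup>2 * (real H)\<^sup>2 + 8 * C * \<epsilon> + 2 * e)" (is "_ \<le> _ + ?err")
proof -
  let ?K = "\<kappa> (b + H)"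
  have pointwise: "p ?K - p (\<kappa> b) \<le> d * \<epsilon> * (\<Sum>i<H. avg (U k) (b + i) - W k ?K) + ?err"
    if k: "?K \<le> k" "k < \<kappa> (Suc (b + H))" for k
  proof -
    have bK: "\<kappa> b \<le> ?K" by (rule \<kappa>_mono) simp
    have b0: "\<kappa> 0 \<le> \<kappa> b" by (rule \<kappa>_mono) simp
    have 1: "p ?K \<le> p k + 4 * C * \<epsilon> + e"
      using p_lip[of ?K k] block_time[of "b + H" ?K k] k b0 bK by (auto simp: abs_le_iff)
    have 2: "p k - p (\<kappa> b) \<le> W k k - W k (\<kappa> b) + e" using k b0 bK by (intro inc) auto
    have 3: "W k k \<le> W k ?K + 4 * C * \<epsilon>"
      using W_lip[of ?K k k] block_time[of "b + H" ?K k] k by (auto simp: abs_le_iff)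
    have "(\<Sum>j\<in>{\<kappa> b..<?K}. \<alpha> j * (U k j - W k j))
        \<le> (\<Sum>j\<in>{\<kappa> b..<?K}. \<alpha> j * (U k j - W k ?K) + \<alpha> j * (4 * C * \<epsilon> * H))"
    proof (intro sum_mono)
      fix j assume j: "j \<in> {\<kappa> b..<?K}"
      have "sum \<alpha> {j..<?K} \<le> 2 * \<epsilon> * H"
        using time_mono[of "\<kappa> b" j ?K ?K] time_blocks[of b H] j by auto
      then have "2 * C * sum \<alpha> {j..<?K} \<le> 2 * C * (2 * \<epsilon> * H)" using C_nonneg by (intro mult_left_mono) auto
      then have "U k j - W k j \<le> U k j - W k ?K + 4 * C * \<epsilon> * H"
        using W_lip[of j ?K k] j by (auto simp: abs_le_iff)
      then have "\<alpha> j * (U k j - W k j) \<le> \<alpha> j * (U k j - W k ?K + 4 * C * \<epsilon> * H)"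
        using step_nonneg by (rule mult_left_mono)
      then show "\<alpha> j * (U k j - W k j) \<le> \<alpha> j * (U k j - W k ?K) + \<alpha> j * (4 * C * \<epsilon> * H)"
        by (simp add: distrib_left)
    qed
    also have "\<dots> = (\<Sum>j\<in>{\<kappa> b..<?K}. \<alpha> j * (U k j - W k ?K)) + sum \<alpha> {\<kappa> b..<?K} * (4 * C * \<epsilon> * H)"
      by (simp add: sum.distrib sum_distrib_right)
    also have "sum \<alpha> {\<kappa> b..<?K} * (4 * C * \<epsilon> * H) \<le> 2 * \<epsilon> * H * (4 * C * \<epsilon> * H)"
      using time_blocks[of b H] C_nonneg \<epsilon>_pos by (intro mult_right_mono) auto
    also have "\<dots> = 8 * C * \<epsilon>\<^sup>2 * (real H)\<^sup>2" by (simp add: power2_eq_square)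
    also have "(\<Sum>j\<in>{\<kappa> b..<?K}. \<alpha> j * (U k j - W k ?K)) = (\<Sum>i<H. A (b + i) * (avg (U k) (b + i) - W k ?K))"
    proof -
      have "(\<Sum>j\<in>{\<kappa> (b + i)..<\<kappa> (Suc (b + i))}. \<alpha> j * (U k j - W k ?K))
          = A (b + i) * (avg (U k) (b + i) - W k ?K)" for i
        using A_avg[of "b + i" "\<lambda>j. U k j - W k ?K"] by (simp add: avg_diff)
      then show ?thesis by (simp add: sum_blocks)
    qed
    also have "\<dots> \<le> (\<Sum>i<H. \<epsilon> * (avg (U k) (b + i) - W k ?K) + \<eta> * (2 * C))"
    proof (intro sum_mono A_mult_le)
      fix i
      have "\<bar>avg (U k) (b + i)\<bar> \<le> C" by (intro abs_avg_le bounds)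
      then show "\<bar>avg (U k) (b + i) - W k ?K\<bar> \<le> 2 * C" using bounds(6)[of k ?K] by linarith
    qed
    also have "\<dots> = \<epsilon> * (\<Sum>i<H. avg (U k) (b + i) - W k ?K) + 2 * C * \<eta> * H"
      by (simp add: sum.distrib sum_distrib_left)
    finally have "(\<Sum>j\<in>{\<kappa> b..<?K}. \<alpha> j * (U k j - W k j)) - \<epsilon> * (\<Sum>i<H. avg (U k) (b + i) - W k ?K)
       \<le> 2 * C * \<eta> * H + 8 * C * \<epsilon>\<^sup>2 * (real H)\<^sup>2" by linarith
    then have "d * ((\<Sum>j\<in>{\<kappa> b..<?K}. \<alpha> j * (U k j - W k j)) - \<epsilon> * (\<Sum>i<H. avg (U k) (b + i) - W k ?K))
       \<le> 2 * C * \<eta> * H + 8 * C * \<epsilon>\<^sup>2 * (real H)\<^sup>2"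
      using C_nonneg \<eta>_nonneg by (intro d_mult_le) auto
    then have "W k ?K - W k (\<kappa> b) \<le> d * \<epsilon> * (\<Sum>i<H. avg (U k) (b + i) - W k ?K)
       + (2 * C * \<eta> * H + 8 * C * \<epsilon>\<^sup>2 * (real H)\<^sup>2)"
      unfolding W_diff[OF bK, of k] by (simp add: right_diff_distrib mult.assoc)
    with 1 2 3 show ?thesis by linarith
  qed
  have "avg (\<lambda>k. p ?K - p (\<kappa> b)) (b + H)
      \<le> avg (\<lambda>k. d * \<epsilon> * (\<Sum>i<H. avg (U k) (b + i) - W k ?K) + ?err) (b + H)"
    by (intro avg_mono pointwise) auto
  also have "\<dots> = d * \<epsilon> * (\<Sum>i<H. ub (b + H) (b + i) - w (b + H)) + ?err"
    unfolding avg_add avg_cmult avg_sum avg_diff avg_const ub_def w_def ..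
  finally show ?thesis by simp
qed

lemma w_ge: "p (\<kappa> b) - (8 * C * \<epsilon> + 2 * e) \<le> w b + avg g b"
proof -
  have "avg (\<lambda>k. p (\<kappa> b) - (8 * C * \<epsilon> + 2 * e)) b \<le> avg (\<lambda>k. W k (\<kappa> b) + g k) b"
  proof (intro avg_mono)
    fix k assume k: "\<kappa> b \<le> k" "k < \<kappa> (Suc b)"
    have b0: "\<kappa> 0 \<le> \<kappa> b" by (rule \<kappa>_mono) simp
    show "p (\<kappa> b) - (8 * C * \<epsilon> + 2 * e) \<le> W k (\<kappa> b) + g k"
      using p_lip[of "\<kappa> b" k] W_lip[of "\<kappa> b" k k] top[of k] block_time[of b "\<kappa> b" k] k b0
      by (auto simp: abs_le_iff)
  qed
  then show ?thesis by (simp add: avg_add w_def)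
qed

text \<open>\<open>s_upper\<close> bounds each earlier \<open>s k\<close> from below by the final
  value up to \<open>2 * C * \<Theta>\<close>, so the decay can be charged to the value at the end
  of the window.\<close>

lemma s_over_window:
  assumes "2 * \<epsilon> * N \<le> \<Theta>"
  shows "s (\<kappa> (b + N)) - s (\<kappa> b) \<le> - d * \<epsilon> * (\<Sum>i<N. s (\<kappa> (b + N)) + avg h (b + i))
      + (2 * C * \<eta> * N + 4 * C * \<Theta> * \<epsilon> * N)"
proof -
  let ?K = "\<kappa> (b + N)"
  have bK: "\<kappa> b \<le> ?K" by (rule \<kappa>_mono) simp
  have "s m - s (\<kappa> b) \<le> (\<Sum>k\<in>{\<kappa> b..<m}. d * (\<alpha> k * - (s ?K + h k) + \<alpha> k * (2 * C * \<Theta>)))"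
    if "\<kappa> b \<le> m" "m \<le> ?K" for m
    using that
  proof (induction m rule: dec_induct)
    case (step k)
    have "sum \<alpha> {k..<?K} \<le> \<Theta>"
      using time_mono[of "\<kappa> b" k ?K ?K] time_blocks[of b N] assms step by auto
    then have "2 * C * sum \<alpha> {k..<?K} \<le> 2 * C * \<Theta>" using C_nonneg by (intro mult_left_mono) auto
    then have "- (s k + h k) \<le> - (s ?K + h k) + 2 * C * \<Theta>"
      using s_upper[of k ?K] step by auto
    then have "d * (\<alpha> k * - (s k + h k)) \<le> d * (\<alpha> k * (- (s ?K + h k) + 2 * C * \<Theta>))"
      using step_nonneg[of k] d by (intro mult_left_mono) auto
    then show ?case using step s_Suc[of k] by (simp add: algebra_simps)
  qed simp
  from this[OF bK order_refl] have "s ?K - s (\<kappa> b) \<le>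
     d * ((\<Sum>k\<in>{\<kappa> b..<?K}. \<alpha> k * - (s ?K + h k)) + sum \<alpha> {\<kappa> b..<?K} * (2 * C * \<Theta>))"
    by (simp only: sum_distrib_left[symmetric] sum_distrib_right[symmetric] sum.distrib)
  moreover have "(\<Sum>k\<in>{\<kappa> b..<?K}. \<alpha> k * - (s ?K + h k)) = (\<Sum>i<N. A (b + i) * - (s ?K + avg h (b + i)))"
  proof -
    have "(\<Sum>k\<in>{\<kappa> (b + i)..<\<kappa> (Suc (b + i))}. \<alpha> k * - (s ?K + h k))
        = A (b + i) * - (s ?K + avg h (b + i))" for i
      using A_avg[of "b + i" "\<lambda>k. - 1 * (s ?K + h k)"] by (simp only: avg_cmult avg_add avg_const) simp
    then show ?thesis by (simp only: sum_blocks)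
  qed
  moreover have "\<dots> \<le> (\<Sum>i<N. \<epsilon> * - (s ?K + avg h (b + i)) + \<eta> * (2 * C))"
  proof (intro sum_mono A_mult_le)
    fix i
    have "\<bar>avg h (b + i)\<bar> \<le> C" by (intro abs_avg_le bounds)
    then show "\<bar>- (s ?K + avg h (b + i))\<bar> \<le> 2 * C" using bounds(2)[of ?K] by linarith
  qed
  moreover have "\<dots> = - \<epsilon> * (\<Sum>i<N. s ?K + avg h (b + i)) + 2 * C * \<eta> * N"
    by (simp add: sum.distrib sum_subtractf sum_distrib_left[symmetric] algebra_simps)
  moreover have "sum \<alpha> {\<kappa> b..<?K} * (2 * C * \<Theta>) \<le> 2 * \<epsilon> * N * (2 * C * \<Theta>)"
  proof -
    have "0 \<le> 2 * \<epsilon> * N" using \<epsilon>_pos by simp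
    then have "0 \<le> \<Theta>" using assms by linarith
    then show ?thesis using time_blocks[of b N] C_nonneg by (intro mult_right_mono) auto
  qed
  ultimately have "s ?K - s (\<kappa> b) \<le> d * (- \<epsilon> * (\<Sum>i<N. s ?K + avg h (b + i))
      + (2 * C * \<eta> * N + 4 * C * \<Theta> * \<epsilon> * N))"
    using d by (elim order_trans) (intro mult_left_mono, auto simp: algebra_simps)
  also have "\<dots> = - d * \<epsilon> * (\<Sum>i<N. s ?K + avg h (b + i)) + d * (2 * C * \<eta> * N + 4 * C * \<Theta> * \<epsilon> * N)"
    by (simp add: algebra_simps)
  also have "d * (2 * C * \<eta> * N + 4 * C * \<Theta> * \<epsilon> * N) \<le> 2 * C * \<eta> * N + 4 * C * \<Theta> * \<epsilon> * N"
  proof -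
    have "0 \<le> 2 * \<epsilon> * N" using \<epsilon>_pos by simp
    then have "0 \<le> \<Theta>" using assms by linarith
    then show ?thesis using C_nonneg \<eta>_nonneg \<epsilon>_pos by (intro d_mult_le) auto
  qed
  finally show ?thesis by simp
qed

text \<open>Increments over overlapping runs of \<open>H\<close> blocks are added. The sum
  telescopes to two groups of \<open>H\<close> values of \<open>p\<close> near the ends of the
  window, each close to \<open>H\<close> times an endpoint value. Division by \<open>H\<close>
  leaves the increment over the window, with each strategy paired with the mean of the preceding
  \<open>H\<close> blocks.\<close>

lemma p_over_window:
  assumes H: "0 < H" and \<Theta>: "2 * \<epsilon> * N \<le> \<Theta>"
  shows "p (\<kappa> (H + N)) - p (\<kappa> H)
    \<le> d * \<epsilon> * (\<Sum>b<N. (\<Sum>i<H. ub (H + b) (b + i)) / H + avg g (H + b) - p (\<kappa> (H + N)))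
      + (N * (2 * C * \<eta> + 8 * C * \<epsilon>\<^sup>2 * H + (8 * C * \<epsilon> + 2 * e) / H) + 8 * C * \<epsilon> * H + 2 * e
        + N * \<epsilon> * (8 * C * \<epsilon> + 3 * e + 2 * C * \<Theta>))"
proof -
  let ?P = "\<lambda>b. p (\<kappa> b)"
  have near: "\<bar>?P (b + i) - ?P b\<bar> \<le> 4 * C * \<epsilon> * n + e" if "i \<le> n" for b i n
  proof -
    have "2 * C * sum \<alpha> {\<kappa> b..<\<kappa> (b + i)} \<le> 2 * C * (2 * \<epsilon> * n)"
    proof (intro mult_left_mono)
      show "sum \<alpha> {\<kappa> b..<\<kappa> (b + i)} \<le> 2 * \<epsilon> * n"
        using time_mono[of "\<kappa> b" "\<kappa> b" "\<kappa> (b + i)" "\<kappa> (b + n)"] \<kappa>_mono[of "b + i" "b + n"]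
          time_blocks[of b n] that by auto
    qed (use C_nonneg in auto)
    then show ?thesis using p_lip[of "\<kappa> b" "\<kappa> (b + i)"] \<kappa>_mono[of 0 b] \<kappa>_mono[of b "b + i"] by auto
  qed
  have "H * (?P (H + N) - ?P H) - H * (8 * C * \<epsilon> * H + 2 * e)
      = (\<Sum>i<H. ?P (H + N) - ?P H - (8 * C * \<epsilon> * H + 2 * e))"
    by (simp add: algebra_simps)
  also have "\<dots> \<le> (\<Sum>i<H. ?P (N + i) - ?P i)"
  proof (intro sum_mono)
    fix i assume "i \<in> {..<H}"
    then have i: "H - i \<le> H" "i + (H - i) = H" "N + i + (H - i) = H + N" by auto
    show "?P (H + N) - ?P H - (8 * C * \<epsilon> * H + 2 * e) \<le> ?P (N + i) - ?P i"
      using near[OF i(1), of i] near[OF i(1), of "N + i"] unfolding i by (auto simp: abs_le_iff)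
  qed
  also have "\<dots> = (\<Sum>b<N. ?P (b + H) - ?P b)"
    using sum_shift_diff[of ?P H N] by (simp add: sum_subtractf)
  also have "\<dots> \<le> (\<Sum>b<N. d * \<epsilon> * (\<Sum>i<H. ub (b + H) (b + i) - w (b + H))
     + (2 * C * \<eta> * H + 8 * C * \<epsilon>\<^sup>2 * (real H)\<^sup>2 + 8 * C * \<epsilon> + 2 * e))"
    by (intro sum_mono increment_over_blocks)
  also have "\<dots> = H * (d * \<epsilon> * (\<Sum>b<N. (\<Sum>i<H. ub (b + H) (b + i)) / H - w (b + H))
     + N * (2 * C * \<eta> + 8 * C * \<epsilon>\<^sup>2 * H + (8 * C * \<epsilon> + 2 * e) / H))"
    using H by (simp add: sum.distrib sum_subtractf sum_divide_distrib[symmetric]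
        sum_distrib_left[symmetric] field_simps power2_eq_square)
  finally have "H * (?P (H + N) - ?P H) \<le> H * (d * \<epsilon> * (\<Sum>b<N. (\<Sum>i<H. ub (b + H) (b + i)) / H - w (b + H))
     + N * (2 * C * \<eta> + 8 * C * \<epsilon>\<^sup>2 * H + (8 * C * \<epsilon> + 2 * e) / H) + (8 * C * \<epsilon> * H + 2 * e))"
    by (simp add: distrib_left)
  then have main: "?P (H + N) - ?P H \<le> d * \<epsilon> * (\<Sum>b<N. (\<Sum>i<H. ub (b + H) (b + i)) / H - w (b + H))
     + N * (2 * C * \<eta> + 8 * C * \<epsilon>\<^sup>2 * H + (8 * C * \<epsilon> + 2 * e) / H) + (8 * C * \<epsilon> * H + 2 * e)"
    using H by simp
  \<comment> \<open>As for \<open>s\<close>, the decay is charged to the final value.\<close>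
  have end_le: "?P (H + N) \<le> ?P (b + H) + 2 * C * \<Theta> + e" if "b < N" for b
  proof -
    have i: "N - b \<le> N" "b + H + (N - b) = H + N" using that by auto
    have "2 * C * (2 * \<epsilon> * N) \<le> 2 * C * \<Theta>" using C_nonneg \<Theta> by (intro mult_left_mono) auto
    then show ?thesis using near[OF i(1), of "b + H"] unfolding i by auto
  qed
  have "(\<Sum>b<N. (\<Sum>i<H. ub (b + H) (b + i)) / H - w (b + H))
    \<le> (\<Sum>b<N. ((\<Sum>i<H. ub (b + H) (b + i)) / H + avg g (b + H) - ?P (H + N))
        + (8 * C * \<epsilon> + 3 * e + 2 * C * \<Theta>))"
  proof (intro sum_mono)
    fix b assume "b \<in> {..<N}"
    then show "(\<Sum>i<H. ub (b + H) (b + i)) / H - w (b + H)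
        \<le> ((\<Sum>i<H. ub (b + H) (b + i)) / H + avg g (b + H) - ?P (H + N))
        + (8 * C * \<epsilon> + 3 * e + 2 * C * \<Theta>)"
      using w_ge[of "b + H"] end_le[of b] by simp
  qed
  also have "\<dots> = (\<Sum>b<N. (\<Sum>i<H. ub (b + H) (b + i)) / H + avg g (b + H) - ?P (H + N))
        + N * (8 * C * \<epsilon> + 3 * e + 2 * C * \<Theta>)"
    by (simp add: sum.distrib)
  finally have "d * \<epsilon> * (\<Sum>b<N. (\<Sum>i<H. ub (b + H) (b + i)) / H - w (b + H))
    \<le> d * \<epsilon> * ((\<Sum>b<N. (\<Sum>i<H. ub (b + H) (b + i)) / H + avg g (b + H) - ?P (H + N))
        + N * (8 * C * \<epsilon> + 3 * e + 2 * C * \<Theta>))"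
    using d \<epsilon>_pos by (intro mult_left_mono) auto
  also have "\<dots> = d * \<epsilon> * (\<Sum>b<N. (\<Sum>i<H. ub (b + H) (b + i)) / H + avg g (b + H) - ?P (H + N))
     + d * (N * \<epsilon> * (8 * C * \<epsilon> + 3 * e + 2 * C * \<Theta>))"
    by (simp add: algebra_simps)
  also have "d * (N * \<epsilon> * (8 * C * \<epsilon> + 3 * e + 2 * C * \<Theta>)) \<le> N * \<epsilon> * (8 * C * \<epsilon> + 3 * e + 2 * C * \<Theta>)"
  proof -
    have "0 \<le> 2 * \<epsilon> * N" using \<epsilon>_pos by simp
    then have "0 \<le> \<Theta>" using \<Theta> by linarith
    then show ?thesis using C_nonneg e \<epsilon>_pos by (intro d_mult_le) auto
  qed
  finally show ?thesis using main by (simp add: add.commute[of _ H])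
qed

text \<open>Collects the errors. \<open>CH\<close> dilutes the endpoint error of each increment,
  \<open>CN\<close> makes the window long against \<open>H\<close>, and the bound on
  \<open>2 * C * \<epsilon> * (N + H)\<close> keeps it short in time. The 49 multiples of
  \<open>\<rho> * \<epsilon> * N\<close> that arise are rounded up to 60.\<close>

lemma player_over_window:
  assumes H: "0 < H" and CH: "C \<le> \<rho> * H" and CN: "C * H \<le> \<rho> * N"
    and \<Theta>: "2 * C * \<epsilon> * (N + H) \<le> \<rho>" and \<eta>\<rho>: "C * \<eta> \<le> \<rho> * \<epsilon>" and e\<rho>: "e \<le> \<rho> * \<epsilon>"
    and N: "0 < N" and \<epsilon>1: "\<epsilon> \<le> 1"
  shows "(p (\<kappa> (H + N)) + s (\<kappa> (H + N))) - (p (\<kappa> H) + s (\<kappa> H))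
    \<le> d * \<epsilon> * ((\<Sum>b<N. (\<Sum>i<H. ub (H + b) (b + i)) / H + avg g (H + b) - avg h (H + b))
        - N * (p (\<kappa> (H + N)) + s (\<kappa> (H + N)))) + 60 * \<rho> * \<epsilon> * N"
proof -
  have H1: "1 \<le> real H" and N1: "1 \<le> real N" using H N by auto
  define \<Theta> where "\<Theta> = 2 * \<epsilon> * N"
  define X where "X = N * \<epsilon>"
  have X: "0 < X" using N \<epsilon>_pos by (simp add: X_def)
  have \<rho>: "0 \<le> \<rho>"
    using e\<rho> e \<epsilon>_pos by (meson order_trans zero_le_mult_iff not_le)
  have C0: "0 \<le> C" by (rule C_nonneg)
  have C\<Theta>: "C * \<Theta> \<le> \<rho>"
  proof -
    have "0 \<le> C * \<epsilon> * H" using C0 \<epsilon>_pos by simp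
    then show ?thesis using \<Theta> by (simp add: \<Theta>_def algebra_simps)
  qed
  have C\<epsilon>H: "C * \<epsilon> * H \<le> \<rho>"
  proof -
    have "0 \<le> C * \<epsilon> * H" "0 \<le> C * \<epsilon> * N" using C0 \<epsilon>_pos by simp_all
    then show ?thesis using \<Theta> by (simp add: algebra_simps)
  qed
  have C\<epsilon>: "C * \<epsilon> \<le> \<rho>"
    using mult_left_mono[OF H1, of "C * \<epsilon>"] C\<epsilon>H C0 \<epsilon>_pos by simp
  have t1: "N * (C * \<eta>) \<le> \<rho> * X"
    using mult_left_mono[OF \<eta>\<rho>, of "real N"] by (simp add: X_def algebra_simps)
  have t2: "N * (C * \<epsilon>\<^sup>2 * H) \<le> \<rho> * X"
    using mult_right_mono[OF C\<epsilon>H, of X] X by (simp add: X_def power2_eq_square algebra_simps)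
  have t3: "N * (C * \<epsilon> / H) \<le> \<rho> * X"
  proof -
    have "C / H \<le> \<rho>" using CH H by (simp add: field_simps)
    from mult_right_mono[OF this, of X] show ?thesis using X by (simp add: X_def field_simps)
  qed
  have t4: "N * (e / H) \<le> \<rho> * X"
  proof -
    have "e / H \<le> e" using H1 e mult_left_mono[of 1 "real H" e] by (simp add: divide_le_eq)
    then have "N * (e / H) \<le> N * (\<rho> * \<epsilon>)" using e\<rho> by (intro mult_left_mono) auto
    then show ?thesis by (simp add: X_def algebra_simps)
  qed
  have t5: "C * \<epsilon> * H \<le> \<rho> * X"
    using mult_left_mono[OF CN, of \<epsilon>] \<epsilon>_pos by (simp add: X_def algebra_simps)
  have t6: "e \<le> \<rho> * X"
  proof -
    have "\<rho> * \<epsilon> * 1 \<le> \<rho> * \<epsilon> * N" using \<rho> \<epsilon>_pos N1 by (intro mult_left_mono) auto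
    then show ?thesis using e\<rho> by (simp add: X_def algebra_simps)
  qed
  have t7: "X * (C * \<epsilon>) \<le> \<rho> * X" "X * (C * \<Theta>) \<le> \<rho> * X"
    using mult_left_mono[OF C\<epsilon>, of X] mult_left_mono[OF C\<Theta>, of X] X by (auto simp: mult.commute)
  have t8: "X * e \<le> \<rho> * X"
  proof -
    have "e \<le> \<rho>" using e\<rho> \<rho> \<epsilon>1 \<epsilon>_pos by (meson mult_left_le order_trans)
    from mult_left_mono[OF this, of X] show ?thesis using X by (simp add: mult.commute)
  qed
  have e1: "N * (2 * C * \<eta> + 8 * C * \<epsilon>\<^sup>2 * H + (8 * C * \<epsilon> + 2 * e) / H) + 8 * C * \<epsilon> * H + 2 * e
        + N * \<epsilon> * (8 * C * \<epsilon> + 3 * e + 2 * C * \<Theta>)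
     = 2 * (N * (C * \<eta>)) + 8 * (N * (C * \<epsilon>\<^sup>2 * H)) + 8 * (N * (C * \<epsilon> / H)) + 2 * (N * (e / H))
       + 8 * (C * \<epsilon> * H) + 2 * e + (8 * (X * (C * \<epsilon>)) + 3 * (X * e) + 2 * (X * (C * \<Theta>)))"
    by (simp add: X_def algebra_simps add_divide_distrib)
  have e2: "2 * C * \<eta> * N + 4 * C * \<Theta> * \<epsilon> * N = 2 * (N * (C * \<eta>)) + 4 * (X * (C * \<Theta>))"
    by (simp add: X_def algebra_simps)
  have "0 \<le> \<rho> * X" using \<rho> X by simp
  then have err: "N * (2 * C * \<eta> + 8 * C * \<epsilon>\<^sup>2 * H + (8 * C * \<epsilon> + 2 * e) / H) + 8 * C * \<epsilon> * H + 2 * e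
        + N * \<epsilon> * (8 * C * \<epsilon> + 3 * e + 2 * C * \<Theta>) + (2 * C * \<eta> * N + 4 * C * \<Theta> * \<epsilon> * N) \<le> 60 * (\<rho> * X)"
    unfolding e1 e2 using t1 t2 t3 t4 t5 t6 t7 t8 by linarith
  have "d * \<epsilon> * (\<Sum>b<N. (\<Sum>i<H. ub (H + b) (b + i)) / H + avg g (H + b) - p (\<kappa> (H + N)))
      + - d * \<epsilon> * (\<Sum>i<N. s (\<kappa> (H + N)) + avg h (H + i))
     = d * \<epsilon> * ((\<Sum>b<N. (\<Sum>i<H. ub (H + b) (b + i)) / H + avg g (H + b) - avg h (H + b))
        - N * (p (\<kappa> (H + N)) + s (\<kappa> (H + N))))"
    by (simp add: sum.distrib sum_subtractf algebra_simps)
  then show ?thesis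
    using p_over_window[OF H, of N \<Theta>] s_over_window[of N \<Theta> H] err by (simp add: \<Theta>_def X_def algebra_simps)
qed

end

section \<open>The bilinear game over a time window\<close>

lemma prob_simplexD:
  assumes "\<mu> \<in> prob_simplex"
  shows "0 \<le> \<mu> z" "sum \<mu> UNIV = 1" "\<mu> z \<le> 1" "\<bar>\<mu> z\<bar> \<le> 1"
proof -
  show 1: "0 \<le> \<mu> z" and 2: "sum \<mu> UNIV = 1" for z using assms by (auto simp: prob_simplex_def)
  have "\<mu> z \<le> sum \<mu> UNIV" using 1 by (intro member_le_sum) auto
  then show "\<mu> z \<le> 1" "\<bar>\<mu> z\<bar> \<le> 1" using 2 1[of z] by auto
qed

lemma bil_add_right: "bil \<mu> R (\<lambda>z. v z + w z) = bil \<mu> R v + bil \<mu> R w"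
  by (simp add: bil_def algebra_simps sum.distrib)

lemma bil_diff_right: "bil \<mu> R (\<lambda>z. v z - w z) = bil \<mu> R v - bil \<mu> R w"
  by (simp add: bil_def algebra_simps sum_subtractf)

lemma bil_cmult_right: "bil \<mu> R (\<lambda>z. c * v z) = c * bil \<mu> R v"
  by (simp add: bil_def sum_distrib_left mult.left_commute)

lemma bil_swap: "bil \<mu> R v = bil v (\<lambda>b a. R a b) \<mu>"
  unfolding bil_def by (subst sum.swap) (simp add: mult.commute mult.left_commute)

lemma bil_sum_right: "bil \<mu> R (\<lambda>z. \<Sum>i\<in>I. v i z) = (\<Sum>i\<in>I. bil \<mu> R (v i))"
proof -
  have "bil \<mu> R (\<lambda>z. \<Sum>i\<in>I. v i z) = (\<Sum>a\<in>UNIV. \<Sum>b\<in>UNIV. \<Sum>i\<in>I. \<mu> a * R a b * v i b)"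
    by (simp add: bil_def sum_distrib_left)
  also have "\<dots> = (\<Sum>a\<in>UNIV. \<Sum>i\<in>I. \<Sum>b\<in>UNIV. \<mu> a * R a b * v i b)"
    by (intro sum.cong refl sum.swap)
  also have "\<dots> = (\<Sum>i\<in>I. bil \<mu> R (v i))"
    unfolding bil_def by (rule sum.swap)
  finally show ?thesis .
qed

lemma abs_bil_le:
  assumes "\<mu> \<in> prob_simplex" and R: "\<And>a b. \<bar>R a b\<bar> \<le> C"
  shows "\<bar>bil \<mu> R v\<bar> \<le> C * (\<Sum>b\<in>UNIV. \<bar>v b\<bar>)"
proof -
  have "\<bar>bil \<mu> R v\<bar> \<le> (\<Sum>a\<in>UNIV. \<Sum>b\<in>UNIV. \<bar>\<mu> a * R a b * v b\<bar>)"
    unfolding bil_def by (rule order_trans[OF sum_abs]) (intro sum_mono sum_abs)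
  also have "\<dots> \<le> (\<Sum>a\<in>UNIV. \<Sum>b\<in>UNIV. \<mu> a * (C * \<bar>v b\<bar>))"
    using prob_simplexD(1)[OF assms(1)]
    by (intro sum_mono) (auto simp: abs_mult mult.assoc intro!: mult_left_mono mult_right_mono R)
  also have "\<dots> = C * (\<Sum>b\<in>UNIV. \<bar>v b\<bar>)"
    using prob_simplexD(2)[OF assms(1)]
    by (simp add: sum_distrib_left[symmetric] sum_distrib_right[symmetric])
  finally show ?thesis .
qed

lemma abs_bil_simplex_le:
  assumes "\<mu> \<in> prob_simplex" "\<nu> \<in> prob_simplex" "\<And>a b. \<bar>R a b\<bar> \<le> C"
  shows "\<bar>bil \<mu> R \<nu>\<bar> \<le> C"
  using abs_bil_le[OF assms(1,3), where v = \<nu>] prob_simplexD[OF assms(2)] by simp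

context block_clock
begin

lemma avg_simplex:
  assumes "\<And>k. \<mu> k \<in> prob_simplex"
  shows "(\<lambda>z. avg (\<lambda>k. \<mu> k z) b) \<in> prob_simplex"
proof -
  have "0 \<le> avg (\<lambda>k. \<mu> k z) b" for z
    using avg_mono[of b "\<lambda>_. 0" "\<lambda>k. \<mu> k z"] prob_simplexD(1)[OF assms] by simp
  moreover have "(\<Sum>z\<in>UNIV. avg (\<lambda>k. \<mu> k z) b) = 1"
    using prob_simplexD(2)[OF assms] by (simp add: avg_sum[symmetric])
  ultimately show ?thesis by (simp add: prob_simplex_def)
qed

lemma avg_bil_right: "avg (\<lambda>l. bil u R (\<nu> l)) c = bil u R (\<lambda>z. avg (\<lambda>l. \<nu> l z) c)"
proof -
  have "avg (\<lambda>l. bil u R (\<nu> l)) c = (\<Sum>a\<in>UNIV. \<Sum>b\<in>UNIV. (u a * R a b) * avg (\<lambda>l. \<nu> l b) c)"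
    by (simp only: bil_def avg_sum avg_cmult)
  then show ?thesis by (simp add: bil_def)
qed

lemma avg_bil: "avg (\<lambda>k. avg (\<lambda>l. bil (\<mu> k) R (\<nu> l)) c) b
    = bil (\<lambda>z. avg (\<lambda>k. \<mu> k z) b) R (\<lambda>z. avg (\<lambda>l. \<nu> l z) c)"
  unfolding avg_bil_right by (simp only: bil_swap[of _ R] avg_bil_right)

end

lemma sum_shift_le:
  fixes c :: "nat \<Rightarrow> real"
  assumes "\<And>b. \<bar>c b\<bar> \<le> C"
  shows "(\<Sum>b<N. c b) \<le> (\<Sum>b<N. c (b + j)) + 2 * C * j"
proof -
  have "(\<Sum>i<j. c i) - (\<Sum>i<j. c (N + i)) = (\<Sum>i<j. c i - c (N + i))" by (simp add: sum_subtractf)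
  also have "\<dots> \<le> (\<Sum>i<j. 2 * C)"
  proof (intro sum_mono)
    fix i show "c i - c (N + i) \<le> 2 * C" using assms[of i] assms[of "N + i"] by linarith
  qed
  finally show ?thesis using sum_shift_diff[of c j N] by (simp add: mult.commute)
qed

text \<open>Both players' payoffs are measured against the opponent's past. Summation by parts turns
  the second player's backward average into a forward average of that player's own strategy;
  the good scale makes forward and backward averages agree.\<close>

lemma cross_term_le:
  fixes m :: "nat \<Rightarrow> 'a::finite \<Rightarrow> real" and n :: "nat \<Rightarrow> 'b::finite \<Rightarrow> real"
  assumes m: "\<And>b. m b \<in> prob_simplex" and n: "\<And>b. n b \<in> prob_simplex"
    and R: "\<And>a b. \<bar>R1 a b\<bar> \<le> C" "\<And>a b. \<bar>R2 b a\<bar> \<le> C"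
    and D: "\<And>\<mu> \<nu>. \<mu> \<in> prob_simplex \<Longrightarrow> \<nu> \<in> prob_simplex \<Longrightarrow> bil \<mu> R1 \<nu> + bil \<nu> R2 \<mu> \<le> D"
    and H: "0 < H"
    and scale: "(\<Sum>b<N. \<Sum>z\<in>UNIV. \<bar>shifted_sum (\<lambda>b. n b z) H b - shifted_sum (\<lambda>b. n b z) H (b + H)\<bar>)
      \<le> \<zeta> * N * H"
  shows "(\<Sum>b<N. (\<Sum>i<H. bil (m (H + b)) R1 (n (b + i))) / H + (\<Sum>i<H. bil (n (H + b)) R2 (m (b + i))) / H)
    \<le> N * D + C * \<zeta> * N + 2 * C * N / H + 2 * C * H"
proof -
  define a where "a j l = bil (n j) R2 (m l)" for j l
  have a: "\<bar>a j l\<bar> \<le> C" for j l unfolding a_def by (intro abs_bil_simplex_le m n R)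
  have C0: "0 \<le> C" using a[of 0 0] by linarith
  define F where "F b z = shifted_sum (\<lambda>b. n b z) H b" for b z
  have "(\<Sum>b<N. \<Sum>i<H. a (H + b) (b + i)) = (\<Sum>i<H. \<Sum>b<N. a (H + b) (b + i))"
    by (rule sum.swap)
  \<comment> \<open>Reflecting the index turns it into a lag: block \<open>H + b\<close> is paired
    with the block \<open>Suc i\<close> before it.\<close>
  also have "\<dots> = (\<Sum>i<H. \<Sum>b<N. a (H + b) (b + (H - Suc i)))"
    by (rule sum.nat_diff_reindex[symmetric])
  also have "\<dots> \<le> (\<Sum>i<H. (\<Sum>b<N. a (H + b + Suc i) (H + b)) + 2 * C * H)"
  proof (intro sum_mono)
    fix i assume i: "i \<in> {..<H}"
    let ?c = "\<lambda>b. a (H + b) (b + (H - Suc i))"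
    \<comment> \<open>Shifting \<open>b\<close> by the lag puts \<open>m\<close> at block
      \<open>H + b\<close> and \<open>n\<close> at a later one, at a cost of \<open>2 * C\<close>
      for each unit of shift.\<close>
    have "(\<Sum>b<N. ?c b) \<le> (\<Sum>b<N. ?c (b + Suc i)) + 2 * C * Suc i"
      by (rule sum_shift_le) (rule a)
    moreover have "?c (b + Suc i) = a (H + b + Suc i) (H + b)" for b
    proof -
      have "b + Suc i + (H - Suc i) = H + b" using i by auto
      then show ?thesis by (simp only: add.assoc)
    qed
    moreover have "2 * C * Suc i \<le> 2 * C * H" using i C0 by (intro mult_left_mono) auto
    ultimately show "(\<Sum>b<N. ?c b) \<le> (\<Sum>b<N. a (H + b + Suc i) (H + b)) + 2 * C * H" by simp
  qed
  also have "\<dots> = (\<Sum>i<H. \<Sum>b<N. a (H + b + Suc i) (H + b)) + 2 * C * H * H" by (simp add: sum.distrib)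
  also have "(\<Sum>i<H. \<Sum>b<N. a (H + b + Suc i) (H + b)) = (\<Sum>b<N. \<Sum>i<H. a (H + b + Suc i) (H + b))"
    by (rule sum.swap)
  \<comment> \<open>Lags from 1 to \<open>H\<close> become lags from 0 to \<open>H - 1\<close>; the
    two sums differ by one boundary term each, of size at most \<open>C\<close>.\<close>
  also have "\<dots> \<le> (\<Sum>b<N. (\<Sum>i<H. a (H + b + i) (H + b)) + 2 * C)"
  proof (intro sum_mono)
    fix b
    have "(\<Sum>i<H. a (H + b + Suc i) (H + b)) + a (H + b) (H + b)
       = (\<Sum>i<H. a (H + b + i) (H + b)) + a (H + b + H) (H + b)"
      using sum.lessThan_Suc_shift[of "\<lambda>i. a (H + b + i) (H + b)" H]
        sum.lessThan_Suc[of "\<lambda>i. a (H + b + i) (H + b)" H] by simp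
    then show "(\<Sum>i<H. a (H + b + Suc i) (H + b)) \<le> (\<Sum>i<H. a (H + b + i) (H + b)) + 2 * C"
      using a[of "H + b" "H + b"] a[of "H + b + H" "H + b"] by (simp add: abs_le_iff)
  qed
  finally have swap: "(\<Sum>b<N. \<Sum>i<H. a (H + b) (b + i))
     \<le> (\<Sum>b<N. \<Sum>i<H. a (H + b + i) (H + b)) + 2 * C * N + 2 * C * H * H"
    by (simp add: sum.distrib mult.commute mult.left_commute)
  have "(\<Sum>b<N. (\<Sum>i<H. bil (m (H + b)) R1 (n (b + i)))) + (\<Sum>b<N. \<Sum>i<H. a (H + b + i) (H + b))
     = (\<Sum>b<N. bil (m (H + b)) R1 (F b) + (\<Sum>i<H. a (H + b + i) (H + b)))"
    by (simp add: F_def[abs_def] shifted_sum_def bil_sum_right sum.distrib)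
  \<comment> \<open>\<open>F b\<close> sums \<open>n\<close> over the \<open>H\<close> blocks before
    \<open>H + b\<close>, \<open>F (b + H)\<close> over the \<open>H\<close> blocks from there on.
    After exchanging the first for the second, both payoffs involve the same pairs of blocks and
    \<open>D\<close> applies.\<close>
  also have "\<dots> \<le> (\<Sum>b<N. H * D + C * (\<Sum>z\<in>UNIV. \<bar>F b z - F (b + H) z\<bar>))"
  proof (intro sum_mono)
    fix b
    have 1: "bil (m (H + b)) R1 (F b) = bil (m (H + b)) R1 (F (b + H)) + bil (m (H + b)) R1 (\<lambda>z. F b z - F (b + H) z)"
      by (simp add: bil_diff_right)
    have 2: "bil (m (H + b)) R1 (\<lambda>z. F b z - F (b + H) z) \<le> C * (\<Sum>z\<in>UNIV. \<bar>F b z - F (b + H) z\<bar>)"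
      using abs_bil_le[OF m R(1), where v = "\<lambda>z. F b z - F (b + H) z"] by (rule abs_le_D1)
    have "bil (m (H + b)) R1 (F (b + H)) + (\<Sum>i<H. a (H + b + i) (H + b))
       = (\<Sum>i<H. bil (m (H + b)) R1 (n (H + b + i)) + bil (n (H + b + i)) R2 (m (H + b)))"
      by (simp add: F_def[abs_def] shifted_sum_def bil_sum_right sum.distrib a_def add.commute[of H])
    also have "\<dots> \<le> (\<Sum>i<H. D)" by (intro sum_mono D m n)
    finally show "bil (m (H + b)) R1 (F b) + (\<Sum>i<H. a (H + b + i) (H + b))
        \<le> H * D + C * (\<Sum>z\<in>UNIV. \<bar>F b z - F (b + H) z\<bar>)" using 1 2 by simp
  qed
  also have "\<dots> = N * H * D + C * (\<Sum>b<N. \<Sum>z\<in>UNIV. \<bar>F b z - F (b + H) z\<bar>)"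
    by (simp add: sum.distrib sum_distrib_left)
  also have "\<dots> \<le> N * H * D + C * (\<zeta> * N * H)"
    using scale C0 by (intro add_left_mono mult_left_mono) (auto simp: F_def)
  finally have "(\<Sum>b<N. \<Sum>i<H. bil (m (H + b)) R1 (n (b + i))) + (\<Sum>b<N. \<Sum>i<H. a (H + b) (b + i))
     \<le> H * (N * D + C * \<zeta> * N + 2 * C * N / H + 2 * C * H)"
    using swap H by (simp add: algebra_simps)
  then have "((\<Sum>b<N. \<Sum>i<H. bil (m (H + b)) R1 (n (b + i))) + (\<Sum>b<N. \<Sum>i<H. a (H + b) (b + i))) / H
     \<le> N * D + C * \<zeta> * N + 2 * C * N / H + 2 * C * H"
    using H by (simp add: divide_le_eq mult.commute)
  then show ?thesis
    by (simp add: a_def sum.distrib sum_divide_distrib add_divide_distrib)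
qed

section \<open>Block sequences and iteration over windows\<close>

lemma exists_block_sequence:
  fixes \<alpha> :: "nat \<Rightarrow> real"
  assumes nonneg: "\<And>k. 0 \<le> \<alpha> k" and "\<not> summable \<alpha>" and small: "\<And>k. k0 \<le> k \<Longrightarrow> \<alpha> k \<le> \<eta>" and \<epsilon>: "0 < \<epsilon>"
  obtains \<kappa> where "strict_mono \<kappa>" "\<kappa> 0 = k0" "\<And>b. \<epsilon> \<le> sum \<alpha> {\<kappa> b..<\<kappa> (Suc b)}"
    "\<And>b. sum \<alpha> {\<kappa> b..<\<kappa> (Suc b)} \<le> \<epsilon> + \<eta>"
proof -
  have unbounded: "\<exists>l. \<epsilon> \<le> sum \<alpha> {k..<l}" for k
  proof (rule ccontr)
    assume "\<not> ?thesis"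
    then have *: "sum \<alpha> {k..<l} \<le> \<epsilon>" for l by (meson linear)
    have "sum \<alpha> {..<n} \<le> sum \<alpha> {..<k} + \<epsilon>" for n
    proof -
      have "sum \<alpha> {..<n} \<le> sum \<alpha> ({..<k} \<union> {k..<n})" using nonneg by (intro sum_mono2) auto
      also have "\<dots> = sum \<alpha> {..<k} + sum \<alpha> {k..<n}" by (intro sum.union_disjoint) auto
      finally show ?thesis using *[of n] by linarith
    qed
    then have "summable \<alpha>" using nonneg by (intro summableI_nonneg_bounded[of \<alpha>]) auto
    with assms(2) show False by simp
  qed
  \<comment> \<open>Greedy blocks: each ends when its duration first reaches
    \<open>\<epsilon>\<close>, so the excess is at most its last step.\<close>
  define nxt where "nxt k = (LEAST l. \<epsilon> \<le> sum \<alpha> {k..<l})" for k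
  have ge: "\<epsilon> \<le> sum \<alpha> {k..<nxt k}" for k
    unfolding nxt_def by (rule LeastI_ex) (rule unbounded)
  have gt: "k < nxt k" for k
    using ge[of k] \<epsilon> by (cases "k < nxt k") auto
  have le: "sum \<alpha> {k..<nxt k} \<le> \<epsilon> + \<eta>" if "k0 \<le> k" for k
  proof -
    obtain l where l: "nxt k = Suc l" using gt[of k] by (cases "nxt k") auto
    have "\<not> \<epsilon> \<le> sum \<alpha> {k..<l}" using not_less_Least[of l "\<lambda>l. \<epsilon> \<le> sum \<alpha> {k..<l}"] l by (auto simp: nxt_def)
    then show ?thesis using small[of l] that gt[of k] by (simp add: l)
  qed
  define \<kappa> where "\<kappa> b = (nxt ^^ b) k0" for b
  have Suc: "\<kappa> (Suc b) = nxt (\<kappa> b)" for b by (simp add: \<kappa>_def)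
  have mono: "strict_mono \<kappa>" by (simp add: strict_mono_Suc_iff Suc gt)
  have "k0 \<le> \<kappa> b" for b
    using strict_mono_less_eq[OF mono, of 0 b] by (simp add: \<kappa>_def)
  then show ?thesis using that[of \<kappa>] mono ge le by (auto simp: Suc \<kappa>_def)
qed

text \<open>Windows are chained, each starting where the previous one ended. The excess over
  \<open>G\<close> shrinks by \<open>1 / (1 + T)\<close> per window, and \<open>r\<close> covers the
  stages inside a window.\<close>

lemma eventually_le_of_contraction:
  fixes \<Lambda> :: "nat \<Rightarrow> real"
  assumes T: "0 < T"
    and step: "\<And>k. k0 \<le> k \<Longrightarrow> \<exists>k'>k. (1 + T) * \<Lambda> k' \<le> \<Lambda> k + T * G \<and> (\<forall>l. k \<le> l \<longrightarrow> l \<le> k' \<longrightarrow> \<Lambda> l \<le> \<Lambda> k + r)"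
    and \<delta>: "0 < \<delta>"
  shows "\<forall>\<^sub>F l in sequentially. \<Lambda> l \<le> G + r + \<delta>"
proof -
  define P where "P k k' \<longleftrightarrow> k < k' \<and> (1 + T) * \<Lambda> k' \<le> \<Lambda> k + T * G
    \<and> (\<forall>l. k \<le> l \<longrightarrow> l \<le> k' \<longrightarrow> \<Lambda> l \<le> \<Lambda> k + r)" for k k'
  obtain f where f: "\<And>k. k0 \<le> k \<Longrightarrow> P k (f k)" using step unfolding P_def by metis
  define s where "s i = (f ^^ i) k0" for i
  have s0: "k0 \<le> s i" for i
  proof (induction i)
    case (Suc i) then show ?case using f[of "s i"] by (simp add: s_def P_def)
  qed (simp add: s_def)
  have sP: "P (s i) (s (Suc i))" for i using f[OF s0[of i]] by (simp add: s_def)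
  have mono: "strict_mono s" using sP by (simp add: strict_mono_Suc_iff P_def)
  have contr: "\<Lambda> (s i) - G \<le> (1 / (1 + T)) ^ i * (\<Lambda> (s 0) - G)" for i
  proof (induction i)
    case (Suc i)
    have "(1 + T) * (\<Lambda> (s (Suc i)) - G) \<le> \<Lambda> (s i) - G" using sP[of i] by (simp add: P_def algebra_simps)
    then have "\<Lambda> (s (Suc i)) - G \<le> 1 / (1 + T) * (\<Lambda> (s i) - G)" using T by (simp add: field_simps)
    also have "\<dots> \<le> 1 / (1 + T) * ((1 / (1 + T)) ^ i * (\<Lambda> (s 0) - G))"
      using T Suc by (intro mult_left_mono) auto
    finally show ?case by simp
  qed simp
  have "(\<lambda>i. (1 / (1 + T)) ^ i * (\<Lambda> (s 0) - G)) \<longlonglongrightarrow> 0 * (\<Lambda> (s 0) - G)"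
    using T by (intro tendsto_intros LIMSEQ_realpow_zero) auto
  then have "\<forall>\<^sub>F i in sequentially. (1 / (1 + T)) ^ i * (\<Lambda> (s 0) - G) < \<delta>"
    using \<delta> by (intro order_tendstoD(2)) auto
  then obtain I where I: "\<And>i. I \<le> i \<Longrightarrow> (1 / (1 + T)) ^ i * (\<Lambda> (s 0) - G) < \<delta>"
    by (auto simp: eventually_sequentially)
  have "\<Lambda> l \<le> G + r + \<delta>" if l: "s I \<le> l" for l
  proof -
    \<comment> \<open>The last window starting no later than \<open>l\<close>; it exists because
      \<open>s j\<close> is at least \<open>j\<close>.\<close>
    define i where "i = (GREATEST i. s i \<le> l)"
    have bound: "\<And>j. s j \<le> l \<Longrightarrow> j \<le> l"
      using strict_mono_imp_increasing[OF mono] by (meson order_trans)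
    have i: "s i \<le> l" unfolding i_def by (rule GreatestI_nat[where k = I]) (use l bound in auto)
    have Ii: "I \<le> i" unfolding i_def by (rule Greatest_le_nat) (use l bound in auto)
    have "\<not> s (Suc i) \<le> l"
    proof
      assume "s (Suc i) \<le> l"
      then have "Suc i \<le> i" unfolding i_def[symmetric] by (subst (2) i_def) (rule Greatest_le_nat, use bound in auto)
      then show False by simp
    qed
    then have "\<Lambda> l \<le> \<Lambda> (s i) + r" using sP[of i] i by (simp add: P_def)
    then show ?thesis using contr[of i] I[OF Ii] by linarith
  qed
  then show ?thesis by (auto simp: eventually_sequentially)
qed

text \<open>Player 2's clock runs at rate one, player 1's at rate \<open>d\<close>; \<open>r\<close> and \<open>t\<close> play for player 2
  the roles of \<open>p\<close> and \<open>s\<close>.\<close>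

locale game_path =
  fixes \<alpha> e :: "nat \<Rightarrow> real" and d C D v1 v2 :: real
    and R1 :: "'a::finite \<Rightarrow> 'b::finite \<Rightarrow> real" and R2 :: "'b \<Rightarrow> 'a \<Rightarrow> real"
    and \<mu> y :: "nat \<Rightarrow> 'a \<Rightarrow> real" and \<nu> x :: "nat \<Rightarrow> 'b \<Rightarrow> real"
    and p s g h r t :: "nat \<Rightarrow> real"
  assumes \<alpha>: "\<And>k. 0 \<le> \<alpha> k" "\<alpha> \<longlonglongrightarrow> 0" "\<not> summable \<alpha>"
    and d: "0 < d" "d \<le> 1" and C1: "1 \<le> C"
    and e: "e \<longlonglongrightarrow> 0"
    and simplex: "\<And>k. \<mu> k \<in> prob_simplex" "\<And>k. \<nu> k \<in> prob_simplex"
      "\<And>k. x k \<in> prob_simplex" "\<And>k. y k \<in> prob_simplex"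
    and x_Suc: "\<And>k z. x (Suc k) z = x k z + d * \<alpha> k * (\<nu> k z - x k z)"
    and y_Suc: "\<And>k z. y (Suc k) z = y k z + \<alpha> k * (\<mu> k z - y k z)"
    and R_bound: "\<And>a b. \<bar>R1 a b\<bar> \<le> C" "\<And>a b. \<bar>R2 b a\<bar> \<le> C"
    and D: "\<And>\<mu> \<nu>. \<mu> \<in> prob_simplex \<Longrightarrow> \<nu> \<in> prob_simplex \<Longrightarrow> bil \<mu> R1 \<nu> + bil \<nu> R2 \<mu> \<le> D"
    and inc1: "\<And>k l. p k - p l \<le> bil (\<mu> k) R1 (x k) - bil (\<mu> k) R1 (x l) + e k"
    and top1: "\<And>k. p k \<le> bil (\<mu> k) R1 (x k) + g k + e k"
    and s_Suc: "\<And>k. s (Suc k) \<le> s k - d * \<alpha> k * (s k + h k)"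
    and inc2: "\<And>k l. r k - r l \<le> bil (\<nu> k) R2 (y k) - bil (\<nu> k) R2 (y l) + e k"
    and top2: "\<And>k. r k \<le> bil (\<nu> k) R2 (y k) + h k + e k"
    and t_Suc: "\<And>k. t (Suc k) \<le> t k - \<alpha> k * (t k + g k)"
    and bounds: "\<And>k. \<bar>p k\<bar> \<le> C" "\<And>k. \<bar>s k\<bar> \<le> C" "\<And>k. \<bar>g k\<bar> \<le> C" "\<And>k. \<bar>h k\<bar> \<le> C"
      "\<And>k. \<bar>r k\<bar> \<le> C" "\<And>k. \<bar>t k\<bar> \<le> C"
    and v: "\<And>k. v1 \<le> p k + s k" "\<And>k. v2 \<le> r k + t k"
begin

definition \<Lambda> :: "nat \<Rightarrow> real" where
  "\<Lambda> k = (p k + s k - v1) + d * (r k + t k - v2)"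

lemma bil_Suc:
  assumes "\<And>z. w' z = w z + c * (u z - w z)"
  shows "bil m R w' = bil m R w + c * (bil m R u - bil m R w)"
proof -
  have "w' = (\<lambda>z. w z + c * (u z - w z))" using assms by auto
  then show ?thesis by (simp add: bil_add_right bil_cmult_right bil_diff_right)
qed

text \<open>Player 1's estimate plus \<open>d\<close> times player 2's, over the last
  \<open>N\<close> blocks; the first \<open>H\<close> blocks serve as the past and contribute only a
  bounded rise. The constant 150 rounds up 120 from the two players, 5 from the cross term and 18
  from the first \<open>H\<close> blocks.\<close>

lemma \<Lambda>_over_window:
  assumes clock: "block_clock \<alpha> \<kappa> \<epsilon> \<eta>"
    and H: "0 < H" and CH: "C \<le> \<rho> * H" and CN: "C * H \<le> \<rho> * N"
    and \<Theta>: "2 * C * \<epsilon> * (N + H) \<le> \<rho>" and \<eta>\<rho>: "C * \<eta> \<le> \<rho> * \<epsilon>"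
    and e\<rho>: "\<And>k. \<kappa> 0 \<le> k \<Longrightarrow> e k \<le> \<rho> * \<epsilon>"
    and N: "0 < N" and \<epsilon>1: "\<epsilon> \<le> 1" and \<rho>: "0 \<le> \<rho>"
    and \<zeta>: "C * \<zeta> \<le> \<rho>"
    and scale: "(\<Sum>b<N. \<Sum>z\<in>UNIV. \<bar>shifted_sum (\<lambda>b. block_clock.avg \<alpha> \<kappa> (\<lambda>k. \<nu> k z) b) H b
          - shifted_sum (\<lambda>b. block_clock.avg \<alpha> \<kappa> (\<lambda>k. \<nu> k z) b) H (b + H)\<bar>) \<le> \<zeta> * N * H"
  shows "(1 + d * (\<epsilon> * N)) * \<Lambda> (\<kappa> (H + N)) \<le> \<Lambda> (\<kappa> 0) + d * (\<epsilon> * N) * (D - v1 - v2 + 150 * \<rho> / d)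
    \<and> (\<forall>l. \<kappa> 0 \<le> l \<longrightarrow> l \<le> \<kappa> (H + N) \<longrightarrow> \<Lambda> l \<le> \<Lambda> (\<kappa> 0) + 10 * \<rho>)"
proof -
  interpret block_clock \<alpha> \<kappa> \<epsilon> \<eta> by (rule clock)
  define e0 where "e0 = \<rho> * \<epsilon>"
  have e0: "0 \<le> e0" using \<rho> \<epsilon>_pos by (simp add: e0_def)
  have e_le: "e k \<le> e0" if "\<kappa> 0 \<le> k" for k using e\<rho>[OF that] by (simp add: e0_def)
  interpret p1: player \<alpha> \<kappa> \<epsilon> \<eta> d C e0 p s g h "\<lambda>k l. bil (\<mu> k) R1 (\<nu> l)" "\<lambda>k l. bil (\<mu> k) R1 (x l)"
  proof unfold_locales
    show "p k - p l \<le> bil (\<mu> k) R1 (x k) - bil (\<mu> k) R1 (x l) + e0" if "\<kappa> 0 \<le> k" for k l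
      using inc1[of k l] e_le[OF that] by linarith
    show "p k \<le> bil (\<mu> k) R1 (x k) + g k + e0" if "\<kappa> 0 \<le> k" for k
      using top1[of k] e_le[OF that] by linarith
    show "bil (\<mu> k) R1 (x (Suc l)) = bil (\<mu> k) R1 (x l) + d * \<alpha> l * (bil (\<mu> k) R1 (\<nu> l) - bil (\<mu> k) R1 (x l))" for k l
      by (rule bil_Suc) (rule x_Suc)
  qed (use d e0 s_Suc bounds abs_bil_simplex_le[OF simplex(1) simplex(2) R_bound(1)]
        abs_bil_simplex_le[OF simplex(1) simplex(3) R_bound(1)] in auto)
  interpret p2: player \<alpha> \<kappa> \<epsilon> \<eta> 1 C e0 r t h g "\<lambda>k l. bil (\<nu> k) R2 (\<mu> l)" "\<lambda>k l. bil (\<nu> k) R2 (y l)"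
  proof unfold_locales
    show "r k - r l \<le> bil (\<nu> k) R2 (y k) - bil (\<nu> k) R2 (y l) + e0" if "\<kappa> 0 \<le> k" for k l
      using inc2[of k l] e_le[OF that] by linarith
    show "r k \<le> bil (\<nu> k) R2 (y k) + h k + e0" if "\<kappa> 0 \<le> k" for k
      using top2[of k] e_le[OF that] by linarith
    show "bil (\<nu> k) R2 (y (Suc l)) = bil (\<nu> k) R2 (y l) + 1 * \<alpha> l * (bil (\<nu> k) R2 (\<mu> l) - bil (\<nu> k) R2 (y l))" for k l
      using bil_Suc[of "y (Suc l)" "y l" "\<alpha> l" "\<mu> l"] y_Suc by simp
  qed (use e0 t_Suc bounds abs_bil_simplex_le[OF simplex(2) simplex(1) R_bound(2)]
        abs_bil_simplex_le[OF simplex(2) simplex(4) R_bound(2)] in auto)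
  define m where "m b z = avg (\<lambda>k. \<mu> k z) b" for b z
  define n where "n b z = avg (\<lambda>k. \<nu> k z) b" for b z
  have mn: "m b \<in> prob_simplex" "n b \<in> prob_simplex" for b
    unfolding m_def[abs_def] n_def[abs_def] by (intro avg_simplex simplex)+
  have ub1: "p1.ub b c = bil (m b) R1 (n c)" and ub2: "p2.ub b c = bil (n b) R2 (m c)" for b c
    by (simp_all add: p1.ub_def p2.ub_def avg_bil m_def[abs_def] n_def[abs_def])
  define S1 where "S1 = (\<Sum>b<N. (\<Sum>i<H. p1.ub (H + b) (b + i)) / H + avg g (H + b) - avg h (H + b))"
  define S2 where "S2 = (\<Sum>b<N. (\<Sum>i<H. p2.ub (H + b) (b + i)) / H + avg h (H + b) - avg g (H + b))"
  define E where "E = \<kappa> (H + N)"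
  define T where "T = \<epsilon> * N"
  have T: "0 < T" using \<epsilon>_pos N by (simp add: T_def)
  have e0\<rho>: "e0 \<le> \<rho> * \<epsilon>" by (simp add: e0_def)
  have w1: "(p E + s E) - (p (\<kappa> H) + s (\<kappa> H)) \<le> d * \<epsilon> * (S1 - N * (p E + s E)) + 60 * \<rho> * T"
    using p1.player_over_window[OF H CH CN \<Theta> \<eta>\<rho> e0\<rho> N \<epsilon>1] by (simp add: S1_def E_def T_def mult.assoc)
  have w2: "(r E + t E) - (r (\<kappa> H) + t (\<kappa> H)) \<le> \<epsilon> * (S2 - N * (r E + t E)) + 60 * \<rho> * T"
    using p2.player_over_window[OF H CH CN \<Theta> \<eta>\<rho> e0\<rho> N \<epsilon>1] by (simp add: S2_def E_def T_def mult.assoc)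
  \<comment> \<open>The averages of \<open>g\<close> and \<open>h\<close> enter the two players with
    opposite signs and cancel.\<close>
  have "S1 + S2 = (\<Sum>b<N. (\<Sum>i<H. bil (m (H + b)) R1 (n (b + i))) / H + (\<Sum>i<H. bil (n (H + b)) R2 (m (b + i))) / H)"
    by (simp add: S1_def S2_def ub1 ub2 sum.distrib sum_subtractf)
  also have "\<dots> \<le> N * D + C * \<zeta> * N + 2 * C * N / H + 2 * C * H"
    by (rule cross_term_le[OF mn R_bound D H]) (use scale in \<open>auto simp: n_def\<close>)
  also have "\<dots> \<le> N * D + 5 * \<rho> * N"
  proof -
    have "C * \<zeta> * N \<le> \<rho> * N" using \<zeta> by (intro mult_right_mono) auto
    moreover have "C / H \<le> \<rho>" using CH H by (simp add: field_simps)
    then have "C / H * N \<le> \<rho> * N" by (intro mult_right_mono) auto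
    ultimately show ?thesis using CN by simp
  qed
  finally have cross: "S1 + S2 \<le> N * (D + 5 * \<rho>)" by (simp add: algebra_simps)
  \<comment> \<open>Player 2's clock has rate one; the weight \<open>d\<close> gives its payoffs the
    factor \<open>d * \<epsilon>\<close> of player 1.\<close>
  have dw2: "d * ((r E + t E) - (r (\<kappa> H) + t (\<kappa> H))) \<le> d * \<epsilon> * (S2 - N * (r E + t E)) + 60 * \<rho> * T"
  proof -
    have "d * ((r E + t E) - (r (\<kappa> H) + t (\<kappa> H))) \<le> d * (\<epsilon> * (S2 - N * (r E + t E)) + 60 * \<rho> * T)"
      using w2 d by (intro mult_left_mono) auto
    moreover have "d * (60 * \<rho> * T) \<le> 60 * \<rho> * T"
      using \<rho> T d by (intro p1.d_mult_le) auto
    ultimately show ?thesis by (simp add: algebra_simps)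
  qed
  have "\<Lambda> E - \<Lambda> (\<kappa> H) \<le> d * \<epsilon> * ((S1 + S2) - N * (p E + s E) - N * (r E + t E)) + 120 * \<rho> * T"
    using w1 dw2 by (simp add: \<Lambda>_def algebra_simps)
  also have "\<dots> \<le> d * \<epsilon> * (N * (D - v1 - v2 + 5 * \<rho> - \<Lambda> E)) + 120 * \<rho> * T"
  proof -
    \<comment> \<open>As \<open>r + t\<close> stays above \<open>v2\<close> and
      \<open>d \<le> 1\<close>, the weighted excess in \<open>\<Lambda>\<close> is at most the full
      one, so the two decay terms together dominate \<open>\<Lambda>\<close>.\<close>
    have "d * (r E + t E - v2) \<le> r E + t E - v2" using v(2)[of E] by (intro p1.d_mult_le) auto
    then have "N * (v1 + v2 + \<Lambda> E) \<le> N * (p E + s E + (r E + t E))" by (intro mult_left_mono) (auto simp: \<Lambda>_def)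
    then have "(S1 + S2) - N * (p E + s E) - N * (r E + t E) \<le> N * (D - v1 - v2 + 5 * \<rho> - \<Lambda> E)"
      using cross by (simp add: algebra_simps)
    then show ?thesis using d \<epsilon>_pos by (intro add_right_mono mult_left_mono) auto
  qed
  also have "\<dots> = d * T * (D - v1 - v2 - \<Lambda> E) + 5 * (d * (\<rho> * T)) + 120 * \<rho> * T"
    by (simp add: T_def algebra_simps)
  also have "d * (\<rho> * T) \<le> \<rho> * T" using \<rho> T by (intro p1.d_mult_le) auto
  finally have decrease: "\<Lambda> E - \<Lambda> (\<kappa> H) \<le> d * T * (D - v1 - v2 - \<Lambda> E) + 125 * \<rho> * T"
    unfolding mult.assoc[of _ \<rho> T] by linarith
  have rise: "\<Lambda> l \<le> \<Lambda> (\<kappa> 0) + 4 * (2 * C * c) + 2 * e0"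
    if l: "\<kappa> 0 \<le> l" and c: "sum \<alpha> {\<kappa> 0..<l} \<le> c" for l c
  proof -
    let ?q = "2 * C * sum \<alpha> {\<kappa> 0..<l}"
    have "0 \<le> ?q" using p1.C_nonneg step_nonneg by (simp add: sum_nonneg)
    then have "d * (r l + t l - (r (\<kappa> 0) + t (\<kappa> 0))) \<le> 2 * ?q + e0"
      using p2.p_lip[OF order_refl l] p2.s_upper[OF l] e0 by (intro p1.d_mult_le) (auto simp: abs_le_iff)
    then have "\<Lambda> l \<le> \<Lambda> (\<kappa> 0) + 4 * ?q + 2 * e0"
      using p1.p_lip[OF order_refl l] p1.s_upper[OF l] by (simp add: \<Lambda>_def algebra_simps abs_le_iff)
    moreover have "?q \<le> 2 * C * c" using c p1.C_nonneg by (intro mult_left_mono) auto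
    ultimately show ?thesis by linarith
  qed
  have "\<Lambda> (\<kappa> H) \<le> \<Lambda> (\<kappa> 0) + 4 * (2 * C * (2 * \<epsilon> * H)) + 2 * e0"
    using time_blocks[of 0 H] by (intro rise \<kappa>_mono) auto
  also have "\<dots> \<le> \<Lambda> (\<kappa> 0) + 18 * (\<rho> * T)"
  proof -
    have "C * H * \<epsilon> \<le> \<rho> * N * \<epsilon>" using CN \<epsilon>_pos by (intro mult_right_mono) auto
    moreover have "\<rho> * \<epsilon> * 1 \<le> \<rho> * \<epsilon> * N" using N \<rho> \<epsilon>_pos by (intro mult_left_mono) auto
    ultimately show ?thesis by (simp add: T_def e0_def algebra_simps)
  qed
  finally have start: "\<Lambda> (\<kappa> H) \<le> \<Lambda> (\<kappa> 0) + 18 * (\<rho> * T)" .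
  have "(1 + d * T) * \<Lambda> E \<le> \<Lambda> (\<kappa> 0) + d * T * (D - v1 - v2) + 150 * (\<rho> * T)"
  proof -
    have combine: "M \<le> S + X + 150 * y"
      if "L - K \<le> (X - a) + 125 * y" "K \<le> S + 18 * y" "0 \<le> y" "M = L + a" for L K X a S M y :: real
      using that by linarith
    show ?thesis
    proof (rule combine)
      show "\<Lambda> E - \<Lambda> (\<kappa> H) \<le> (d * T * (D - v1 - v2) - d * T * \<Lambda> E) + 125 * (\<rho> * T)"
        using decrease by (simp only: right_diff_distrib mult.assoc)
      show "0 \<le> \<rho> * T" using \<rho> T by simp
    qed (use start in \<open>auto simp: algebra_simps\<close>)
  qed
  also have "\<dots> = \<Lambda> (\<kappa> 0) + d * T * (D - v1 - v2 + 150 * \<rho> / d)"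
    using d by (simp add: field_simps)
  finally have A: "(1 + d * T) * \<Lambda> E \<le> \<Lambda> (\<kappa> 0) + d * T * (D - v1 - v2 + 150 * \<rho> / d)" .
  have B: "\<Lambda> l \<le> \<Lambda> (\<kappa> 0) + 10 * \<rho>" if l: "\<kappa> 0 \<le> l" "l \<le> E" for l
  proof -
    have "sum \<alpha> {\<kappa> 0..<l} \<le> 2 * \<epsilon> * (N + H)"
      using time_mono[of "\<kappa> 0" "\<kappa> 0" l E] time_blocks[of 0 "H + N"] l by (simp add: E_def algebra_simps)
    then have "\<Lambda> l \<le> \<Lambda> (\<kappa> 0) + 4 * (2 * C * (2 * \<epsilon> * (N + H))) + 2 * e0" by (rule rise[OF l(1)])
    also have "4 * (2 * C * (2 * \<epsilon> * (N + H))) = 8 * (2 * C * \<epsilon> * (N + H))" by (simp add: algebra_simps)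
    also have "\<dots> \<le> 8 * \<rho>" using \<Theta> by simp
    also have "e0 \<le> \<rho>" using \<rho> \<epsilon>1 by (simp add: e0_def mult_left_le)
    finally show ?thesis by simp
  qed
  show ?thesis using A B unfolding E_def T_def by blast
qed

text \<open>The order of choice matters: \<open>\<rho>\<close>, the least scale, the largest scale
  \<open>Hm\<close>, the length \<open>N\<close>, the duration \<open>\<epsilon>\<close>, the
  tolerance \<open>\<eta>\<close>, the first stage \<open>k0\<close>. The scale \<open>H\<close>
  varies with the window but stays below \<open>Hm\<close>; \<open>\<epsilon> * N\<close>, and with
  it the contraction factor, is the same for all windows.\<close>

theorem \<Lambda>_eventually_le:
  assumes "0 < \<delta>"
  shows "\<forall>\<^sub>F k in sequentially. \<Lambda> k \<le> D - v1 - v2 + \<delta>"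
proof -
  \<comment> \<open>\<open>150 * \<rho> / d\<close> takes three quarters of \<open>\<delta>\<close>;
    the rise \<open>10 * \<rho>\<close> and the slack \<open>5 * \<rho>\<close> fit into the
    rest.\<close>
  define \<rho> where "\<rho> = \<delta> * d / 200"
  have \<rho>: "0 < \<rho>" using assms d by (simp add: \<rho>_def)
  have C0: "0 < C" using C1 by simp
  obtain j0 :: nat where "C / \<rho> < j0" using reals_Archimedean2 by blast
  then have "C < \<rho> * j0" using \<rho> by (simp add: field_simps)
  also have "\<dots> < \<rho> * 2 ^ j0"
    by (rule mult_strict_left_mono[OF of_nat_less_two_power \<rho>])
  finally have j0: "C \<le> \<rho> * 2 ^ j0" by simp
  define \<zeta> where "\<zeta> = \<rho> / C"
  have \<zeta>: "0 < \<zeta>" "C * \<zeta> \<le> \<rho>" using \<rho> C0 by (auto simp: \<zeta>_def)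
  from good_scale[OF \<zeta>(1), of j0, where 'z = 'b]
  obtain Hm where Hm: "\<forall>N\<ge>Hm. \<forall>f :: 'b \<Rightarrow> nat \<Rightarrow> real. (\<forall>z b. \<bar>f z b\<bar> \<le> 1) \<longrightarrow>
    (\<exists>H. 2 ^ j0 \<le> H \<and> H \<le> Hm \<and>
      (\<Sum>b<N. \<Sum>z\<in>UNIV. \<bar>shifted_sum (f z) H b - shifted_sum (f z) H (b + H)\<bar>) \<le> \<zeta> * N * H)"
    by (rule exE)
  obtain N0 :: nat where "C * Hm / \<rho> < N0" using reals_Archimedean2 by blast
  then have N0: "C * Hm \<le> \<rho> * N0" using \<rho> by (simp add: field_simps)
  define N where "N = Suc (max N0 Hm)"
  have N: "0 < N" "Hm \<le> N" by (auto simp: N_def)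
  have "\<rho> * N0 \<le> \<rho> * N" using \<rho> by (intro mult_left_mono) (auto simp: N_def)
  with N0 have CN: "C * Hm \<le> \<rho> * N" by simp
  define \<epsilon> where "\<epsilon> = min 1 (\<rho> / (2 * C * (real N + Hm)))"
  have \<epsilon>: "0 < \<epsilon>" "\<epsilon> \<le> 1" using \<rho> C0 N by (auto simp: \<epsilon>_def)
  have \<Theta>: "2 * C * \<epsilon> * (real N + Hm) \<le> \<rho>"
  proof -
    have "\<epsilon> \<le> \<rho> / (2 * C * (real N + Hm))" by (simp add: \<epsilon>_def)
    moreover have "0 < 2 * C * (real N + Hm)" using C0 N by simp
    ultimately show ?thesis by (simp add: field_simps)
  qed
  define \<eta> where "\<eta> = min \<epsilon> (\<rho> * \<epsilon> / C)"
  have \<eta>: "0 < \<eta>" "\<eta> \<le> \<epsilon>" using \<epsilon> \<rho> C0 by (auto simp: \<eta>_def)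
  have "C * \<eta> \<le> C * (\<rho> * \<epsilon> / C)" using C0 by (intro mult_left_mono) (auto simp: \<eta>_def)
  then have C\<eta>: "C * \<eta> \<le> \<rho> * \<epsilon>" using C0 by simp
  have "\<forall>\<^sub>F k in sequentially. \<alpha> k < \<eta> \<and> e k < \<rho> * \<epsilon>"
    using order_tendstoD(2)[OF \<alpha>(2) \<eta>(1)] order_tendstoD(2)[OF e, of "\<rho> * \<epsilon>"] \<rho> \<epsilon> by (auto intro: eventually_conj)
  then obtain k0 where k0: "\<And>k. k0 \<le> k \<Longrightarrow> \<alpha> k < \<eta>" "\<And>k. k0 \<le> k \<Longrightarrow> e k < \<rho> * \<epsilon>"
    by (auto simp: eventually_sequentially)
  have "\<exists>k'>k. (1 + d * (\<epsilon> * N)) * \<Lambda> k' \<le> \<Lambda> k + d * (\<epsilon> * N) * (D - v1 - v2 + 150 * \<rho> / d)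
    \<and> (\<forall>l. k \<le> l \<longrightarrow> l \<le> k' \<longrightarrow> \<Lambda> l \<le> \<Lambda> k + 10 * \<rho>)" if k: "k0 \<le> k" for k
  proof -
    have "\<alpha> l \<le> \<eta>" if "k \<le> l" for l using k0(1)[of l] k that by simp
    then obtain \<kappa> where \<kappa>: "strict_mono \<kappa>" "\<kappa> 0 = k" "\<And>b. \<epsilon> \<le> sum \<alpha> {\<kappa> b..<\<kappa> (Suc b)}"
        "\<And>b. sum \<alpha> {\<kappa> b..<\<kappa> (Suc b)} \<le> \<epsilon> + \<eta>"
      using exists_block_sequence[OF \<alpha>(1,3), of k \<eta> \<epsilon>] \<epsilon>(1) by metis
    have clock: "block_clock \<alpha> \<kappa> \<epsilon> \<eta>"
      by unfold_locales (use \<alpha> \<kappa> \<epsilon> \<eta> in auto)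
    let ?f = "\<lambda>z b. block_clock.avg \<alpha> \<kappa> (\<lambda>k. \<nu> k z) b"
    have f: "\<forall>z b. \<bar>?f z b\<bar> \<le> 1"
      using prob_simplexD(4)[OF block_clock.avg_simplex[OF clock simplex(2)]] by simp
    obtain H where H: "2 ^ j0 \<le> H" "H \<le> Hm"
      and sc: "(\<Sum>b<N. \<Sum>z\<in>UNIV. \<bar>shifted_sum (?f z) H b - shifted_sum (?f z) H (b + H)\<bar>) \<le> \<zeta> * N * H"
      using Hm[THEN spec, THEN mp, OF N(2), THEN spec, THEN mp, OF f] by (elim exE conjE)
    have H0: "0 < H" using H(1) by (metis gr0I le_zero_eq power_not_zero zero_neq_numeral)
    have CH: "C \<le> \<rho> * H"
    proof -
      have "(2::real) ^ j0 \<le> H" using H(1) by (metis of_nat_le_iff of_nat_numeral of_nat_power)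
      then have "\<rho> * 2 ^ j0 \<le> \<rho> * H" using \<rho> by (intro mult_left_mono) auto
      then show ?thesis using j0 by simp
    qed
    have CHN: "C * H \<le> \<rho> * N"
      using H C0 by (intro order_trans[OF mult_left_mono CN]) auto
    have \<Theta>H: "2 * C * \<epsilon> * (real N + real H) \<le> \<rho>"
    proof -
      have "2 * C * \<epsilon> * (real N + real H) \<le> 2 * C * \<epsilon> * (real N + Hm)"
        using H C0 \<epsilon> by (intro mult_left_mono) auto
      then show ?thesis using \<Theta> by simp
    qed
    have ek: "e l \<le> \<rho> * \<epsilon>" if "\<kappa> 0 \<le> l" for l using k0(2)[of l] that k \<kappa>(2) by simp
    have "k < \<kappa> (H + N)" using strict_monoD[OF \<kappa>(1), of 0 "H + N"] \<kappa>(2) N by simp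
    moreover note \<Lambda>_over_window[OF clock H0 CH CHN \<Theta>H C\<eta> ek N(1) \<epsilon>(2) less_imp_le[OF \<rho>] \<zeta>(2) sc]
    ultimately show ?thesis unfolding \<kappa>(2) by blast
  qed
  then have "\<forall>\<^sub>F l in sequentially. \<Lambda> l \<le> (D - v1 - v2 + 150 * \<rho> / d) + 10 * \<rho> + 5 * \<rho>"
    using d \<epsilon> N \<rho> by (intro eventually_le_of_contraction[where T = "d * (\<epsilon> * N)"]) auto
  moreover have "150 * \<rho> / d + 10 * \<rho> + 5 * \<rho> \<le> \<delta>"
  proof -
    have "\<delta> * d \<le> \<delta>" using d assms by (simp add: mult_left_le)
    moreover have "150 * \<rho> / d = 3 / 4 * \<delta>" using d by (simp add: \<rho>_def)
    moreover have "\<rho> = \<delta> * d / 200" by (simp add: \<rho>_def)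
    ultimately show ?thesis using assms by linarith
  qed
  ultimately show ?thesis by (auto elim!: eventually_mono)
qed

end

section \<open>Entropy, best responses and values\<close>

lemma vertex_simplex [simp]: "vertex a \<in> prob_simplex"
  by (simp add: prob_simplex_def vertex_def)

lemma sum_vertex [simp]: "(\<Sum>x\<in>UNIV. vertex (a :: 'a::finite) x * f x) = f a"
proof -
  have "(\<Sum>x\<in>UNIV. vertex a x * f x) = (\<Sum>x\<in>UNIV. if x = a then f x else 0)"
    by (intro sum.cong) (auto simp: vertex_def)
  then show ?thesis by simp
qed

lemma simplex_step:
  assumes "x \<in> prob_simplex" "u \<in> prob_simplex" "0 \<le> c" "c \<le> 1"
  shows "(\<lambda>z. x z + c * (u z - x z)) \<in> prob_simplex"
proof -
  have "0 \<le> (1 - c) * x z + c * u z" for z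
    using assms prob_simplexD(1)[OF assms(1)] prob_simplexD(1)[OF assms(2)] by simp
  then have "0 \<le> x z + c * (u z - x z)" for z by (simp add: algebra_simps)
  moreover have "(\<Sum>z\<in>UNIV. x z + c * (u z - x z)) = 1"
    using prob_simplexD(2)[OF assms(1)] prob_simplexD(2)[OF assms(2)]
    by (simp add: sum.distrib sum_distrib_left[symmetric] sum_subtractf)
  ultimately show ?thesis by (simp add: prob_simplex_def)
qed

text \<open>The tangent of a convex function lies below it. This one inequality yields concavity of
  entropy, its upper bound and Gibbs' principle. At \<open>z = 0\<close> it reads
  \<open>- w \<le> 0\<close>, through \<open>0 * ln 0 = 0\<close>.\<close>

lemma xlnx_tangent:
  fixes z w :: real
  assumes "0 \<le> z" "0 < w"
  shows "w * ln w + (ln w + 1) * (z - w) \<le> z * ln z"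
proof (cases "z = 0")
  case True then show ?thesis using assms by (simp add: algebra_simps)
next
  case False
  then have z: "0 < z" using assms by simp
  have "ln (w / z) \<le> w / z - 1" using z assms by (intro ln_le_minus_one) auto
  then have "z * (ln w - ln z) \<le> z * (w / z - 1)" using z assms by (simp add: ln_div)
  also have "\<dots> = w - z" using z by (simp add: field_simps)
  finally show ?thesis by (simp add: algebra_simps)
qed

text \<open>Jensen from the tangent at the mixed point \<open>w\<close>, where the first-order terms
  cancel. For \<open>w = 0\<close> both weighted terms on the right vanish.\<close>

lemma xlnx_convex:
  fixes x u c :: real
  assumes "0 \<le> x" "0 \<le> u" "0 \<le> c" "c \<le> 1"
  shows "(x + c * (u - x)) * ln (x + c * (u - x)) \<le> (1 - c) * (x * ln x) + c * (u * ln u)"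
proof -
  define w where "w = x + c * (u - x)"
  have weq: "w = (1 - c) * x + c * u" by (simp add: w_def algebra_simps)
  have terms: "0 \<le> (1 - c) * x" "0 \<le> c * u" using assms by auto
  show ?thesis
  proof (cases "w = 0")
    case True
    then have "(1 - c) * x = 0" "c * u = 0" using terms unfolding weq by linarith+
    then have "(1 - c) * (x * ln x) = 0" "c * (u * ln u) = 0" by auto
    then have "(1 - c) * (x * ln x) + c * (u * ln u) = 0" by linarith
    moreover have "(x + c * (u - x)) * ln (x + c * (u - x)) = 0" using True by (simp add: w_def)
    ultimately show ?thesis by (simp only: order_refl)
  next
    case False
    then have w: "0 < w" using terms unfolding weq by linarith
    have "(1 - c) * (w * ln w + (ln w + 1) * (x - w)) + c * (w * ln w + (ln w + 1) * (u - w))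
       \<le> (1 - c) * (x * ln x) + c * (u * ln u)"
      using assms w by (intro add_mono mult_left_mono xlnx_tangent) auto
    moreover have "(1 - c) * (w * ln w + (ln w + 1) * (x - w)) + c * (w * ln w + (ln w + 1) * (u - w))
       = w * ln w + (ln w + 1) * ((1 - c) * x + c * u - w)" by (simp add: algebra_simps)
    ultimately show ?thesis using weq by (simp add: w_def[symmetric])
  qed
qed

lemma entropy_concave:
  assumes "x \<in> prob_simplex" "u \<in> prob_simplex" "0 \<le> c" "c \<le> 1"
  shows "(1 - c) * entropy x + c * entropy u \<le> entropy (\<lambda>z. x z + c * (u z - x z))"
proof -
  have "(\<Sum>z\<in>UNIV. (x z + c * (u z - x z)) * ln (x z + c * (u z - x z)))
     \<le> (\<Sum>z\<in>UNIV. (1 - c) * (x z * ln (x z)) + c * (u z * ln (u z)))"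
    using assms prob_simplexD(1) by (intro sum_mono xlnx_convex) auto
  then show ?thesis by (simp add: entropy_def sum.distrib sum_distrib_left[symmetric])
qed

text \<open>The tangent at 1 gives \<open>- 1 \<le> z * ln z\<close> for every entry; a bound this
  crude suffices for the constant \<open>C\<close> of the path.\<close>

lemma entropy_bounds:
  fixes \<mu> :: "'a::finite \<Rightarrow> real"
  assumes "\<mu> \<in> prob_simplex"
  shows "0 \<le> entropy \<mu>" "entropy \<mu> \<le> CARD('a)" "\<bar>entropy \<mu>\<bar> \<le> CARD('a)"
proof -
  have "\<mu> z * ln (\<mu> z) \<le> 0" for z
    using prob_simplexD(1,3)[OF assms, of z] by (cases "\<mu> z = 0") (auto simp: mult_nonneg_nonpos)
  then have "(\<Sum>z\<in>UNIV. \<mu> z * ln (\<mu> z)) \<le> 0" by (intro sum_nonpos)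
  then show 1: "0 \<le> entropy \<mu>" by (simp add: entropy_def)
  have "- 1 \<le> \<mu> z * ln (\<mu> z)" for z
    using xlnx_tangent[of "\<mu> z" 1] prob_simplexD(1)[OF assms, of z] by simp
  then have "(\<Sum>z\<in>(UNIV::'a set). - 1) \<le> (\<Sum>z\<in>UNIV. \<mu> z * ln (\<mu> z))" by (intro sum_mono)
  then show 2: "entropy \<mu> \<le> CARD('a)" by (simp add: entropy_def)
  show "\<bar>entropy \<mu>\<bar> \<le> CARD('a)" using 1 2 by simp
qed

section \<open>Regularised payoffs, best responses and the value\<close>

definition payoff :: "real \<Rightarrow> ('a::finite \<Rightarrow> real) \<Rightarrow> ('a \<Rightarrow> real) \<Rightarrow> real" where
  "payoff \<tau> \<mu> q = (\<Sum>x\<in>UNIV. \<mu> x * q x) + \<tau> * entropy \<mu>"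

text \<open>The largest entry of \<open>q\<close> for \<open>\<tau> = 0\<close>, its log-sum-exp at
  temperature \<open>\<tau>\<close> otherwise. The supremum treats both agent types alike and makes
  the Lipschitz bound immediate.\<close>

definition best :: "real \<Rightarrow> ('a::finite \<Rightarrow> real) \<Rightarrow> real" where
  "best \<tau> q = (SUP \<mu>\<in>prob_simplex. payoff \<tau> \<mu> q)"

lemma abs_le_l2norm: "\<bar>v a\<bar> \<le> l2norm v"
proof -
  have "\<bar>v a\<bar> = sqrt ((v a)\<^sup>2)" by simp
  also have "\<dots> \<le> l2norm v" unfolding l2norm_def
    by (intro real_sqrt_le_mono member_le_sum) auto
  finally show ?thesis .
qed

lemma l2norm_nonneg: "0 \<le> l2norm v"
  by (simp add: l2norm_def sum_nonneg)

lemma l2norm_le_sum: "l2norm v \<le> (\<Sum>a\<in>UNIV. \<bar>v a\<bar>)"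
  unfolding l2norm_def
  using L2_set_le_sum_abs[of v UNIV] by (simp add: L2_set_def)

lemma sum_simplex_le:
  assumes "\<mu> \<in> prob_simplex" "\<And>a. f a \<le> c"
  shows "(\<Sum>a\<in>UNIV. \<mu> a * f a) \<le> c"
proof -
  have "(\<Sum>a\<in>UNIV. \<mu> a * f a) \<le> (\<Sum>a\<in>UNIV. \<mu> a * c)"
    using assms prob_simplexD(1) by (intro sum_mono mult_left_mono) auto
  then show ?thesis using prob_simplexD(2)[OF assms(1)] by (simp add: sum_distrib_right[symmetric])
qed

lemma payoff_diff_le:
  assumes "\<mu> \<in> prob_simplex"
  shows "payoff \<tau> \<mu> q \<le> payoff \<tau> \<mu> q' + l2norm (\<lambda>x. q x - q' x)"
proof -
  have "(\<Sum>x\<in>UNIV. \<mu> x * (q x - q' x)) \<le> l2norm (\<lambda>x. q x - q' x)"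
    by (intro sum_simplex_le assms) (meson abs_le_l2norm abs_le_D1)
  then show ?thesis by (simp add: payoff_def right_diff_distrib sum_subtractf)
qed

lemma abs_payoff_le:
  fixes \<mu> :: "'a::finite \<Rightarrow> real"
  assumes "\<mu> \<in> prob_simplex" "\<And>a. \<bar>q a\<bar> \<le> c" "0 \<le> \<tau>"
  shows "\<bar>payoff \<tau> \<mu> q\<bar> \<le> c + \<tau> * CARD('a)"
proof -
  have "(\<Sum>x\<in>UNIV. \<mu> x * q x) \<le> c" "(\<Sum>x\<in>UNIV. \<mu> x * - q x) \<le> c"
    using assms(2) by (intro sum_simplex_le assms; fastforce simp: abs_le_iff)+
  then have "\<bar>\<Sum>x\<in>UNIV. \<mu> x * q x\<bar> \<le> c" by (simp add: sum_negf abs_le_iff)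
  moreover have "\<bar>\<tau> * entropy \<mu>\<bar> \<le> \<tau> * CARD('a)"
    using entropy_bounds[OF assms(1)] assms(3) by (simp add: abs_mult mult_left_mono)
  ultimately show ?thesis unfolding payoff_def by linarith
qed

lemma bdd_above_payoff:
  fixes q :: "'a::finite \<Rightarrow> real"
  assumes "0 \<le> \<tau>"
  shows "bdd_above ((\<lambda>\<mu>. payoff \<tau> \<mu> q) ` prob_simplex)"
proof (rule bdd_aboveI2)
  fix \<mu> :: "'a \<Rightarrow> real" assume "\<mu> \<in> prob_simplex"
  from abs_payoff_le[OF this abs_le_l2norm assms] show "payoff \<tau> \<mu> q \<le> l2norm q + \<tau> * CARD('a)"
    by (rule abs_le_D1)
qed

lemma payoff_le_best: "0 \<le> \<tau> \<Longrightarrow> \<mu> \<in> prob_simplex \<Longrightarrow> payoff \<tau> \<mu> q \<le> best \<tau> q"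
  unfolding best_def by (intro cSUP_upper bdd_above_payoff)

lemma simplex_nonempty: "prob_simplex \<noteq> {}"
  using vertex_simplex by blast

lemma best_eqI:
  assumes "0 \<le> \<tau>" "\<mu> \<in> prob_simplex" "\<And>\<mu>'. \<mu>' \<in> prob_simplex \<Longrightarrow> payoff \<tau> \<mu>' q \<le> payoff \<tau> \<mu> q"
  shows "best \<tau> q = payoff \<tau> \<mu> q"
  using assms payoff_le_best[OF assms(1,2)] unfolding best_def
  by (intro antisym cSUP_least simplex_nonempty) auto

lemma best_diff_le:
  assumes "0 \<le> \<tau>"
  shows "best \<tau> q \<le> best \<tau> q' + l2norm (\<lambda>x. q x - q' x)"
  unfolding best_def[of \<tau> q]
proof (intro cSUP_least simplex_nonempty)
  fix \<mu> :: "'a \<Rightarrow> real" assume \<mu>: "\<mu> \<in> prob_simplex"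
  show "payoff \<tau> \<mu> q \<le> best \<tau> q' + l2norm (\<lambda>x. q x - q' x)"
    using payoff_diff_le[OF \<mu>, of \<tau> q q'] payoff_le_best[OF assms \<mu>, of q'] by linarith
qed

lemma abs_best_le:
  fixes q :: "'a::finite \<Rightarrow> real"
  assumes "\<And>a. \<bar>q a\<bar> \<le> c" "0 \<le> \<tau>"
  shows "\<bar>best \<tau> q\<bar> \<le> c + \<tau> * CARD('a)"
proof -
  have "best \<tau> q \<le> c + \<tau> * CARD('a)"
    unfolding best_def
  proof (intro cSUP_least simplex_nonempty)
    fix \<mu> :: "'a \<Rightarrow> real" assume "\<mu> \<in> prob_simplex"
    from abs_payoff_le[OF this assms] show "payoff \<tau> \<mu> q \<le> c + \<tau> * CARD('a)" by (rule abs_le_D1)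
  qed
  moreover have "- (c + \<tau> * CARD('a)) \<le> best \<tau> q"
  proof -
    fix a :: 'a
    show ?thesis
      using payoff_le_best[OF assms(2) vertex_simplex, of a q] abs_payoff_le[where q = q, OF vertex_simplex assms, of a]
      by (simp add: abs_le_iff)
  qed
  ultimately show ?thesis by (simp add: abs_le_iff)
qed

lemma sbr_simplex: "sbr \<tau> q \<in> prob_simplex" and sbr_pos: "0 < sbr \<tau> q a"
  for q :: "'a::finite \<Rightarrow> real"
proof -
  have Z: "0 < (\<Sum>a'\<in>UNIV. exp (q a' / \<tau>))" by (intro sum_pos) auto
  then show pos: "0 < sbr \<tau> q a" for a by (simp add: sbr_def)
  have "(\<Sum>a\<in>UNIV. sbr \<tau> q a) = 1" using Z by (simp add: sbr_def sum_divide_distrib[symmetric])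
  then show "sbr \<tau> q \<in> prob_simplex" using pos by (simp add: prob_simplex_def less_imp_le)
qed

text \<open>Gibbs' variational principle: the value \<open>\<tau> ln Z\<close> minus the payoff of \<open>\<mu>\<close> is \<open>\<tau>\<close> times the
  relative entropy of \<open>\<mu>\<close> and the softmax distribution.\<close>

lemma sbr_maximises:
  fixes q :: "'a::finite \<Rightarrow> real"
  assumes \<tau>: "0 < \<tau>" and \<mu>: "\<mu> \<in> prob_simplex"
  shows "payoff \<tau> \<mu> q \<le> payoff \<tau> (sbr \<tau> q) q"
proof -
  define Z where "Z = (\<Sum>a'\<in>UNIV. exp (q a' / \<tau>))"
  have Z: "0 < Z" unfolding Z_def by (intro sum_pos) auto
  have "ln (sbr \<tau> q a) = q a / \<tau> - ln Z" for a
    using Z by (simp add: sbr_def Z_def[symmetric] ln_div)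
  then have q: "q a = \<tau> * (ln (sbr \<tau> q a) + ln Z)" for a using \<tau> by simp
  have pay: "payoff \<tau> \<nu> q = \<tau> * (ln Z + (\<Sum>a\<in>UNIV. \<nu> a * (ln (sbr \<tau> q a) - ln (\<nu> a))))"
    if "\<nu> \<in> prob_simplex" for \<nu>
  proof -
    have "(\<Sum>a\<in>UNIV. \<nu> a * q a) = (\<Sum>a\<in>UNIV. \<tau> * (\<nu> a * ln (sbr \<tau> q a) + \<nu> a * ln Z))"
      by (subst q) (simp add: algebra_simps)
    then show ?thesis using prob_simplexD(2)[OF that]
      by (simp add: payoff_def entropy_def right_diff_distrib sum.distrib sum_subtractf distrib_left
        sum_distrib_left[symmetric] sum_distrib_right[symmetric])
  qed
  have "(\<Sum>a\<in>UNIV. \<mu> a * (ln (sbr \<tau> q a) - ln (\<mu> a))) \<le> (\<Sum>a\<in>UNIV. sbr \<tau> q a - \<mu> a)"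
  proof (intro sum_mono)
    fix a
    show "\<mu> a * (ln (sbr \<tau> q a) - ln (\<mu> a)) \<le> sbr \<tau> q a - \<mu> a"
      using xlnx_tangent[OF prob_simplexD(1)[OF \<mu>, of a] sbr_pos[of \<tau> q a]] by (simp add: algebra_simps)
  qed
  also have "\<dots> = 0" using prob_simplexD(2)[OF \<mu>] prob_simplexD(2)[OF sbr_simplex[of \<tau> q]] by (simp add: sum_subtractf)
  finally show ?thesis using \<tau> pay[OF \<mu>] pay[OF sbr_simplex[of \<tau> q]] by simp
qed

lemma strat_simplex: "strat brt \<tau> q a \<in> prob_simplex"
  by (simp add: strat_def sbr_simplex)

text \<open>Unites the two agent types: a vertex on a maximal entry at temperature zero, the softmax
  at positive temperature. The pathwise argument distinguishes them only through this
  optimality.\<close>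

lemma best_strat:
  assumes "agent_ok brt \<tau> \<theta> kn" "brt \<Longrightarrow> a \<in> br_set q"
  shows "best \<tau> q = payoff \<tau> (strat brt \<tau> q a) q"
proof (rule best_eqI)
  show "0 \<le> \<tau>" using assms(1) by (auto simp: agent_ok_def split: if_splits)
  fix \<mu> :: "'a \<Rightarrow> real" assume \<mu>: "\<mu> \<in> prob_simplex"
  show "payoff \<tau> \<mu> q \<le> payoff \<tau> (strat brt \<tau> q a) q"
  proof (cases brt)
    case True
    then have "\<tau> = 0" "\<And>a'. q a' \<le> q a" using assms by (auto simp: agent_ok_def br_set_def)
    then show ?thesis using True sum_simplex_le[OF \<mu>, of q] by (simp add: payoff_def strat_def)
  next
    case False
    then show ?thesis using assms(1) sbr_maximises[OF _ \<mu>, of \<tau> q] by (simp add: agent_ok_def strat_def)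
  qed
qed (rule strat_simplex)

lemma bil_eq_mv: "bil \<mu> R \<nu> = (\<Sum>x\<in>UNIV. \<mu> x * mv R \<nu> x)"
  by (simp add: bil_def mv_def sum_distrib_left mult.assoc)

lemma payoff_mv: "payoff \<tau> \<mu> (mv R \<nu>) = bil \<mu> R \<nu> + \<tau> * entropy \<mu>"
  by (simp add: payoff_def bil_eq_mv)

lemma abs_mv_le:
  fixes R :: "'a::finite \<Rightarrow> 'b::finite \<Rightarrow> real"
  assumes "\<nu> \<in> prob_simplex" "\<And>a b. \<bar>R a b\<bar> \<le> C"
  shows "\<bar>mv R \<nu> a\<bar> \<le> C"
  using abs_bil_simplex_le[OF vertex_simplex[of a] assms] by (simp add: bil_eq_mv)

lemma abs_le_maxnorm: "\<bar>R a b\<bar> \<le> maxnorm R"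
  unfolding maxnorm_def by (rule Max_ge) (auto intro!: rev_image_eqI[of "(a, b)"])

lemma maxnorm_nonneg: "0 \<le> maxnorm R"
  using abs_le_maxnorm[of R undefined undefined] by linarith

lemma bil_add_transpose_le_maxnorm:
  assumes "\<mu> \<in> prob_simplex" "\<nu> \<in> prob_simplex"
  shows "bil \<mu> R1 \<nu> + bil \<nu> R2 \<mu> \<le> maxnorm (\<lambda>x y. R1 x y + R2 y x)"
proof -
  have "bil \<mu> R1 \<nu> + bil \<nu> R2 \<mu> = bil \<mu> (\<lambda>x y. R1 x y + R2 y x) \<nu>"
    unfolding bil_swap[of \<nu> R2] by (simp add: bil_def algebra_simps sum.distrib)
  also have "\<dots> \<le> maxnorm (\<lambda>x y. R1 x y + R2 y x)"
    using abs_bil_simplex_le[OF assms abs_le_maxnorm] by (rule abs_le_D1)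
  finally show ?thesis .
qed

text \<open>For each \<open>\<mu>\<close> the infimum over the opponent is at most the value at
  \<open>\<pi>\<close>, and the best reply to \<open>\<pi>\<close> does at least as well as
  \<open>\<mu>\<close>.\<close>

lemma sval_le:
  fixes R :: "'a::finite \<Rightarrow> 'b::finite \<Rightarrow> real"
  assumes \<pi>: "\<pi> \<in> prob_simplex" and \<tau>: "0 \<le> \<tau>i" "0 \<le> \<tau>j"
  shows "sval \<tau>i \<tau>j R \<le> best \<tau>i (mv R \<pi>) - \<tau>j * entropy \<pi>"
  unfolding sval_def
proof (intro cSUP_least simplex_nonempty)
  fix \<mu> :: "'a \<Rightarrow> real" assume \<mu>: "\<mu> \<in> prob_simplex"
  let ?f = "\<lambda>\<nu>. bil \<mu> R \<nu> + \<tau>i * entropy \<mu> - \<tau>j * entropy \<nu>"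
  \<comment> \<open>A real infimum lies below its members only when the set is bounded
    below.\<close>
  have "bdd_below (?f ` prob_simplex)"
  proof (rule bdd_belowI2)
    fix \<nu> :: "'b \<Rightarrow> real" assume \<nu>: "\<nu> \<in> prob_simplex"
    have "\<bar>bil \<mu> R \<nu>\<bar> \<le> maxnorm R"
      by (rule abs_bil_simplex_le[OF \<mu> \<nu>]) (rule abs_le_maxnorm)
    then have "- maxnorm R \<le> bil \<mu> R \<nu>" by (simp add: abs_le_iff)
    moreover have "0 \<le> \<tau>i * entropy \<mu>" using \<tau> entropy_bounds(1)[OF \<mu>] by simp
    moreover have "\<tau>j * entropy \<nu> \<le> \<tau>j * CARD('b)" using \<tau> entropy_bounds(2)[OF \<nu>] by (intro mult_left_mono)
    ultimately show "- maxnorm R - \<tau>j * CARD('b) \<le> ?f \<nu>" by linarith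
  qed
  then have "(INF \<nu>\<in>prob_simplex. ?f \<nu>) \<le> ?f \<pi>" using \<pi> by (rule cINF_lower)
  also have "\<dots> \<le> best \<tau>i (mv R \<pi>) - \<tau>j * entropy \<pi>"
    using payoff_le_best[OF \<tau>(1) \<mu>, of "mv R \<pi>"] by (simp add: payoff_mv)
  finally show "(INF \<nu>\<in>prob_simplex. ?f \<nu>) \<le> best \<tau>i (mv R \<pi>) - \<tau>j * entropy \<pi>" .
qed

lemma delta_eq_best:
  assumes "agent_ok brt \<tau>i \<theta> kn" "brt \<Longrightarrow> a \<in> br_set q"
  shows "delta \<tau>i \<tau>j R (strat brt \<tau>i q a) q \<pi> = best \<tau>i q - \<tau>j * entropy \<pi> - sval \<tau>i \<tau>j R"
  using best_strat[OF assms] by (simp add: delta_def payoff_def)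

lemma agent_temp_nonneg: "agent_ok brt \<tau> \<theta> kn \<Longrightarrow> 0 \<le> \<tau>"
  by (auto simp: agent_ok_def split: if_splits)

text \<open>With \<open>mv R \<pi>\<close> in place of \<open>q\<close> the quantity would be
  nonnegative by \<open>sval_le\<close>. As \<open>best\<close> is 1-Lipschitz, passing to
  \<open>q\<close> costs at most the norm, whence the minus sign.\<close>

lemma delta_ge:
  assumes "agent_ok brt \<tau>i \<theta> kn" "brt \<Longrightarrow> a \<in> br_set q" "\<pi> \<in> prob_simplex" "0 \<le> \<tau>j"
  shows "- l2norm (\<lambda>x. q x - mv R \<pi> x) \<le> delta \<tau>i \<tau>j R (strat brt \<tau>i q a) q \<pi>"
proof -
  have \<tau>: "0 \<le> \<tau>i" by (rule agent_temp_nonneg[OF assms(1)])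
  have "l2norm (\<lambda>x. mv R \<pi> x - q x) = l2norm (\<lambda>x. q x - mv R \<pi> x)"
    by (simp add: l2norm_def power2_commute)
  then show ?thesis
    using sval_le[OF assms(3) \<tau> assms(4), of R] best_diff_le[OF \<tau>, of "mv R \<pi>" q]
      delta_eq_best[OF assms(1,2), of \<tau>j R \<pi>] by linarith
qed

section \<open>From the learning path to the noise-free path\<close>

text \<open>Once \<open>e < \<delta> / 2\<close>, the excess of \<open>z\<close> over
  \<open>\<delta> / 2\<close> shrinks by \<open>1 - a k \<le> exp (- a k)\<close>, and the divergent
  sum of \<open>a\<close> sends the product to zero.\<close>

lemma recursion_tendsto_zero:
  fixes z a e :: "nat \<Rightarrow> real"
  assumes z: "\<And>k. 0 \<le> z k" and a: "\<And>k. 0 \<le> a k" "\<And>k. a k \<le> 1" "\<not> summable a"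
    and e: "e \<longlonglongrightarrow> 0" and step: "\<And>k. z (Suc k) \<le> (1 - a k) * z k + a k * e k"
  shows "z \<longlonglongrightarrow> 0"
proof (rule LIMSEQ_I)
  fix \<delta> :: real assume \<delta>: "0 < \<delta>"
  obtain K where K: "\<And>k. K \<le> k \<Longrightarrow> e k < \<delta> / 2"
    using order_tendstoD(2)[OF e, of "\<delta> / 2"] \<delta> by (auto simp: eventually_sequentially)
  have decay: "z k - \<delta> / 2 \<le> exp (- sum a {K..<k}) * \<bar>z K\<bar>" if "K \<le> k" for k
    using that
  proof (induction k rule: dec_induct)
    case base then show ?case using \<delta> by simp
  next
    case (step k)
    have "a k * e k \<le> a k * (\<delta> / 2)" using K[of k] step a(1) by (intro mult_left_mono) auto
    then have "z (Suc k) - \<delta> / 2 \<le> (1 - a k) * (z k - \<delta> / 2)"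
      using assms(6)[of k] by (simp add: field_simps)
    also have "\<dots> \<le> (1 - a k) * (exp (- sum a {K..<k}) * \<bar>z K\<bar>)"
      using step a(2) by (intro mult_left_mono) auto
    also have "\<dots> \<le> exp (- a k) * (exp (- sum a {K..<k}) * \<bar>z K\<bar>)"
      using exp_ge_add_one_self[of "- a k"] by (intro mult_right_mono) auto
    also have "\<dots> = exp (- sum a {K..<Suc k}) * \<bar>z K\<bar>"
    proof -
      have "sum a {K..<Suc k} = a k + sum a {K..<k}" using step by simp
      then show ?thesis by (simp add: mult_exp_exp mult.assoc[symmetric])
    qed
    finally show ?case .
  qed
  \<comment> \<open>Chosen so that \<open>exp (- c) * (\<bar>z K\<bar> + 1) = \<delta> / 4\<close>;
    the summand 1 covers \<open>z K = 0\<close>.\<close>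
  define c where "c = ln ((\<bar>z K\<bar> + 1) * 4 / \<delta>)"
  have "\<exists>n. sum a {..<K} + c < sum a {..<n}"
  proof (rule ccontr)
    assume "\<not> ?thesis"
    then have "summable a" using a(1) by (intro summableI_nonneg_bounded[of a "sum a {..<K} + c"]) (auto simp: not_less)
    with a(3) show False by simp
  qed
  then obtain n where n: "sum a {..<K} + c < sum a {..<n}" by blast
  have "z k < \<delta>" if k: "max K n \<le> k" for k
  proof -
    have "sum a {..<n} \<le> sum a {..<k}" using a(1) k by (intro sum_mono2) auto
    moreover have "sum a {..<k} = sum a {..<K} + sum a {K..<k}"
      using k by (metis atLeast0LessThan max.bounded_iff sum.atLeastLessThan_concat zero_le)
    ultimately have "- sum a {K..<k} \<le> - c" using n by linarith
    then have "exp (- sum a {K..<k}) \<le> exp (- c)" by simp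
    also have "\<dots> = \<delta> / ((\<bar>z K\<bar> + 1) * 4)"
      unfolding c_def using \<delta> by (subst ln_inverse[symmetric]) auto
    finally have "exp (- sum a {K..<k}) * \<bar>z K\<bar> \<le> \<delta> / ((\<bar>z K\<bar> + 1) * 4) * (\<bar>z K\<bar> + 1)"
      using \<delta> by (intro mult_mono) auto
    also have "\<dots> = \<delta> / 4" by (simp add: field_simps)
    finally show ?thesis using decay[of k] k \<delta> by simp
  qed
  then show "\<exists>no. \<forall>k\<ge>no. norm (z k - 0) < \<delta>" using z by (intro exI[of _ "max K n"]) auto
qed

lemma continuous_on_xlnx: "continuous_on {0..1} (\<lambda>z::real. z * ln z)"
  unfolding continuous_on_eq_continuous_within
proof
  fix x :: real assume x: "x \<in> {0..1}"
  show "continuous (at x within {0..1}) (\<lambda>z. z * ln z)"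
  proof (cases "x = 0")
    case False
    then have "isCont (\<lambda>z. z * ln z) x" using x by (intro continuous_intros) auto
    then show ?thesis by (rule continuous_at_imp_continuous_at_within)
  next
    case True
    \<comment> \<open>From \<open>ln u \<le> u - 1\<close> at \<open>u = 1 / sqrt z\<close>; it
      settles continuity at 0, the one delicate point.\<close>
    have bound: "\<bar>z * ln z\<bar> \<le> 2 * sqrt z" if "z \<in> {0..1}" for z :: real
    proof (cases "z = 0")
      case False
      then have z: "0 < z" "z \<le> 1" using that by auto
      have "ln (1 / sqrt z) \<le> 1 / sqrt z - 1" using z by (intro ln_le_minus_one) auto
      then have "- ln z \<le> 2 * (1 / sqrt z - 1)" using z by (simp add: ln_div ln_sqrt)
      then have "z * (- ln z) \<le> z * (2 * (1 / sqrt z - 1))" using z by (intro mult_left_mono) auto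
      also have "\<dots> = 2 * (z / sqrt z) - 2 * z" by (simp add: algebra_simps)
      also have "z / sqrt z = sqrt z" using z by (simp add: real_div_sqrt)
      finally have "- (z * ln z) \<le> 2 * sqrt z" using z by simp
      moreover have "z * ln z \<le> 0" using z by (simp add: mult_nonneg_nonpos)
      ultimately show ?thesis by simp
    qed simp
    have "((\<lambda>z. 2 * sqrt z) \<longlongrightarrow> 2 * sqrt 0) (at 0 within {0..1})" by (intro tendsto_intros)
    then have lim: "((\<lambda>z. 2 * sqrt z) \<longlongrightarrow> 0) (at 0 within {0..1})" by simp
    have "((\<lambda>z::real. z * ln z) \<longlongrightarrow> 0) (at 0 within {0..1})"
    proof (rule Lim_null_comparison[OF _ lim])
      show "\<forall>\<^sub>F z in at 0 within {0..1}. norm (z * ln z) \<le> 2 * sqrt (z::real)"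
        unfolding eventually_at_filter real_norm_def by (intro always_eventually allI impI bound)
    qed
    then show ?thesis by (simp add: continuous_within True)
  qed
qed

text \<open>Neither sequence need converge, so continuity has to be uniform, which compactness of
  the unit interval provides.\<close>

lemma entropy_diff_tendsto:
  fixes \<mu> \<nu> :: "nat \<Rightarrow> 'a::finite \<Rightarrow> real"
  assumes "\<And>k. \<mu> k \<in> prob_simplex" "\<And>k. \<nu> k \<in> prob_simplex" and lim: "\<And>z. (\<lambda>k. \<mu> k z - \<nu> k z) \<longlonglongrightarrow> 0"
  shows "(\<lambda>k. entropy (\<mu> k) - entropy (\<nu> k)) \<longlonglongrightarrow> 0"
proof -
  have uc: "uniformly_continuous_on {0..1} (\<lambda>z::real. z * ln z)"
    by (intro compact_uniformly_continuous continuous_on_xlnx) auto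
  have "(\<lambda>k. \<mu> k z * ln (\<mu> k z) - \<nu> k z * ln (\<nu> k z)) \<longlonglongrightarrow> 0" for z
  proof -
    have "(\<lambda>k. dist (\<mu> k z) (\<nu> k z)) \<longlonglongrightarrow> 0"
      using lim[of z] by (simp add: dist_real_def tendsto_rabs_zero_iff)
    then have "(\<lambda>k. dist (\<mu> k z * ln (\<mu> k z)) (\<nu> k z * ln (\<nu> k z))) \<longlonglongrightarrow> 0"
      using uc[unfolded uniformly_continuous_on_sequentially, THEN spec, of "\<lambda>k. \<mu> k z", THEN spec, of "\<lambda>k. \<nu> k z"]
        prob_simplexD(1,3)[OF assms(1)] prob_simplexD(1,3)[OF assms(2)] by simp
    then show ?thesis by (simp add: dist_real_def tendsto_rabs_zero_iff)
  qed
  then have "(\<lambda>k. - (\<Sum>z\<in>UNIV. \<mu> k z * ln (\<mu> k z) - \<nu> k z * ln (\<nu> k z))) \<longlonglongrightarrow> - (\<Sum>z\<in>(UNIV::'a set). 0)"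
    by (intro tendsto_intros)
  then show ?thesis by (simp add: entropy_def sum_subtractf algebra_simps)
qed

lemma l2norm_tendsto_zero_iff:
  "(\<lambda>k. l2norm (v k)) \<longlonglongrightarrow> 0 \<longleftrightarrow> (\<forall>a. (\<lambda>k. v k a) \<longlonglongrightarrow> 0)"
proof safe
  fix a assume "(\<lambda>k. l2norm (v k)) \<longlonglongrightarrow> 0"
  then show "(\<lambda>k. v k a) \<longlonglongrightarrow> 0"
    by (rule Lim_null_comparison[rotated]) (simp add: abs_le_l2norm)
next
  assume "\<forall>a. (\<lambda>k. v k a) \<longlonglongrightarrow> 0"
  then have "(\<lambda>k. \<Sum>a\<in>UNIV. \<bar>v k a\<bar>) \<longlonglongrightarrow> (\<Sum>a\<in>(UNIV::'a set). 0)"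
    by (intro tendsto_sum) (simp add: tendsto_rabs_zero_iff)
  then show "(\<lambda>k. l2norm (v k)) \<longlonglongrightarrow> 0"
    by (intro Lim_null_comparison[of "\<lambda>k. l2norm (v k)" "\<lambda>k. \<Sum>a\<in>UNIV. \<bar>v k a\<bar>"])
      (auto simp: l2norm_nonneg l2norm_le_sum)
qed

lemma mv_diff: "mv R \<nu> a - mv R \<nu>' a = (\<Sum>b\<in>UNIV. R a b * (\<nu> b - \<nu>' b))"
  by (simp add: mv_def right_diff_distrib sum_subtractf)

lemma estimate_error_transfer:
  assumes q: "(\<lambda>k. l2norm (\<lambda>a. q k a - mv R (\<pi> k) a)) \<longlonglongrightarrow> 0"
    and \<pi>: "\<And>b. (\<lambda>k. \<pi> k b - x k b) \<longlonglongrightarrow> 0"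
  shows "(\<lambda>k. l2norm (\<lambda>a. q k a - mv R (x k) a)) \<longlonglongrightarrow> 0"
  unfolding l2norm_tendsto_zero_iff
proof
  fix a
  have "(\<lambda>k. (q k a - mv R (\<pi> k) a) + (\<Sum>b\<in>UNIV. R a b * (\<pi> k b - x k b))) \<longlonglongrightarrow> 0 + (\<Sum>b\<in>UNIV. R a b * 0)"
    using q by (intro tendsto_intros \<pi>) (simp add: l2norm_tendsto_zero_iff)
  then show "(\<lambda>k. q k a - mv R (x k) a) \<longlonglongrightarrow> 0" by (simp add: mv_diff[symmetric])
qed

lemma best_diff_tendsto:
  assumes "0 \<le> \<tau>" and lim: "(\<lambda>k. l2norm (\<lambda>a. q k a - q' k a)) \<longlonglongrightarrow> 0"
  shows "(\<lambda>k. best \<tau> (q k) - best \<tau> (q' k)) \<longlonglongrightarrow> 0"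
proof (rule Lim_null_comparison[OF _ lim])
  have "l2norm (\<lambda>a. q' k a - q k a) = l2norm (\<lambda>a. q k a - q' k a)" for k
    by (simp add: l2norm_def power2_commute)
  then show "\<forall>\<^sub>F k in sequentially. norm (best \<tau> (q k) - best \<tau> (q' k)) \<le> l2norm (\<lambda>a. q k a - q' k a)"
  proof (intro always_eventually allI)
    fix k
    show "norm (best \<tau> (q k) - best \<tau> (q' k)) \<le> l2norm (\<lambda>a. q k a - q' k a)"
      using best_diff_le[OF assms(1), of "q k" "q' k"] best_diff_le[OF assms(1), of "q' k" "q k"]
        \<open>l2norm (\<lambda>a. q' k a - q k a) = l2norm (\<lambda>a. q k a - q' k a)\<close> by (simp add: abs_le_iff)
  qed
qed

text \<open>These become the assumptions \<open>top1\<close>, \<open>inc1\<close> and their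
  counterparts for player 2. The factor 2 arises because \<open>q\<close> stands in for
  \<open>mv R x\<close> twice, in the best payoff and in the payoff of \<open>\<mu>\<close>. The
  second claim is the subgradient inequality: \<open>\<mu>\<close> competes against
  \<open>x'\<close> as well.\<close>

lemma near_optimal:
  fixes R :: "'a::finite \<Rightarrow> 'b::finite \<Rightarrow> real"
  assumes \<mu>: "\<mu> \<in> prob_simplex" and opt: "best \<tau> q = payoff \<tau> \<mu> q" and \<tau>: "0 \<le> \<tau>"
  shows "best \<tau> (mv R x) \<le> bil \<mu> R x + \<tau> * entropy \<mu> + 2 * l2norm (\<lambda>a. q a - mv R x a)"
    and "best \<tau> (mv R x) - best \<tau> (mv R x') \<le> bil \<mu> R x - bil \<mu> R x' + 2 * l2norm (\<lambda>a. q a - mv R x a)"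
proof -
  have "l2norm (\<lambda>a. mv R x a - q a) = l2norm (\<lambda>a. q a - mv R x a)"
    by (simp add: l2norm_def power2_commute)
  then show 1: "best \<tau> (mv R x) \<le> bil \<mu> R x + \<tau> * entropy \<mu> + 2 * l2norm (\<lambda>a. q a - mv R x a)"
    using best_diff_le[OF \<tau>, of "mv R x" q] payoff_diff_le[OF \<mu>, of \<tau> q "mv R x"] opt by (simp add: payoff_mv)
  show "best \<tau> (mv R x) - best \<tau> (mv R x') \<le> bil \<mu> R x - bil \<mu> R x' + 2 * l2norm (\<lambda>a. q a - mv R x a)"
    using 1 payoff_le_best[OF \<tau> \<mu>, of "mv R x'"] by (simp add: payoff_mv)
qed

lemma neg_entropy_step:
  assumes "x \<in> prob_simplex" "u \<in> prob_simplex" "0 \<le> c" "c \<le> 1" "0 \<le> \<tau>"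
  shows "- \<tau> * entropy (\<lambda>z. x z + c * (u z - x z)) \<le> - \<tau> * entropy x - c * (- \<tau> * entropy x + \<tau> * entropy u)"
  using mult_left_mono[OF entropy_concave[OF assms(1-4)] assms(5)] by (simp add: algebra_simps)

text \<open>The recursion of \<open>empseq\<close> with arbitrary inputs: played vertices give the
  empirical average, strategies give the noise-free path from the same start.\<close>

primrec average :: "(nat \<Rightarrow> real) \<Rightarrow> ('a \<Rightarrow> real) \<Rightarrow> (nat \<Rightarrow> 'a \<Rightarrow> real) \<Rightarrow> nat \<Rightarrow> 'a \<Rightarrow> real" where
  "average c x0 u 0 = x0"
| "average c x0 u (Suc k) = (\<lambda>z. average c x0 u k z + c k * (u k z - average c x0 u k z))"

lemma empseq_eq_average: "empseq \<alpha> \<pi>0 a k = average \<alpha> \<pi>0 (\<lambda>k. vertex (a k)) k"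
  by (induction k) auto

lemma average_simplex:
  assumes "x0 \<in> prob_simplex" "\<And>k. u k \<in> prob_simplex" "\<And>k. 0 \<le> c k" "\<And>k. c k \<le> 1"
  shows "average c x0 u k \<in> prob_simplex"
  using assms by (induction k) (auto intro!: simplex_step)

text \<open>Passes from the steps \<open>\<alpha>1\<close> to the exact multiple
  \<open>d * \<alpha>2\<close> that \<open>game_path\<close> demands. The gap contracts at rate
  \<open>c'\<close> and is driven by \<open>\<bar>c k / c' k - 1\<bar>\<close>, which tends to
  zero.\<close>

lemma average_change_steps:
  assumes x0: "x0 \<in> prob_simplex" and u: "\<And>k. u k \<in> prob_simplex"
    and c: "\<And>k. 0 \<le> c k" "\<And>k. c k \<le> 1" and c': "\<And>k. 0 < c' k" "\<And>k. c' k \<le> 1" "\<not> summable c'"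
    and ratio: "(\<lambda>k. c k / c' k) \<longlonglongrightarrow> 1"
  shows "(\<lambda>k. average c x0 u k z - average c' x0 u k z) \<longlonglongrightarrow> 0"
proof -
  let ?z = "\<lambda>k. \<bar>average c x0 u k z - average c' x0 u k z\<bar>"
  have "?z \<longlonglongrightarrow> 0"
  proof (rule recursion_tendsto_zero[where a = c' and e = "\<lambda>k. \<bar>c k / c' k - 1\<bar>"])
    show "(\<lambda>k. \<bar>c k / c' k - 1\<bar>) \<longlonglongrightarrow> 0"
      using ratio LIM_zero_iff[of "\<lambda>k. c k / c' k" 1] by (simp add: tendsto_rabs_zero_iff)
    fix k
    let ?x = "average c x0 u k z" and ?y = "average c' x0 u k z"
    have "average c x0 u (Suc k) z - average c' x0 u (Suc k) z
       = (1 - c' k) * (?x - ?y) + (c k - c' k) * (u k z - ?x)" by (simp add: algebra_simps)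
    also have "\<bar>\<dots>\<bar> \<le> \<bar>(1 - c' k) * (?x - ?y)\<bar> + \<bar>(c k - c' k) * (u k z - ?x)\<bar>" by (rule abs_triangle_ineq)
    also have "\<bar>(1 - c' k) * (?x - ?y)\<bar> = (1 - c' k) * ?z k" using c'(2)[of k] by (simp add: abs_mult)
    also have "\<bar>(c k - c' k) * (u k z - ?x)\<bar> \<le> c' k * \<bar>c k / c' k - 1\<bar>"
    proof -
      have "c k - c' k = c' k * (c k / c' k - 1)" using c'(1)[of k] by (simp add: field_simps)
      then have "\<bar>c k - c' k\<bar> = c' k * \<bar>c k / c' k - 1\<bar>" using c'(1)[of k] by (simp add: abs_mult)
      moreover have "average c x0 u k \<in> prob_simplex" by (rule average_simplex; rule x0 u c)
      then have "\<bar>u k z - ?x\<bar> \<le> 1"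
        using prob_simplexD(1,3)[OF u[of k], of z] prob_simplexD(1,3)[of "average c x0 u k" z] by auto
      ultimately show ?thesis
        using mult_left_mono[of "\<bar>u k z - ?x\<bar>" 1 "\<bar>c k - c' k\<bar>"] by (simp add: abs_mult)
    qed
    finally show "?z (Suc k) \<le> (1 - c' k) * ?z k + c' k * \<bar>c k / c' k - 1\<bar>" by simp
  qed (use c' less_imp_le[OF c'(1)] in auto)
  then show ?thesis by (simp add: tendsto_rabs_zero_iff)
qed

text \<open>The deterministic half: on a path where estimates track averages and averages track
  noise-free paths, \<open>game_path\<close> is instantiated at those paths \<open>x\<close> and
  \<open>y\<close>.\<close>

theorem pathwise_limsup:
  fixes R1 :: "'a1::finite \<Rightarrow> 'a2::finite \<Rightarrow> real" and R2 :: "'a2 \<Rightarrow> 'a1 \<Rightarrow> real"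
  assumes ok: "agent_ok brt1 \<tau>1 \<theta>1 kn1" "agent_ok brt2 \<tau>2 \<theta>2 kn2"
    and \<alpha>1: "\<And>k. 0 < \<alpha>1 k" "\<And>k. \<alpha>1 k < 1"
    and \<alpha>2: "\<And>k. 0 < \<alpha>2 k" "\<And>k. \<alpha>2 k < 1" "\<alpha>2 \<longlonglongrightarrow> 0" "\<not> summable \<alpha>2"
    and ratio: "(\<lambda>k. \<alpha>1 k / \<alpha>2 k) \<longlonglongrightarrow> d" and d: "0 < d" "d \<le> 1"
    and init: "\<pi>10 \<in> prob_simplex" "\<pi>20 \<in> prob_simplex"
    and br: "\<And>k. brt1 \<Longrightarrow> a1 k \<in> br_set (q1 k)" "\<And>k. brt2 \<Longrightarrow> a2 k \<in> br_set (q2 k)"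
    and \<pi>: "\<And>k. \<pi>1 k \<in> prob_simplex" "\<And>k. \<pi>2 k \<in> prob_simplex"
    and q1: "(\<lambda>k. l2norm (\<lambda>a. q1 k a - mv R1 (\<pi>2 k) a)) \<longlonglongrightarrow> 0"
    and q2: "(\<lambda>k. l2norm (\<lambda>a. q2 k a - mv R2 (\<pi>1 k) a)) \<longlonglongrightarrow> 0"
    and \<mu>: "\<And>k. \<mu> k = strat brt1 \<tau>1 (q1 k) (a1 k)" and \<nu>: "\<And>k. \<nu> k = strat brt2 \<tau>2 (q2 k) (a2 k)"
    and \<pi>1_lim: "\<And>z. (\<lambda>k. \<pi>1 k z - average \<alpha>2 \<pi>10 \<mu> k z) \<longlonglongrightarrow> 0"
    and \<pi>2_lim: "\<And>z. (\<lambda>k. \<pi>2 k z - average \<alpha>1 \<pi>20 \<nu> k z) \<longlonglongrightarrow> 0"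
    and \<delta>: "0 < \<delta>"
  shows "\<forall>\<^sub>F k in sequentially. delta \<tau>1 \<tau>2 R1 (\<mu> k) (q1 k) (\<pi>2 k) + d * delta \<tau>2 \<tau>1 R2 (\<nu> k) (q2 k) (\<pi>1 k)
     \<le> maxnorm (\<lambda>x y. R1 x y + R2 y x) - (sval \<tau>1 \<tau>2 R1 + sval \<tau>2 \<tau>1 R2) + \<delta>"
proof -
  note \<tau> = ok[THEN agent_temp_nonneg]
  have \<mu>s: "\<mu> k \<in> prob_simplex" and \<nu>s: "\<nu> k \<in> prob_simplex" for k by (simp_all add: \<mu> \<nu> strat_simplex)
  have opt1: "best \<tau>1 (q1 k) = payoff \<tau>1 (\<mu> k) (q1 k)" for k
    unfolding \<mu> by (rule best_strat[OF ok(1) br(1)])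
  have opt2: "best \<tau>2 (q2 k) = payoff \<tau>2 (\<nu> k) (q2 k)" for k
    unfolding \<nu> by (rule best_strat[OF ok(2) br(2)])
  define x where "x = average (\<lambda>k. d * \<alpha>2 k) \<pi>20 \<nu>"
  define y where "y = average \<alpha>2 \<pi>10 \<mu>"
  have d\<alpha>: "0 < d * \<alpha>2 k" "d * \<alpha>2 k \<le> 1" for k
    using d \<alpha>2(1,2)[of k] by (auto intro!: mult_le_one)
  have nonneg: "0 \<le> d * \<alpha>2 k" "0 \<le> \<alpha>2 k" "\<alpha>2 k \<le> 1" "0 \<le> \<alpha>1 k" "\<alpha>1 k \<le> 1" for k
    using d\<alpha>(1)[of k] \<alpha>2(1,2)[of k] \<alpha>1[of k] by auto
  have xs: "x k \<in> prob_simplex" for k unfolding x_def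
    by (rule average_simplex) (use init \<nu>s d\<alpha> nonneg in auto)
  have ys: "y k \<in> prob_simplex" for k unfolding y_def
    by (rule average_simplex) (use init \<mu>s nonneg in auto)
  have x_lim: "(\<lambda>k. \<pi>2 k z - x k z) \<longlonglongrightarrow> 0" for z
  proof -
    have "(\<lambda>k. average \<alpha>1 \<pi>20 \<nu> k z - x k z) \<longlonglongrightarrow> 0" unfolding x_def
    proof (rule average_change_steps)
      have "(\<lambda>k. \<alpha>1 k / \<alpha>2 k / d) \<longlonglongrightarrow> d / d" using d by (intro tendsto_intros ratio) auto
      then show "(\<lambda>k. \<alpha>1 k / (d * \<alpha>2 k)) \<longlonglongrightarrow> 1" using d by (simp add: mult.commute)
      show "\<not> summable (\<lambda>k. d * \<alpha>2 k)" using \<alpha>2(4) d by (simp add: summable_cmult_iff)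
    qed (use init \<nu>s d\<alpha> nonneg in auto)
    from tendsto_add[OF \<pi>2_lim[of z] this] show ?thesis by simp
  qed
  have y_lim: "(\<lambda>k. \<pi>1 k z - y k z) \<longlonglongrightarrow> 0" for z using \<pi>1_lim by (simp add: y_def)
  define E1 where "E1 k = l2norm (\<lambda>a. q1 k a - mv R1 (x k) a)" for k
  define E2 where "E2 k = l2norm (\<lambda>a. q2 k a - mv R2 (y k) a)" for k
  have E1: "E1 \<longlonglongrightarrow> 0" unfolding E1_def by (rule estimate_error_transfer[OF q1 x_lim])
  have E2: "E2 \<longlonglongrightarrow> 0" unfolding E2_def by (rule estimate_error_transfer[OF q2 y_lim])
  have E0: "0 \<le> E1 k" "0 \<le> E2 k" for k by (simp_all add: E1_def E2_def l2norm_nonneg)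
  define C where "C = 1 + maxnorm R1 + maxnorm R2 + \<tau>1 * CARD('a1) + \<tau>2 * CARD('a2)"
  have nn: "0 \<le> maxnorm R1" "0 \<le> maxnorm R2" "0 \<le> \<tau>1 * CARD('a1)" "0 \<le> \<tau>2 * CARD('a2)"
    using \<tau> by (auto simp: maxnorm_nonneg)
  have ent1: "\<bar>\<tau>1 * entropy u\<bar> \<le> C" if "u \<in> prob_simplex" for u :: "'a1 \<Rightarrow> real"
  proof -
    have "\<bar>\<tau>1 * entropy u\<bar> \<le> \<tau>1 * CARD('a1)"
      using entropy_bounds[OF that] \<tau> by (simp add: abs_mult mult_left_mono)
    then show ?thesis using nn by (simp add: C_def)
  qed
  have ent2: "\<bar>\<tau>2 * entropy u\<bar> \<le> C" if "u \<in> prob_simplex" for u :: "'a2 \<Rightarrow> real"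
  proof -
    have "\<bar>\<tau>2 * entropy u\<bar> \<le> \<tau>2 * CARD('a2)"
      using entropy_bounds[OF that] \<tau> by (simp add: abs_mult mult_left_mono)
    then show ?thesis using nn by (simp add: C_def)
  qed
  have R1C: "\<bar>R1 a b\<bar> \<le> C" and R2C: "\<bar>R2 b a\<bar> \<le> C" for a b
    using abs_le_maxnorm[of R1 a b] abs_le_maxnorm[of R2 b a] nn by (auto simp: C_def)
  interpret game_path \<alpha>2 "\<lambda>k. 2 * (E1 k + E2 k)" d C "maxnorm (\<lambda>x y. R1 x y + R2 y x)"
    "sval \<tau>1 \<tau>2 R1" "sval \<tau>2 \<tau>1 R2" R1 R2 \<mu> y \<nu> x "\<lambda>k. best \<tau>1 (mv R1 (x k))" "\<lambda>k. - \<tau>2 * entropy (x k)"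
    "\<lambda>k. \<tau>1 * entropy (\<mu> k)" "\<lambda>k. \<tau>2 * entropy (\<nu> k)" "\<lambda>k. best \<tau>2 (mv R2 (y k))" "\<lambda>k. - \<tau>1 * entropy (y k)"
  proof
    show "(\<lambda>k. 2 * (E1 k + E2 k)) \<longlonglongrightarrow> 0" using tendsto_mult_left[OF tendsto_add[OF E1 E2], of 2] by simp
    show "1 \<le> C" using nn by (simp add: C_def)
    fix k l :: nat
    show "best \<tau>1 (mv R1 (x k)) - best \<tau>1 (mv R1 (x l)) \<le> bil (\<mu> k) R1 (x k) - bil (\<mu> k) R1 (x l) + 2 * (E1 k + E2 k)"
      using near_optimal(2)[OF \<mu>s[of k] opt1[of k] \<tau>(1), of R1 "x k" "x l"] E0[of k] by (simp add: E1_def)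
    show "best \<tau>1 (mv R1 (x k)) \<le> bil (\<mu> k) R1 (x k) + \<tau>1 * entropy (\<mu> k) + 2 * (E1 k + E2 k)"
      using near_optimal(1)[OF \<mu>s[of k] opt1[of k] \<tau>(1), of R1 "x k"] E0[of k] by (simp add: E1_def)
    show "best \<tau>2 (mv R2 (y k)) - best \<tau>2 (mv R2 (y l)) \<le> bil (\<nu> k) R2 (y k) - bil (\<nu> k) R2 (y l) + 2 * (E1 k + E2 k)"
      using near_optimal(2)[OF \<nu>s[of k] opt2[of k] \<tau>(2), of R2 "y k" "y l"] E0[of k] by (simp add: E2_def)
    show "best \<tau>2 (mv R2 (y k)) \<le> bil (\<nu> k) R2 (y k) + \<tau>2 * entropy (\<nu> k) + 2 * (E1 k + E2 k)"
      using near_optimal(1)[OF \<nu>s[of k] opt2[of k] \<tau>(2), of R2 "y k"] E0[of k] by (simp add: E2_def)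
    show "- \<tau>2 * entropy (x (Suc k)) \<le> - \<tau>2 * entropy (x k) - d * \<alpha>2 k * (- \<tau>2 * entropy (x k) + \<tau>2 * entropy (\<nu> k))"
      using neg_entropy_step[OF xs[of k] \<nu>s[of k], of "d * \<alpha>2 k" \<tau>2] d\<alpha>[of k] \<tau>(2) by (simp add: x_def)
    show "- \<tau>1 * entropy (y (Suc k)) \<le> - \<tau>1 * entropy (y k) - \<alpha>2 k * (- \<tau>1 * entropy (y k) + \<tau>1 * entropy (\<mu> k))"
      using neg_entropy_step[OF ys[of k] \<mu>s[of k], of "\<alpha>2 k" \<tau>1] \<alpha>2(1,2)[of k] \<tau>(1) by (simp add: y_def)
    show "\<bar>best \<tau>1 (mv R1 (x k))\<bar> \<le> C"
    proof -
      have "\<bar>best \<tau>1 (mv R1 (x k))\<bar> \<le> maxnorm R1 + \<tau>1 * CARD('a1)"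
        by (rule abs_best_le[OF _ \<tau>(1)]) (rule abs_mv_le[OF xs], rule abs_le_maxnorm)
      then show ?thesis using nn by (simp add: C_def)
    qed
    show "\<bar>best \<tau>2 (mv R2 (y k))\<bar> \<le> C"
    proof -
      have "\<bar>best \<tau>2 (mv R2 (y k))\<bar> \<le> maxnorm R2 + \<tau>2 * CARD('a2)"
        by (rule abs_best_le[OF _ \<tau>(2)]) (rule abs_mv_le[OF ys], rule abs_le_maxnorm)
      then show ?thesis using nn by (simp add: C_def)
    qed
    show "sval \<tau>1 \<tau>2 R1 \<le> best \<tau>1 (mv R1 (x k)) + - \<tau>2 * entropy (x k)" using sval_le[OF xs \<tau>] by simp
    show "sval \<tau>2 \<tau>1 R2 \<le> best \<tau>2 (mv R2 (y k)) + - \<tau>1 * entropy (y k)" using sval_le[OF ys \<tau>(2,1)] by simp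
    show "x (Suc k) z = x k z + d * \<alpha>2 k * (\<nu> k z - x k z)" for z by (simp add: x_def)
    show "y (Suc k) z = y k z + \<alpha>2 k * (\<mu> k z - y k z)" for z by (simp add: y_def)
    show "\<bar>- \<tau>2 * entropy (x k)\<bar> \<le> C" "\<bar>- \<tau>1 * entropy (y k)\<bar> \<le> C" using ent2[OF xs] ent1[OF ys] by simp_all
    show "\<bar>\<tau>1 * entropy (\<mu> k)\<bar> \<le> C" "\<bar>\<tau>2 * entropy (\<nu> k)\<bar> \<le> C" using ent1[OF \<mu>s] ent2[OF \<nu>s] by simp_all
  qed (rule nonneg \<alpha>2 d \<mu>s \<nu>s xs ys R1C R2C bil_add_transpose_le_maxnorm; assumption)+
  \<comment> \<open>The weighted sum on the learning path minus \<open>\<Lambda>\<close> on the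
    noise-free path. It vanishes by the Lipschitz bound for best payoffs and uniform continuity for
    entropies.\<close>
  define G where "G k = (best \<tau>1 (q1 k) - best \<tau>1 (mv R1 (x k))) - \<tau>2 * (entropy (\<pi>2 k) - entropy (x k))
    + d * ((best \<tau>2 (q2 k) - best \<tau>2 (mv R2 (y k))) - \<tau>1 * (entropy (\<pi>1 k) - entropy (y k)))" for k
  have "G \<longlonglongrightarrow> (0 - \<tau>2 * 0) + d * (0 - \<tau>1 * 0)"
  proof -
    have 1: "(\<lambda>k. best \<tau>1 (q1 k) - best \<tau>1 (mv R1 (x k))) \<longlonglongrightarrow> 0"
      by (rule best_diff_tendsto[OF \<tau>(1)]) (rule E1[unfolded E1_def])
    have 2: "(\<lambda>k. best \<tau>2 (q2 k) - best \<tau>2 (mv R2 (y k))) \<longlonglongrightarrow> 0"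
      by (rule best_diff_tendsto[OF \<tau>(2)]) (rule E2[unfolded E2_def])
    have 3: "(\<lambda>k. entropy (\<pi>2 k) - entropy (x k)) \<longlonglongrightarrow> 0"
      by (rule entropy_diff_tendsto[OF \<pi>(2) xs x_lim])
    have 4: "(\<lambda>k. entropy (\<pi>1 k) - entropy (y k)) \<longlonglongrightarrow> 0"
      by (rule entropy_diff_tendsto[OF \<pi>(1) ys y_lim])
    show ?thesis unfolding G_def
      by (rule tendsto_add[OF tendsto_diff[OF 1 tendsto_mult_left[OF 3]]
            tendsto_mult_left[OF tendsto_diff[OF 2 tendsto_mult_left[OF 4]]]])
  qed
  then have "\<forall>\<^sub>F k in sequentially. G k < \<delta> / 2" using \<delta> by (intro order_tendstoD(2)) auto
  moreover have "\<forall>\<^sub>F k in sequentially. \<Lambda> k \<le> maxnorm (\<lambda>x y. R1 x y + R2 y x) - sval \<tau>1 \<tau>2 R1 - sval \<tau>2 \<tau>1 R2 + \<delta> / 2"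
    using \<delta> by (intro \<Lambda>_eventually_le) auto
  ultimately show ?thesis
  proof eventually_elim
    case (elim k)
    have "delta \<tau>1 \<tau>2 R1 (\<mu> k) (q1 k) (\<pi>2 k) + d * delta \<tau>2 \<tau>1 R2 (\<nu> k) (q2 k) (\<pi>1 k) = \<Lambda> k + G k"
    proof -
      have "delta \<tau>1 \<tau>2 R1 (\<mu> k) (q1 k) (\<pi>2 k) = best \<tau>1 (q1 k) - \<tau>2 * entropy (\<pi>2 k) - sval \<tau>1 \<tau>2 R1"
        unfolding \<mu> by (rule delta_eq_best[OF ok(1) br(1)])
      moreover have "delta \<tau>2 \<tau>1 R2 (\<nu> k) (q2 k) (\<pi>1 k) = best \<tau>2 (q2 k) - \<tau>1 * entropy (\<pi>1 k) - sval \<tau>2 \<tau>1 R2"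
        unfolding \<nu> by (rule delta_eq_best[OF ok(2) br(2)])
      ultimately show ?thesis unfolding \<Lambda>_def G_def by (simp only:) (simp add: algebra_simps)
    qed
    then show ?case using elim by simp
  qed
qed

section \<open>Almost sure averaging of martingale differences\<close>

text \<open>Filtrations generated by finite histories, represented by the history process itself: a
  random variable is adapted at time \<open>k\<close> if it is a function of the history \<open>H k\<close>.\<close>

locale finite_history = prob_space M for M :: "'m measure" +
  fixes H :: "nat \<Rightarrow> 'm \<Rightarrow> 'h"
  assumes finite_range: "finite (H k ` space M)"
    and history_event: "{w \<in> space M. H k w = h} \<in> events"
    and refines: "w \<in> space M \<Longrightarrow> w' \<in> space M \<Longrightarrow> H (Suc k) w = H (Suc k) w' \<Longrightarrow> H k w = H k w'"
begin

definition adapted :: "nat \<Rightarrow> ('m \<Rightarrow> 'c) \<Rightarrow> bool" where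
  "adapted k X \<longleftrightarrow> (\<forall>w\<in>space M. \<forall>w'\<in>space M. H k w = H k w' \<longrightarrow> X w = X w')"

abbreviation atom :: "nat \<Rightarrow> 'h \<Rightarrow> 'm \<Rightarrow> real" where
  "atom k h \<equiv> indicator {w \<in> space M. H k w = h}"

lemma adapted_Suc: "adapted k X \<Longrightarrow> adapted (Suc k) X"
  unfolding adapted_def using refines by blast

lemma adapted_const: "adapted k (\<lambda>_. c)"
  by (simp add: adapted_def)

lemma adapted_comp: "adapted k X \<Longrightarrow> adapted k (\<lambda>w. f (X w))"
  unfolding adapted_def by (intro ballI impI arg_cong[where f = f]) blast

lemma adapted_comp2: "adapted k X \<Longrightarrow> adapted k Y \<Longrightarrow> adapted k (\<lambda>w. f (X w) (Y w))"
  unfolding adapted_def by (intro ballI impI arg_cong2[where f = f]) blast+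

text \<open>Finitely many histories make an adapted variable a finite combination of indicators of
  atoms, to which integrability and orthogonality are reduced.\<close>

lemma adapted_decompose:
  fixes X :: "'m \<Rightarrow> real"
  assumes "adapted k X"
  shows "\<exists>c. \<forall>w\<in>space M. X w = (\<Sum>h\<in>H k ` space M. c h * atom k h w)"
proof -
  define c where "c h = X (SOME w. w \<in> space M \<and> H k w = h)" for h
  have c: "X w = c (H k w)" if w: "w \<in> space M" for w
  proof -
    have "(SOME w'. w' \<in> space M \<and> H k w' = H k w) \<in> space M
        \<and> H k (SOME w'. w' \<in> space M \<and> H k w' = H k w) = H k w"
      by (rule someI[of _ w]) (use w in simp)
    then show ?thesis using assms w unfolding c_def adapted_def by metis
  qed
  have "X w = (\<Sum>h\<in>H k ` space M. c h * atom k h w)" if w: "w \<in> space M" for w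
  proof -
    have "(\<Sum>h\<in>H k ` space M. c h * atom k h w) = (\<Sum>h\<in>H k ` space M. if h = H k w then c h else 0)"
      using w by (intro sum.cong) (auto simp: indicator_def)
    then show ?thesis using w finite_range c by simp
  qed
  then show ?thesis by blast
qed

lemma integrable_atom: "integrable M (atom k h)"
  using history_event by (intro integrable_real_indicator) (auto simp: emeasure_eq_measure)

lemma adapted_integrable:
  fixes X :: "'m \<Rightarrow> real"
  assumes "adapted k X"
  shows "integrable M X"
proof -
  obtain c where "\<forall>w\<in>space M. X w = (\<Sum>h\<in>H k ` space M. c h * atom k h w)"
    using adapted_decompose[OF assms] by (rule exE)
  then have c: "\<And>w. w \<in> space M \<Longrightarrow> X w = (\<Sum>h\<in>H k ` space M. c h * atom k h w)" by (rule bspec)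
  have "integrable M (\<lambda>w. \<Sum>h\<in>H k ` space M. c h * atom k h w)"
    by (intro Bochner_Integration.integrable_sum integrable_mult_right integrable_atom)
  moreover have "integrable M X \<longleftrightarrow> integrable M (\<lambda>w. \<Sum>h\<in>H k ` space M. c h * atom k h w)"
    by (rule Bochner_Integration.integrable_cong[OF refl c])
  ultimately show ?thesis by (rule iffD2[rotated])
qed

lemma adapted_event:
  assumes "adapted k P"
  shows "{w \<in> space M. P w} \<in> events"
proof -
  have "{w \<in> space M. P w} = (\<Union>h\<in>H k ` {w \<in> space M. P w}. {w \<in> space M. H k w = h})"
    using assms by (auto simp: adapted_def)
  moreover have "finite (H k ` {w \<in> space M. P w})" by (rule finite_subset[OF _ finite_range[of k]]) auto
  ultimately show ?thesis using history_event by (metis (no_types, lifting) sets.finite_UN)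
qed

text \<open>\<open>zero\<close> states atom by atom that \<open>X\<close> has conditional mean zero
  given \<open>H k\<close>; orthogonality to adapted variables follows by linearity.\<close>

lemma expectation_adapted_mult_zero:
  fixes f X :: "'m \<Rightarrow> real"
  assumes f: "adapted k f" and X: "adapted (Suc k) X"
    and zero: "\<And>w0. w0 \<in> space M \<Longrightarrow> expectation (\<lambda>w. X w * atom k (H k w0) w) = 0"
  shows "expectation (\<lambda>w. f w * X w) = 0"
proof -
  obtain c where "\<forall>w\<in>space M. f w = (\<Sum>h\<in>H k ` space M. c h * atom k h w)"
    using adapted_decompose[OF f] by (rule exE)
  then have c: "\<And>w. w \<in> space M \<Longrightarrow> f w = (\<Sum>h\<in>H k ` space M. c h * atom k h w)" by (rule bspec)
  have int: "integrable M (\<lambda>w. X w * atom k h w)" for h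
  proof (rule adapted_integrable[where k = "Suc k"])
    have "adapted k (atom k h)" unfolding adapted_def by (intro ballI impI) (simp add: indicator_def)
    then show "adapted (Suc k) (\<lambda>w. X w * atom k h w)" by (rule adapted_comp2[OF X adapted_Suc])
  qed
  have "expectation (\<lambda>w. f w * X w) = expectation (\<lambda>w. \<Sum>h\<in>H k ` space M. c h * (X w * atom k h w))"
  proof (intro Bochner_Integration.integral_cong refl)
    fix w assume w: "w \<in> space M"
    show "f w * X w = (\<Sum>h\<in>H k ` space M. c h * (X w * atom k h w))"
      by (subst c[OF w]) (simp only: sum_distrib_right mult.assoc mult.commute[of "X w"])
  qed
  also have "\<dots> = (\<Sum>h\<in>H k ` space M. c h * expectation (\<lambda>w. X w * atom k h w))"
    using int by (simp add: Bochner_Integration.integral_sum)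
  also have "\<dots> = 0" using zero by (intro sum.neutral) auto
  finally show ?thesis .
qed

end

text \<open>Robbins--Monro averaging of martingale differences. With square summable steps,
  \<open>z\<^sup>2\<close> plus the tail of the squared steps is a supermartingale, whose expectation tends to
  zero; Doob's maximal inequality then gives almost sure convergence.\<close>

locale averaged_noise = finite_history M H for M :: "'m measure" and H :: "nat \<Rightarrow> 'm \<Rightarrow> 'h" +
  fixes z X :: "nat \<Rightarrow> 'm \<Rightarrow> real" and a :: "nat \<Rightarrow> real" and C :: real and K :: nat
  assumes a: "\<And>k. 0 \<le> a k" "\<And>k. a k \<le> 1" "a \<longlonglongrightarrow> 0" "\<not> summable a" "summable (\<lambda>k. (a k)\<^sup>2)"
    and z_adapted: "\<And>k. adapted k (z k)" and X_adapted: "\<And>k. adapted (Suc k) (X k)"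
    and z_Suc: "\<And>k w. w \<in> space M \<Longrightarrow> z (Suc k) w = (1 - a k) * z k w + a k * X k w"
    and X_bound: "\<And>k w. K \<le> k \<Longrightarrow> w \<in> space M \<Longrightarrow> \<bar>X k w\<bar> \<le> C"
    and X_mean: "\<And>k w0. K \<le> k \<Longrightarrow> w0 \<in> space M \<Longrightarrow> expectation (\<lambda>w. X k w * atom k (H k w0) w) = 0"
begin

definition tail :: "nat \<Rightarrow> real" where
  "tail k = (\<Sum>j. (a (j + k))\<^sup>2)"

definition W :: "nat \<Rightarrow> 'm \<Rightarrow> real" where
  "W k w = (z k w)\<^sup>2 + C\<^sup>2 * tail k"

lemma tail_Suc: "tail k = (a k)\<^sup>2 + tail (Suc k)"
proof -
  have "summable (\<lambda>j. (a (j + k))\<^sup>2)" using a(5) by (simp add: summable_iff_shift[of "\<lambda>k. (a k)\<^sup>2"])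
  from suminf_split_head[OF this] show ?thesis by (simp add: tail_def)
qed

lemma tail_nonneg: "0 \<le> tail k"
proof -
  have "summable (\<lambda>j. (a (j + k))\<^sup>2)" using a(5) by (simp add: summable_iff_shift[of "\<lambda>k. (a k)\<^sup>2"])
  then show ?thesis unfolding tail_def by (intro suminf_nonneg) auto
qed

lemma tail_tendsto: "tail \<longlonglongrightarrow> 0"
proof -
  have "tail k = (\<Sum>j. (a j)\<^sup>2) - (\<Sum>j<k. (a j)\<^sup>2)" for k
    unfolding tail_def using suminf_minus_initial_segment[OF a(5), of k] by simp
  then have "tail = (\<lambda>k. (\<Sum>j. (a j)\<^sup>2) - (\<Sum>j<k. (a j)\<^sup>2))" by auto
  moreover have "(\<lambda>k. (\<Sum>j. (a j)\<^sup>2) - (\<Sum>j<k. (a j)\<^sup>2)) \<longlonglongrightarrow> (\<Sum>j. (a j)\<^sup>2) - (\<Sum>j. (a j)\<^sup>2)"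
    by (intro tendsto_intros summable_LIMSEQ a(5))
  ultimately show ?thesis by simp
qed

lemma W_adapted: "adapted k (W k)"
  unfolding W_def by (rule adapted_comp[OF z_adapted])

lemma W_nonneg: "0 \<le> W k w"
  using tail_nonneg[of k] by (simp add: W_def)

text \<open>In the expanded square the mixed term is an adapted factor times \<open>X k\<close> and
  has mean zero. The weight \<open>f\<close> will be 1 for the moments and the indicator of no
  crossing so far for the maximal inequality.\<close>

lemma second_moment_step:
  assumes k: "K \<le> k" and f: "adapted k f" "\<And>w. 0 \<le> f w"
  shows "expectation (\<lambda>w. f w * (z (Suc k) w)\<^sup>2) \<le> expectation (\<lambda>w. f w * ((1 - a k)\<^sup>2 * (z k w)\<^sup>2 + C\<^sup>2 * (a k)\<^sup>2))"
proof -
  define g where "g w = 2 * (1 - a k) * a k * (f w * z k w)" for w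
  have g: "adapted k g" unfolding g_def
    by (rule adapted_comp) (rule adapted_comp2[OF f(1) z_adapted])
  have int1: "integrable M (\<lambda>w. f w * (z (Suc k) w)\<^sup>2)"
    by (rule adapted_integrable[where k = "Suc k"], rule adapted_comp2[OF adapted_Suc[OF f(1)] z_adapted])
  have int2: "integrable M (\<lambda>w. f w * ((1 - a k)\<^sup>2 * (z k w)\<^sup>2 + C\<^sup>2 * (a k)\<^sup>2))"
    by (rule adapted_integrable[where k = k], rule adapted_comp2[OF f(1) z_adapted])
  have int3: "integrable M (\<lambda>w. g w * X k w)"
    by (rule adapted_integrable[where k = "Suc k"], rule adapted_comp2[OF adapted_Suc[OF g] X_adapted])
  have "expectation (\<lambda>w. f w * (z (Suc k) w)\<^sup>2)
      \<le> expectation (\<lambda>w. f w * ((1 - a k)\<^sup>2 * (z k w)\<^sup>2 + C\<^sup>2 * (a k)\<^sup>2) + g w * X k w)"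
  proof (intro integral_mono int1 Bochner_Integration.integrable_add int2 int3)
    fix w assume w: "w \<in> space M"
    have "\<bar>X k w\<bar> \<le> \<bar>C\<bar>" using X_bound[OF k w] by simp
    then have X2: "(X k w)\<^sup>2 \<le> C\<^sup>2" by (simp add: abs_le_square_iff)
    have "(z (Suc k) w)\<^sup>2 = (1 - a k)\<^sup>2 * (z k w)\<^sup>2 + 2 * (1 - a k) * a k * (z k w * X k w) + (a k)\<^sup>2 * (X k w)\<^sup>2"
      unfolding z_Suc[OF w] by (simp add: power2_eq_square algebra_simps)
    also have "(a k)\<^sup>2 * (X k w)\<^sup>2 \<le> C\<^sup>2 * (a k)\<^sup>2" using mult_right_mono[OF X2, of "(a k)\<^sup>2"] by (simp add: mult.commute)
    finally have "f w * (z (Suc k) w)\<^sup>2 \<le> f w * ((1 - a k)\<^sup>2 * (z k w)\<^sup>2 + 2 * (1 - a k) * a k * (z k w * X k w) + C\<^sup>2 * (a k)\<^sup>2)"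
      using f(2) by (intro mult_left_mono) auto
    then show "f w * (z (Suc k) w)\<^sup>2 \<le> f w * ((1 - a k)\<^sup>2 * (z k w)\<^sup>2 + C\<^sup>2 * (a k)\<^sup>2) + g w * X k w"
      by (simp add: g_def algebra_simps)
  qed
  also have "\<dots> = expectation (\<lambda>w. f w * ((1 - a k)\<^sup>2 * (z k w)\<^sup>2 + C\<^sup>2 * (a k)\<^sup>2)) + expectation (\<lambda>w. g w * X k w)"
    by (rule Bochner_Integration.integral_add[OF int2 int3])
  also have "expectation (\<lambda>w. g w * X k w) = 0"
    by (rule expectation_adapted_mult_zero[OF g X_adapted]) (rule X_mean[OF k])
  finally show ?thesis by simp
qed

text \<open>Testing against nonnegative adapted weights expresses the conditional inequality. The
  drop of \<open>tail\<close> by \<open>(a k)\<^sup>2\<close> pays for the variance of the new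
  noise.\<close>

lemma W_supermartingale:
  assumes k: "K \<le> k" and f: "adapted k f" "\<And>w. 0 \<le> f w"
  shows "expectation (\<lambda>w. f w * W (Suc k) w) \<le> expectation (\<lambda>w. f w * W k w)"
proof -
  have fi: "integrable M f" by (rule adapted_integrable[OF f(1)])
  have int1: "integrable M (\<lambda>w. f w * (z (Suc k) w)\<^sup>2)"
    by (rule adapted_integrable[where k = "Suc k"], rule adapted_comp2[OF adapted_Suc[OF f(1)] z_adapted])
  have int2: "integrable M (\<lambda>w. f w * ((1 - a k)\<^sup>2 * (z k w)\<^sup>2 + C\<^sup>2 * (a k)\<^sup>2))"
    by (rule adapted_integrable[where k = k], rule adapted_comp2[OF f(1) z_adapted])
  have int3: "integrable M (\<lambda>w. f w * W k w)"
    by (rule adapted_integrable[where k = k], rule adapted_comp2[OF f(1) W_adapted])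
  have "expectation (\<lambda>w. f w * W (Suc k) w) = expectation (\<lambda>w. f w * (z (Suc k) w)\<^sup>2 + (C\<^sup>2 * tail (Suc k)) * f w)"
    by (simp add: W_def algebra_simps)
  also have "\<dots> = expectation (\<lambda>w. f w * (z (Suc k) w)\<^sup>2) + expectation (\<lambda>w. (C\<^sup>2 * tail (Suc k)) * f w)"
    using fi by (intro Bochner_Integration.integral_add int1) auto
  also have "\<dots> \<le> expectation (\<lambda>w. f w * ((1 - a k)\<^sup>2 * (z k w)\<^sup>2 + C\<^sup>2 * (a k)\<^sup>2)) + expectation (\<lambda>w. (C\<^sup>2 * tail (Suc k)) * f w)"
    using second_moment_step[OF k f] by simp
  also have "\<dots> = expectation (\<lambda>w. f w * ((1 - a k)\<^sup>2 * (z k w)\<^sup>2 + C\<^sup>2 * (a k)\<^sup>2) + (C\<^sup>2 * tail (Suc k)) * f w)"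
    using fi by (intro Bochner_Integration.integral_add[symmetric] int2) auto
  also have "\<dots> \<le> expectation (\<lambda>w. f w * W k w)"
  proof (intro integral_mono Bochner_Integration.integrable_add int2 int3)
    show "integrable M (\<lambda>w. (C\<^sup>2 * tail (Suc k)) * f w)" using fi by simp
    fix w
    have "(1 - a k)\<^sup>2 \<le> 1" using a(1,2)[of k] by (simp add: abs_square_le_1)
    then have "(1 - a k)\<^sup>2 * (z k w)\<^sup>2 \<le> 1 * (z k w)\<^sup>2" by (intro mult_right_mono) auto
    then have "(1 - a k)\<^sup>2 * (z k w)\<^sup>2 + C\<^sup>2 * (a k)\<^sup>2 + C\<^sup>2 * tail (Suc k) \<le> W k w"
      unfolding W_def tail_Suc[of k] by (simp add: distrib_left)
    then have "f w * ((1 - a k)\<^sup>2 * (z k w)\<^sup>2 + C\<^sup>2 * (a k)\<^sup>2 + C\<^sup>2 * tail (Suc k)) \<le> f w * W k w"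
      using f(2) by (rule mult_left_mono)
    then show "f w * ((1 - a k)\<^sup>2 * (z k w)\<^sup>2 + C\<^sup>2 * (a k)\<^sup>2) + (C\<^sup>2 * tail (Suc k)) * f w \<le> f w * W k w"
      by (simp add: algebra_simps)
  qed
  finally show ?thesis .
qed

text \<open>\<open>(1 - a k)\<^sup>2 \<le> 1 - a k\<close> puts the second moments into the form of
  \<open>recursion_tendsto_zero\<close> with forcing \<open>C\<^sup>2 * a k\<close>. The index is
  shifted by \<open>K\<close>, from where the noise is bounded and centred.\<close>

lemma expectation_W_tendsto: "(\<lambda>k. expectation (W k)) \<longlonglongrightarrow> 0"
proof -
  have z2: "integrable M (\<lambda>w. (z k w)\<^sup>2)" for k
    by (rule adapted_integrable[where k = k]) (rule adapted_comp[OF z_adapted])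
  have "(\<lambda>i. expectation (\<lambda>w. (z (i + K) w)\<^sup>2)) \<longlonglongrightarrow> 0"
  proof (rule recursion_tendsto_zero[where a = "\<lambda>i. a (i + K)" and e = "\<lambda>i. C\<^sup>2 * a (i + K)"])
    show "\<not> summable (\<lambda>i. a (i + K))" using a(4) by (simp add: summable_iff_shift)
    show "(\<lambda>i. C\<^sup>2 * a (i + K)) \<longlonglongrightarrow> 0"
      using tendsto_mult_left[OF LIMSEQ_ignore_initial_segment[OF a(3), of K], of "C\<^sup>2"] by simp
    fix i
    let ?k = "i + K"
    have "expectation (\<lambda>w. (z (Suc ?k) w)\<^sup>2) \<le> expectation (\<lambda>w. (1 - a ?k)\<^sup>2 * (z ?k w)\<^sup>2 + C\<^sup>2 * (a ?k)\<^sup>2)"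
      using second_moment_step[OF _ adapted_const, of ?k 1] by simp
    also have "\<dots> = (1 - a ?k)\<^sup>2 * expectation (\<lambda>w. (z ?k w)\<^sup>2) + C\<^sup>2 * (a ?k)\<^sup>2"
      using z2[of ?k] by (simp add: prob_space)
    also have "\<dots> \<le> (1 - a ?k) * expectation (\<lambda>w. (z ?k w)\<^sup>2) + C\<^sup>2 * (a ?k)\<^sup>2"
    proof -
      have "(1 - a ?k)\<^sup>2 \<le> 1 - a ?k"
        using a(1,2)[of ?k] mult_left_le[of "1 - a ?k" "1 - a ?k"] by (simp add: power2_eq_square)
      then show ?thesis by (intro add_right_mono mult_right_mono) auto
    qed
    finally show "expectation (\<lambda>w. (z (Suc i + K) w)\<^sup>2) \<le> (1 - a ?k) * expectation (\<lambda>w. (z ?k w)\<^sup>2) + a ?k * (C\<^sup>2 * a ?k)"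
      by (simp add: power2_eq_square algebra_simps)
  qed (use a in auto)
  then have "(\<lambda>k. expectation (\<lambda>w. (z k w)\<^sup>2)) \<longlonglongrightarrow> 0" by (rule LIMSEQ_offset)
  then have "(\<lambda>k. expectation (\<lambda>w. (z k w)\<^sup>2) + C\<^sup>2 * tail k) \<longlonglongrightarrow> 0 + C\<^sup>2 * 0"
    by (intro tendsto_intros tail_tendsto)
  moreover have "expectation (W k) = expectation (\<lambda>w. (z k w)\<^sup>2) + C\<^sup>2 * tail k" for k
    unfolding W_def using z2[of k] by (simp add: prob_space)
  ultimately show ?thesis by simp
qed

lemma maximal_inequality:
  assumes n: "K \<le> n" "n \<le> m" and \<epsilon>: "0 < \<epsilon>"
  shows "\<epsilon> * prob {w \<in> space M. \<exists>j\<in>{n..m}. \<epsilon> \<le> W j w} \<le> expectation (W n)"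
proof -
  define good where "good m w \<longleftrightarrow> (\<forall>j\<in>{n..m}. W j w < \<epsilon>)" for m w
  have good_adapted: "adapted m (good m)" if "n \<le> m" for m
    using that
  proof (induction m rule: dec_induct)
    case base
    have "adapted n (\<lambda>w. W n w < \<epsilon>)" by (rule adapted_comp[OF W_adapted])
    then show ?case by (simp add: good_def)
  next
    case (step m)
    have "adapted (Suc m) (\<lambda>w. good m w \<and> W (Suc m) w < \<epsilon>)"
      by (rule adapted_comp2[OF adapted_Suc[OF step.IH] W_adapted])
    moreover have "good (Suc m) = (\<lambda>w. good m w \<and> W (Suc m) w < \<epsilon>)"
      by (rule ext) (use step(1) in \<open>auto simp: good_def le_Suc_eq\<close>)
    ultimately show ?case by simp
  qed
  have int: "integrable M (\<lambda>w. of_bool (good m w) * W k w)" "integrable M (\<lambda>w. of_bool (\<not> good m w) :: real)"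
    if "n \<le> m" "m \<le> k" "k \<le> Suc m" for m k
  proof -
    have "k = m \<or> k = Suc m" using that by auto
    then have gm: "adapted k (good m)" using good_adapted[OF that(1)] adapted_Suc[OF good_adapted[OF that(1)]] by auto
    show "integrable M (\<lambda>w. of_bool (good m w) * W k w)"
      by (rule adapted_integrable[OF adapted_comp2[OF gm W_adapted]])
    show "integrable M (\<lambda>w. of_bool (\<not> good m w) :: real)"
      by (rule adapted_integrable[OF adapted_comp[OF good_adapted[OF that(1)]]])
  qed
  \<comment> \<open>The stopped process: \<open>W\<close> is kept while below
    \<open>\<epsilon>\<close> and replaced by the constant \<open>\<epsilon>\<close> from the first
    crossing on, which does not raise it. Its mean is nonincreasing.\<close>
  have main: "expectation (\<lambda>w. of_bool (good m w) * W m w) + \<epsilon> * expectation (\<lambda>w. of_bool (\<not> good m w)) \<le> expectation (W n)"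
    if "n \<le> m" for m
    using that
  proof (induction m rule: dec_induct)
    case base
    have "expectation (\<lambda>w. of_bool (good n w) * W n w) + \<epsilon> * expectation (\<lambda>w. of_bool (\<not> good n w))
       = expectation (\<lambda>w. of_bool (good n w) * W n w + \<epsilon> * of_bool (\<not> good n w))"
      using int[of n n] by simp
    also have "\<dots> \<le> expectation (W n)"
    proof (rule integral_mono)
      show "integrable M (W n)" by (rule adapted_integrable[OF W_adapted])
    qed (use int[of n n] in \<open>auto simp: good_def\<close>)
    finally show ?case .
  next
    case (step m)
    have "expectation (\<lambda>w. of_bool (good (Suc m) w) * W (Suc m) w) + \<epsilon> * expectation (\<lambda>w. of_bool (\<not> good (Suc m) w))
       = expectation (\<lambda>w. of_bool (good (Suc m) w) * W (Suc m) w + \<epsilon> * of_bool (\<not> good (Suc m) w))"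
      using int[of "Suc m" "Suc m"] step(1) by simp
    also have "\<dots> \<le> expectation (\<lambda>w. of_bool (good m w) * W (Suc m) w + \<epsilon> * of_bool (\<not> good m w))"
    proof (rule integral_mono)
      show "integrable M (\<lambda>w. of_bool (good (Suc m) w) * W (Suc m) w + \<epsilon> * of_bool (\<not> good (Suc m) w))"
        using int[of "Suc m" "Suc m"] step(1) by auto
      show "integrable M (\<lambda>w. of_bool (good m w) * W (Suc m) w + \<epsilon> * of_bool (\<not> good m w))"
        using int[of m "Suc m"] step(1) by auto
      fix w
      show "of_bool (good (Suc m) w) * W (Suc m) w + \<epsilon> * of_bool (\<not> good (Suc m) w)
         \<le> of_bool (good m w) * W (Suc m) w + \<epsilon> * of_bool (\<not> good m w)"
        using step(1) by (auto simp: good_def le_Suc_eq not_less)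
    qed
    also have "\<dots> = expectation (\<lambda>w. of_bool (good m w) * W (Suc m) w) + \<epsilon> * expectation (\<lambda>w. of_bool (\<not> good m w))"
      using int[of m "Suc m"] step(1) by simp
    also have "expectation (\<lambda>w. of_bool (good m w) * W (Suc m) w) \<le> expectation (\<lambda>w. of_bool (good m w) * W m w)"
    proof (rule W_supermartingale)
      show "K \<le> m" using n(1) step(1) by simp
      show "adapted m (\<lambda>w. of_bool (good m w) :: real)" by (rule adapted_comp[OF good_adapted[OF step(1)]])
    qed simp
    finally show ?case using step.IH by simp
  qed
  have "{w \<in> space M. \<exists>j\<in>{n..m}. \<epsilon> \<le> W j w} = {w \<in> space M. \<not> good m w}"
    by (auto simp: good_def not_less)
  moreover have "expectation (\<lambda>w. of_bool (\<not> good m w)) = prob {w \<in> space M. \<not> good m w}"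
  proof -
    have "expectation (\<lambda>w. of_bool (\<not> good m w)) = expectation (indicator {w \<in> space M. \<not> good m w})"
      by (intro Bochner_Integration.integral_cong) (auto simp: indicator_def)
    also have "\<dots> = prob ({w \<in> space M. \<not> good m w} \<inter> space M)"
      by (rule Bochner_Integration.integral_indicator)
    also have "{w \<in> space M. \<not> good m w} \<inter> space M = {w \<in> space M. \<not> good m w}" by blast
    finally show ?thesis .
  qed
  moreover have "0 \<le> expectation (\<lambda>w. of_bool (good m w) * W m w)"
    using W_nonneg by (intro integral_nonneg_AE) auto
  ultimately show ?thesis using main[OF n(2)] by simp
qed

lemma z_tendsto: "AE w in M. (\<lambda>k. z k w) \<longlonglongrightarrow> 0"
proof -
  have ev: "{w \<in> space M. \<epsilon> \<le> W j w} \<in> events" for \<epsilon> j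
    by (rule adapted_event[OF adapted_comp[OF W_adapted]])
  have small: "AE w in M. \<exists>n. \<forall>j\<ge>n. W j w < \<epsilon>" if \<epsilon>: "0 < \<epsilon>" for \<epsilon>
  proof -
    \<comment> \<open>A crossing between \<open>n\<close> and \<open>n + m\<close>. As
      \<open>m\<close> grows, a crossing after \<open>n\<close> has probability at most
      \<open>expectation (W n) / \<epsilon>\<close>, which tends to zero in
      \<open>n\<close>.\<close>
    define B where "B n m = {w \<in> space M. \<exists>j\<in>{n..n + m}. \<epsilon> \<le> W j w}" for n m
    have B: "B n m \<in> events" for n m
    proof -
      have "B n m = (\<Union>j\<in>{n..n + m}. {w \<in> space M. \<epsilon> \<le> W j w})" by (auto simp: B_def)
      then show ?thesis using ev by auto
    qed
    have BU: "prob (\<Union>m. B n m) \<le> expectation (W n) / \<epsilon>" if "K \<le> n" for n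
    proof (rule LIMSEQ_le_const2)
      show "(\<lambda>m. prob (B n m)) \<longlonglongrightarrow> prob (\<Union>m. B n m)"
        by (intro finite_Lim_measure_incseq) (use B in \<open>auto simp: incseq_def B_def\<close>)
      show "\<exists>N. \<forall>m\<ge>N. prob (B n m) \<le> expectation (W n) / \<epsilon>"
        using maximal_inequality[OF that, of _ \<epsilon>] \<epsilon> by (auto simp: B_def field_simps)
    qed
    define Z where "Z = (\<Inter>n. \<Union>m. B n m)"
    have Z: "Z \<in> events" unfolding Z_def using B by (intro sets.countable_INT) auto
    have "prob Z \<le> 0"
    proof (rule LIMSEQ_le_const)
      show "(\<lambda>n. expectation (W n) / \<epsilon>) \<longlonglongrightarrow> 0"
        using tendsto_divide[OF expectation_W_tendsto tendsto_const, of \<epsilon>] \<epsilon> by simp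
      have "prob Z \<le> expectation (W n) / \<epsilon>" if "K \<le> n" for n
      proof -
        have "prob Z \<le> prob (\<Union>m. B n m)" unfolding Z_def using B by (intro finite_measure_mono) auto
        then show ?thesis using BU[OF that] by linarith
      qed
      then show "\<exists>N. \<forall>n\<ge>N. prob Z \<le> expectation (W n) / \<epsilon>" by blast
    qed
    then have "prob Z = 0" by (simp add: measure_le_0_iff)
    then have "Z \<in> null_sets M" using Z by (intro null_setsI) (auto simp: emeasure_eq_measure)
    then show ?thesis
    proof (rule AE_I'[of Z])
      show "{w \<in> space M. \<not> (\<exists>n. \<forall>j\<ge>n. W j w < \<epsilon>)} \<subseteq> Z"
      proof
        fix w assume w: "w \<in> {w \<in> space M. \<not> (\<exists>n. \<forall>j\<ge>n. W j w < \<epsilon>)}"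
        show "w \<in> Z"
        proof (unfold Z_def, rule INT_I)
          fix n
          obtain j where "n \<le> j" "\<epsilon> \<le> W j w" using w by (auto simp: not_less)
          then have "w \<in> B n (j - n)" using w by (auto simp: B_def)
          then show "w \<in> (\<Union>m. B n m)" by blast
        qed
      qed
    qed
  qed
  \<comment> \<open>Countably many thresholds suffice; the square matches
    \<open>(z k w)\<^sup>2 \<le> W k w\<close>.\<close>
  have "AE w in M. \<forall>i. \<exists>n. \<forall>j\<ge>n. W j w < (1 / Suc i)\<^sup>2"
    unfolding AE_all_countable by (intro allI small) simp
  then show ?thesis
  proof eventually_elim
    case (elim w)
    show ?case
    proof (rule LIMSEQ_I)
      fix r :: real assume "0 < r"
      then obtain i where i: "1 / Suc i < r" using nat_approx_posE by blast
      obtain n where n: "\<And>j. n \<le> j \<Longrightarrow> W j w < (1 / Suc i)\<^sup>2" using elim by blast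
      have "\<bar>z j w\<bar> < r" if "n \<le> j" for j
      proof -
        have "0 \<le> C\<^sup>2 * tail j" using tail_nonneg by simp
        then have "(z j w)\<^sup>2 < (1 / Suc i)\<^sup>2" using n[OF that] unfolding W_def by linarith
        then have "\<bar>z j w\<bar> < 1 / Suc i" using power2_less_imp_less[of "\<bar>z j w\<bar>" "1 / Suc i"] by simp
        then show ?thesis using i by linarith
      qed
      then show "\<exists>n. \<forall>j\<ge>n. norm (z j w - 0) < r" by auto
    qed
  qed
qed

end

section \<open>Learning agents\<close>

context finite_history
begin

text \<open>There are finitely many pairs of a past history and a value, and each excluded pair is
  null. This shows that an agent with \<open>\<theta> = 1\<close> almost surely has access at every
  stage.\<close>

lemma AE_of_null_transitions:
  fixes Y :: "'m \<Rightarrow> 't::finite"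
  assumes Y: "adapted (Suc k) Y"
    and null: "\<And>w0 t. w0 \<in> space M \<Longrightarrow> Q t \<Longrightarrow> prob {w \<in> space M. H k w = H k w0 \<and> Y w = t} = 0"
  shows "AE w in M. \<not> Q (Y w)"
proof -
  have event: "{w \<in> space M. H k w = h \<and> Y w = t} \<in> events" for h t
  proof (rule adapted_event)
    show "adapted (Suc k) (\<lambda>w. H k w = h \<and> Y w = t)"
      unfolding adapted_def
    proof (intro ballI impI)
      fix w w' assume w: "w \<in> space M" "w' \<in> space M" "H (Suc k) w = H (Suc k) w'"
      then show "(H k w = h \<and> Y w = t) = (H k w' = h \<and> Y w' = t)"
        using refines[OF w] Y[unfolded adapted_def, THEN bspec, THEN bspec, THEN mp, OF w] by simp
    qed
  qed
  have "(\<Union>h\<in>H k ` space M. \<Union>t\<in>{t. Q t}. {w \<in> space M. H k w = h \<and> Y w = t}) \<in> null_sets M"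
  proof (intro null_sets.finite_UN finite_range finite)
    fix h t assume "h \<in> H k ` space M" "t \<in> {t. Q t}"
    then have "prob {w \<in> space M. H k w = h \<and> Y w = t} = 0" using null by auto
    then show "{w \<in> space M. H k w = h \<and> Y w = t} \<in> null_sets M"
      using event by (intro null_setsI) (auto simp: emeasure_eq_measure)
  qed
  then show ?thesis by (rule AE_I') auto
qed

end

text \<open>The environment of a player collects the own access bit, the opponent's access bit and the
  opponent's action. Given the history, the own action has law \<open>P\<close> and is independent of it.\<close>

locale own_play = finite_history M H for M :: "'m measure" and H :: "nat \<Rightarrow> 'm \<Rightarrow> 'h" +
  fixes env :: "nat \<Rightarrow> 'm \<Rightarrow> bool \<times> bool \<times> 'b::finite" and act :: "nat \<Rightarrow> 'm \<Rightarrow> 'a::finite"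
    and P :: "nat \<Rightarrow> 'm \<Rightarrow> 'a \<Rightarrow> real"
  assumes env_adapted: "adapted (Suc k) (env k)" and act_adapted: "adapted (Suc k) (act k)"
    and law: "w0 \<in> space M \<Longrightarrow> \<exists>c. \<forall>e x.
      prob {w \<in> space M. H k w = H k w0 \<and> env k w = e \<and> act k w = x} = c e * P k w0 x"
begin

lemma refines_all:
  assumes w: "w \<in> space M" "w' \<in> space M" "H (Suc k) w = H (Suc k) w'"
  shows "H k w = H k w'" "env k w = env k w'" "act k w = act k w'"
  using refines[OF w] env_adapted[unfolded adapted_def, THEN bspec, THEN bspec, THEN mp, OF w]
    act_adapted[unfolded adapted_def, THEN bspec, THEN bspec, THEN mp, OF w] by auto

text \<open>By conditional independence it suffices that \<open>G\<close> is centred in the own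
  action for each fixed environment; the opponent's action, though random, is treated as
  given.\<close>

lemma mean_zero:
  assumes w0: "w0 \<in> space M"
    and G: "\<And>w. w \<in> space M \<Longrightarrow> H k w = H k w0 \<Longrightarrow> X w = G (env k w) (act k w)"
    and zero: "\<And>e. (\<Sum>x\<in>UNIV. P k w0 x * G e x) = 0"
  shows "expectation (\<lambda>w. X w * atom k (H k w0) w) = 0"
proof -
  define S where "S e x = {w \<in> space M. H k w = H k w0 \<and> env k w = e \<and> act k w = x}" for e x
  have S: "S e x \<in> events" for e x
    unfolding S_def
  proof (rule adapted_event)
    show "adapted (Suc k) (\<lambda>w. H k w = H k w0 \<and> env k w = e \<and> act k w = x)"
      unfolding adapted_def
    proof (intro ballI impI)
      fix w w' assume w: "w \<in> space M" "w' \<in> space M" "H (Suc k) w = H (Suc k) w'"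
      show "(H k w = H k w0 \<and> env k w = e \<and> act k w = x) = (H k w' = H k w0 \<and> env k w' = e \<and> act k w' = x)"
        unfolding refines_all[OF w] ..
    qed
  qed
  obtain c where c: "\<forall>e x. prob (S e x) = c e * P k w0 x" using law[OF w0] unfolding S_def by (rule exE)
  have "expectation (\<lambda>w. X w * atom k (H k w0) w)
      = expectation (\<lambda>w. \<Sum>e\<in>UNIV. \<Sum>x\<in>UNIV. G e x * indicator (S e x) w)"
  proof (intro Bochner_Integration.integral_cong refl)
    fix w assume w: "w \<in> space M"
    show "X w * atom k (H k w0) w = (\<Sum>e\<in>UNIV. \<Sum>x\<in>UNIV. G e x * indicator (S e x) w)"
    proof (cases "H k w = H k w0")
      case True
      have "(\<Sum>e\<in>UNIV. \<Sum>x\<in>UNIV. G e x * indicator (S e x) w)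
          = (\<Sum>e\<in>UNIV. \<Sum>x\<in>UNIV. if x = act k w then (if e = env k w then G e x else 0) else 0)"
        using w True by (intro sum.cong refl) (auto simp: S_def indicator_def)
      then show ?thesis using w True G[OF w True] by (simp add: indicator_def)
    next
      case False
      then show ?thesis by (simp add: S_def indicator_def)
    qed
  qed
  also have "\<dots> = (\<Sum>e\<in>UNIV. \<Sum>x\<in>UNIV. G e x * prob (S e x))"
  proof -
    have int: "integrable M (\<lambda>w. G e x * indicator (S e x) w)" for e x
      using S by (intro integrable_mult_right integrable_real_indicator) (auto simp: emeasure_eq_measure)
    have val: "expectation (\<lambda>w. G e x * indicator (S e x) w) = G e x * prob (S e x)" for e x
      using sets.Int_space_eq2[OF S] by simp
    have "expectation (\<lambda>w. \<Sum>e\<in>UNIV. \<Sum>x\<in>UNIV. G e x * indicator (S e x) w)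
        = (\<Sum>e\<in>UNIV. expectation (\<lambda>w. \<Sum>x\<in>UNIV. G e x * indicator (S e x) w))"
      by (rule Bochner_Integration.integral_sum) (rule Bochner_Integration.integrable_sum, rule int)
    also have "\<dots> = (\<Sum>e\<in>UNIV. \<Sum>x\<in>UNIV. expectation (\<lambda>w. G e x * indicator (S e x) w))"
      by (intro sum.cong refl Bochner_Integration.integral_sum int)
    finally show ?thesis by (simp only: val)
  qed
  also have "\<dots> = (\<Sum>e\<in>UNIV. c e * (\<Sum>x\<in>UNIV. P k w0 x * G e x))"
    unfolding c[THEN spec, THEN spec] sum_distrib_left by (intro sum.cong refl) simp
  also have "\<dots> = 0" using zero by simp
  finally show ?thesis .
qed

end

section \<open>Bounds on the estimates, informed and smoothed learners\<close>

lemma empseq_simplex: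
  assumes "\<pi>0 \<in> prob_simplex" "\<And>k. 0 \<le> \<alpha> k" "\<And>k. \<alpha> k \<le> 1"
  shows "empseq \<alpha> \<pi>0 a k \<in> prob_simplex"
  unfolding empseq_eq_average using assms by (intro average_simplex) auto

lemma mv_empseq_Suc:
  "mv R (empseq \<alpha> \<pi>0 b (Suc k)) a = (1 - \<alpha> k) * mv R (empseq \<alpha> \<pi>0 b k) a + \<alpha> k * R a (b k)"
proof -
  have "mv R (empseq \<alpha> \<pi>0 b (Suc k)) a
    = (\<Sum>y\<in>UNIV. (1 - \<alpha> k) * (R a y * empseq \<alpha> \<pi>0 b k y) + \<alpha> k * (vertex (b k) y * R a y))"
    by (simp add: mv_def algebra_simps)
  then show ?thesis by (simp add: sum.distrib sum_distrib_left[symmetric] mv_def)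
qed

text \<open>The estimate and \<open>mv R\<close> of the opponent's average obey the same recursion
  with the same steps and inputs, so their gap shrinks by \<open>1 - \<alpha> k\<close> without
  noise. This is why the opponent's average carries the agent's own steps.\<close>

lemma informed_estimate_tendsto:
  assumes acc: "\<And>k. acc k" and kn: kn
    and \<alpha>: "\<And>k. 0 \<le> \<alpha> k" "\<And>k. \<alpha> k \<le> 1" "\<not> summable \<alpha>"
  shows "(\<lambda>k. qseq \<alpha> R \<tau> kn q0 acc x b k a - mv R (empseq \<alpha> \<pi>0 b k) a) \<longlonglongrightarrow> 0"
proof -
  let ?z = "\<lambda>k. qseq \<alpha> R \<tau> kn q0 acc x b k a - mv R (empseq \<alpha> \<pi>0 b k) a"
  have "?z (Suc k) = (1 - \<alpha> k) * ?z k" for k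
    unfolding mv_empseq_Suc using acc kn by (simp add: q_update_def algebra_simps)
  then have contract: "\<bar>?z (Suc k)\<bar> = (1 - \<alpha> k) * \<bar>?z k\<bar>" for k
    using \<alpha>(2)[of k] by (simp only: abs_mult)
  have "(\<lambda>k. \<bar>?z k\<bar>) \<longlonglongrightarrow> 0"
  proof (rule recursion_tendsto_zero[where a = \<alpha> and e = "\<lambda>_. 0"])
    show "\<bar>?z (Suc k)\<bar> \<le> (1 - \<alpha> k) * \<bar>?z k\<bar> + \<alpha> k * 0" for k unfolding contract by simp
  qed (rule \<alpha> abs_ge_zero tendsto_const)+
  then show ?thesis by (simp only: tendsto_rabs_zero_iff)
qed

text \<open>The cap \<open>min 1\<close> makes each update a convex combination of the old entry and
  a payoff, also while the steps are still large.\<close>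

lemma qseq_bound:
  assumes \<alpha>: "\<And>k. 0 \<le> \<alpha> k" "\<And>k. \<alpha> k \<le> 1" and q0: "\<And>a. \<bar>q0 a\<bar> \<le> Q" and R: "\<And>a b. \<bar>R a b\<bar> \<le> Q"
  shows "\<bar>qseq \<alpha> R \<tau> kn q0 acc x b k a\<bar> \<le> Q"
proof (induction k arbitrary: a)
  case 0 then show ?case using q0 by simp
next
  case (Suc k)
  have convex: "\<bar>u + c * (v - u)\<bar> \<le> Q" if "\<bar>u\<bar> \<le> Q" "\<bar>v\<bar> \<le> Q" "0 \<le> c" "c \<le> 1" for u v c :: real
  proof -
    have "u + c * (v - u) = (1 - c) * u + c * v" by (simp add: algebra_simps)
    also have "\<bar>\<dots>\<bar> \<le> (1 - c) * \<bar>u\<bar> + c * \<bar>v\<bar>"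
      using that by (intro order_trans[OF abs_triangle_ineq]) (simp add: abs_mult)
    also have "\<dots> \<le> (1 - c) * Q + c * Q" using that by (intro add_mono mult_left_mono) auto
    also have "\<dots> = Q" by (simp add: algebra_simps)
    finally show ?thesis .
  qed
  have "0 \<le> \<alpha> k / sbr \<tau> q' a'" for q' and a' :: 'a using \<alpha>(1)[of k] sbr_pos[of \<tau> q' a'] by simp
  then have c: "0 \<le> (if a = x k then min 1 (\<alpha> k / sbr \<tau> q' a) else 0)"
    "(if a = x k then min 1 (\<alpha> k / sbr \<tau> q' a) else 0) \<le> 1" for q' by auto
  show ?case
  proof (cases "kn \<and> acc k")
    case True
    show ?thesis unfolding qseq.simps q_update_def if_P[OF True] by (rule convex[OF Suc R \<alpha>])
  next
    case False
    show ?thesis unfolding qseq.simps q_update_def if_not_P[OF False] by (rule convex[OF Suc R c])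
  qed
qed

text \<open>Bounded estimates keep all action probabilities away from zero: importance weights are
  bounded, and once the steps fall below this bound the cap in \<open>q_update\<close> is
  inactive.\<close>

lemma sbr_lower_bound:
  fixes q :: "'a::finite \<Rightarrow> real"
  assumes \<tau>: "0 < \<tau>" and q: "\<And>a. \<bar>q a\<bar> \<le> Q"
  shows "exp (- Q / \<tau>) / (CARD('a) * exp (Q / \<tau>)) \<le> sbr \<tau> q a"
  unfolding sbr_def
proof (rule frac_le)
  show "exp (- Q / \<tau>) \<le> exp (q a / \<tau>)" using q[of a] \<tau> divide_right_mono[of "- Q" "q a" \<tau>] by (simp add: abs_le_iff)
  have "(\<Sum>a'\<in>UNIV. exp (q a' / \<tau>)) \<le> (\<Sum>a'\<in>(UNIV::'a set). exp (Q / \<tau>))"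
    using q \<tau> by (intro sum_mono) (auto simp: abs_le_iff divide_right_mono)
  then show "(\<Sum>a'\<in>UNIV. exp (q a' / \<tau>)) \<le> CARD('a) * exp (Q / \<tau>)" by simp
qed (auto intro!: sum_pos)

text \<open>Covers the smoothed type, where \<open>\<tau> > 0\<close> bounds the importance weights.
  The best-response type obeys a noise-free recursion and is treated in
  \<open>agent_converges\<close>.\<close>

locale learner = own_play M H env act P
  for M :: "'m measure" and H :: "nat \<Rightarrow> 'm \<Rightarrow> 'h" and env :: "nat \<Rightarrow> 'm \<Rightarrow> bool \<times> bool \<times> 'b::finite"
    and act :: "nat \<Rightarrow> 'm \<Rightarrow> 'a::finite" and P +
  fixes \<alpha> :: "nat \<Rightarrow> real" and R :: "'a \<Rightarrow> 'b \<Rightarrow> real" and \<tau> :: real and kn :: bool and q0 :: "'a \<Rightarrow> real"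
    and q :: "nat \<Rightarrow> 'm \<Rightarrow> 'a \<Rightarrow> real"
  assumes \<tau>: "0 < \<tau>" and step: "step_ok False \<alpha>"
    and q_def: "q k w = qseq \<alpha> R \<tau> kn q0 (\<lambda>t. fst (env t w)) (\<lambda>t. act t w) (\<lambda>t. snd (snd (env t w))) k"
    and P_def: "P k w = sbr \<tau> (q k w)"
begin

lemma steps: "0 < \<alpha> k" "\<alpha> k \<le> 1" "0 \<le> \<alpha> k" "\<alpha> \<longlonglongrightarrow> 0" "\<not> summable \<alpha>" "summable (\<lambda>k. (\<alpha> k)\<^sup>2)"
  using step by (auto simp: step_ok_def less_imp_le)

lemma q_Suc: "q (Suc k) w = q_update (\<alpha> k) R \<tau> kn (q k w) (fst (env k w)) (act k w) (snd (snd (env k w)))"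
  by (simp add: q_def)

lemma q_adapted: "adapted k (q k)"
proof (induction k)
  case 0 then show ?case by (simp add: adapted_def q_def)
next
  case (Suc k)
  show ?case unfolding adapted_def
  proof (intro ballI impI)
    fix w w' assume w: "w \<in> space M" "w' \<in> space M" "H (Suc k) w = H (Suc k) w'"
    note r = refines_all[OF w]
    have "q k w = q k w'" by (rule Suc[unfolded adapted_def, THEN bspec, THEN bspec, THEN mp, OF w(1,2) r(1)])
    then show "q (Suc k) w = q (Suc k) w'" unfolding q_Suc r(2,3) by simp
  qed
qed

lemma average_adapted:
  assumes "\<And>k. adapted (Suc k) (u k)"
  shows "adapted k (\<lambda>w. average \<beta> \<pi>0 (\<lambda>k. u k w) k)"
proof (induction k)
  case 0 then show ?case by (simp add: adapted_def)
next
  case (Suc k)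
  show ?case unfolding average.simps
    by (rule adapted_comp2[OF adapted_Suc[OF Suc] assms])
qed

text \<open>A played vertex minus the softmax it is drawn from has conditional mean zero, and the
  gap of the two averages is the Robbins--Monro average of this noise.\<close>

theorem empirical_average_tendsto:
  assumes \<beta>: "step_ok False \<beta>"
  shows "AE w in M. \<forall>z. (\<lambda>k. empseq \<beta> \<pi>0 (\<lambda>t. act t w) k z - average \<beta> \<pi>0 (\<lambda>k. sbr \<tau> (q k w)) k z) \<longlonglongrightarrow> 0"
proof -
  have "AE w in M. (\<lambda>k. empseq \<beta> \<pi>0 (\<lambda>t. act t w) k z - average \<beta> \<pi>0 (\<lambda>k. sbr \<tau> (q k w)) k z) \<longlonglongrightarrow> 0" for z
  proof -
    have ve: "adapted (Suc k) (\<lambda>w. vertex (act k w))" for k by (rule adapted_comp[OF act_adapted])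
    have sb: "adapted (Suc k) (\<lambda>w. sbr \<tau> (q k w))" for k by (rule adapted_comp[OF adapted_Suc[OF q_adapted]])
    interpret averaged_noise M H
      "\<lambda>k w. average \<beta> \<pi>0 (\<lambda>k. vertex (act k w)) k z - average \<beta> \<pi>0 (\<lambda>k. sbr \<tau> (q k w)) k z"
      "\<lambda>k w. vertex (act k w) z - sbr \<tau> (q k w) z" \<beta> 1 0
    proof
      show "0 \<le> \<beta> k" "\<beta> k \<le> 1" for k using \<beta> by (auto simp: step_ok_def less_imp_le)
      show "\<beta> \<longlonglongrightarrow> 0" "\<not> summable \<beta>" "summable (\<lambda>k. (\<beta> k)\<^sup>2)" using \<beta> by (auto simp: step_ok_def)
      show "adapted k (\<lambda>w. average \<beta> \<pi>0 (\<lambda>k. vertex (act k w)) k z - average \<beta> \<pi>0 (\<lambda>k. sbr \<tau> (q k w)) k z)" for k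
        by (rule adapted_comp2[OF average_adapted[OF ve] average_adapted[OF sb]])
      show "adapted (Suc k) (\<lambda>w. vertex (act k w) z - sbr \<tau> (q k w) z)" for k
        by (rule adapted_comp2[OF ve sb])
      show "\<bar>vertex (act k w) z - sbr \<tau> (q k w) z\<bar> \<le> 1" for k w
        using prob_simplexD(1,3)[OF vertex_simplex, of "act k w" z] prob_simplexD(1,3)[OF sbr_simplex[of \<tau> "q k w"], of z] by auto
      fix k w0 assume w0: "w0 \<in> space M"
      show "expectation (\<lambda>w. (vertex (act k w) z - sbr \<tau> (q k w) z) * atom k (H k w0) w) = 0"
      proof (rule mean_zero[OF w0])
        fix w assume w: "w \<in> space M" "H k w = H k w0"
        have "q k w = q k w0" by (rule q_adapted[unfolded adapted_def, THEN bspec, THEN bspec, THEN mp, OF w(1) w0 w(2)])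
        then show "vertex (act k w) z - sbr \<tau> (q k w) z = (\<lambda>_ x. vertex x z - P k w0 z) (env k w) (act k w)"
          by (simp add: P_def)
      next
        have "(\<Sum>x\<in>UNIV. P k w0 x * (vertex x z - P k w0 z))
            = (\<Sum>x\<in>UNIV. vertex z x * P k w0 x) - (\<Sum>x\<in>UNIV. P k w0 x) * P k w0 z"
          by (simp add: right_diff_distrib sum_subtractf sum_distrib_right[symmetric] vertex_def eq_commute mult.commute)
        also have "\<dots> = 0" using prob_simplexD(2)[OF sbr_simplex[of \<tau> "q k w0"]] by (simp add: P_def)
        finally show "(\<Sum>x\<in>UNIV. P k w0 x * (vertex x z - P k w0 z)) = 0" .
      qed
    qed (simp add: algebra_simps)
    show ?thesis using z_tendsto by (simp add: empseq_eq_average)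
  qed
  then show ?thesis unfolding AE_all_countable by (rule allI)
qed

theorem estimate_tendsto:
  shows "AE w in M. \<forall>a. (\<lambda>k. q k w a - mv R (empseq \<alpha> \<pi>0 (\<lambda>t. snd (snd (env t w))) k) a) \<longlonglongrightarrow> 0"
proof -
  define Q where "Q = (\<Sum>a\<in>UNIV. \<bar>q0 a\<bar>) + maxnorm R"
  have Q0: "\<bar>q0 a\<bar> \<le> Q" for a
    using member_le_sum[of a UNIV "\<lambda>a. \<bar>q0 a\<bar>"] maxnorm_nonneg[of R] by (simp add: Q_def)
  have QR: "\<bar>R a b\<bar> \<le> Q" for a b
  proof -
    have "0 \<le> (\<Sum>a\<in>UNIV. \<bar>q0 a\<bar>)" by (intro sum_nonneg) simp
    then show ?thesis using abs_le_maxnorm[of R a b] unfolding Q_def by linarith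
  qed
  have qQ: "\<bar>q k w a\<bar> \<le> Q" for k w a
    unfolding q_def by (intro qseq_bound steps Q0 QR)
  define m where "m = exp (- Q / \<tau>) / (CARD('a) * exp (Q / \<tau>))"
  have m: "0 < m" by (simp add: m_def)
  have sm: "m \<le> sbr \<tau> (q k w) a" for k w a
    unfolding m_def by (intro sbr_lower_bound \<tau> qQ)
  \<comment> \<open>From \<open>K\<close> on the cap is inactive, and division by \<open>sbr\<close>
    exactly compensates the probability that an entry is updated.\<close>
  obtain K where K: "\<And>k. K \<le> k \<Longrightarrow> \<alpha> k < m"
    using order_tendstoD(2)[OF steps(4) m] by (auto simp: eventually_sequentially)
  have "AE w in M. (\<lambda>k. q k w a - mv R (empseq \<alpha> \<pi>0 (\<lambda>t. snd (snd (env t w))) k) a) \<longlonglongrightarrow> 0" for a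
  proof -
    define z where "z k w = q k w a - mv R (empseq \<alpha> \<pi>0 (\<lambda>t. snd (snd (env t w))) k) a" for k w
    \<comment> \<open>Solving the recursion for the noise makes \<open>z_Suc\<close> hold from stage
      0; \<open>X\<close> is identified with \<open>G\<close> from \<open>K\<close> on.\<close>
    define X where "X k w = (z (Suc k) w - (1 - \<alpha> k) * z k w) / \<alpha> k" for k w
    \<comment> \<open>Informed updates carry no noise. Otherwise the noise is the
      importance-weighted move of entry \<open>a\<close> minus the move an informed agent would
      make.\<close>
    define G where "G p e x = (if kn \<and> fst e then 0
        else (if x = a then 1 / sbr \<tau> p a else 0) * (R x (snd (snd e)) - p a) - (R a (snd (snd e)) - p a))"
      for p :: "'a \<Rightarrow> real" and e :: "bool \<times> bool \<times> 'b" and x :: 'a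
    have XG: "X k w = G (q k w) (env k w) (act k w)" if "K \<le> k" for k w
    proof -
      have s: "0 < sbr \<tau> (q k w) a" "\<alpha> k \<le> sbr \<tau> (q k w) a"
        using m sm[of k w a] K[OF that] by auto
      have "z (Suc k) w - (1 - \<alpha> k) * z k w = \<alpha> k * G (q k w) (env k w) (act k w)"
        unfolding z_def mv_empseq_Suc q_Suc q_update_def G_def using s by (auto simp: algebra_simps min_def field_simps)
      then show ?thesis using steps(1)[of k] by (simp add: X_def)
    qed
    have ve: "adapted (Suc k) (\<lambda>w. vertex (snd (snd (env k w))))" for k by (rule adapted_comp[OF env_adapted])
    have z_ad: "adapted k (z k)" for k
      unfolding z_def empseq_eq_average by (rule adapted_comp2[OF q_adapted average_adapted[OF ve]])
    interpret averaged_noise M H z X \<alpha> "(1 / m + 1) * (2 * Q)" K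
    proof
      show "0 \<le> \<alpha> k" "\<alpha> k \<le> 1" for k using steps by auto
      show "\<alpha> \<longlonglongrightarrow> 0" "\<not> summable \<alpha>" "summable (\<lambda>k. (\<alpha> k)\<^sup>2)" using steps by auto
      show "adapted k (z k)" for k by (rule z_ad)
      show "adapted (Suc k) (X k)" for k
        unfolding X_def by (rule adapted_comp2[OF z_ad adapted_Suc[OF z_ad]])
      show "z (Suc k) w = (1 - \<alpha> k) * z k w + \<alpha> k * X k w" for k w
        using steps(1)[of k] by (simp add: X_def)
      fix k assume k: "K \<le> k"
      show "\<bar>X k w\<bar> \<le> (1 / m + 1) * (2 * Q)" for w
      proof -
        have Q0: "0 \<le> Q" using QR[of undefined undefined] by linarith
        have d: "\<bar>R x y - q k w a\<bar> \<le> 2 * Q" for x y using QR[of x y] qQ[of k w a] by linarith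
        have i: "0 \<le> 1 / sbr \<tau> (q k w) a" "1 / sbr \<tau> (q k w) a \<le> 1 / m"
          using sm[of k w a] m by (auto intro!: divide_left_mono mult_pos_pos)
        have p: "\<bar>(if x = a then 1 / sbr \<tau> (q k w) a else 0) * (R x y - q k w a)\<bar> \<le> 1 / m * (2 * Q)" for x y
          unfolding abs_mult by (rule mult_mono) (use i d m Q0 in auto)
        have "\<bar>G (q k w) e x\<bar> \<le> 1 / m * (2 * Q) + 2 * Q" for e x
        proof (cases "kn \<and> fst e")
          case True then show ?thesis using m Q0 by (simp add: G_def)
        next
          case False
          then show ?thesis using p[of x "snd (snd e)"] d[of a "snd (snd e)"] unfolding G_def by (simp only: if_False)
        qed
        then show ?thesis using XG[OF k, of w] by (simp add: distrib_right)
      qed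
      fix w0 assume w0: "w0 \<in> space M"
      show "expectation (\<lambda>w. X k w * atom k (H k w0) w) = 0"
      proof (rule mean_zero[OF w0])
        fix w assume w: "w \<in> space M" "H k w = H k w0"
        have "q k w = q k w0" by (rule q_adapted[unfolded adapted_def, THEN bspec, THEN bspec, THEN mp, OF w(1) w0 w(2)])
        then show "X k w = G (q k w0) (env k w) (act k w)" using XG[OF k] by simp
      next
        fix e :: "bool \<times> bool \<times> 'b"
        let ?p = "q k w0" and ?y = "snd (snd e)"
        show "(\<Sum>x\<in>UNIV. P k w0 x * G ?p e x) = 0"
        proof (cases "kn \<and> fst e")
          case False
          have s: "sbr \<tau> ?p a \<noteq> 0" using sbr_pos[of \<tau> ?p a] by simp
          have "P k w0 x * G ?p e x = vertex a x * (P k w0 x * (1 / sbr \<tau> ?p a) * (R x ?y - ?p a)) - P k w0 x * (R a ?y - ?p a)" for x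
            unfolding G_def if_not_P[OF False] by (simp add: vertex_def right_diff_distrib)
          then have "(\<Sum>x\<in>UNIV. P k w0 x * G ?p e x)
              = P k w0 a * (1 / sbr \<tau> ?p a) * (R a ?y - ?p a) - (\<Sum>x\<in>UNIV. P k w0 x) * (R a ?y - ?p a)"
            by (simp only: sum_subtractf sum_vertex sum_distrib_right)
          then show ?thesis using prob_simplexD(2)[OF sbr_simplex[of \<tau> ?p]] s by (simp add: P_def)
        qed (simp add: G_def)
      qed
    qed
    show ?thesis using z_tendsto by (simp add: z_def)
  qed
  then show ?thesis unfolding AE_all_countable by (rule allI)
qed

end

context finite_history
begin

text \<open>\<open>\<alpha>\<close> drives the estimate and \<open>\<beta>\<close>, the opponent's
  steps, the average of own actions; the smoothed type is noisy in both and so has square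
  summability for both.\<close>

lemma agent_converges:
  fixes env :: "nat \<Rightarrow> 'm \<Rightarrow> bool \<times> bool \<times> 'b::finite" and act :: "nat \<Rightarrow> 'm \<Rightarrow> 'a::finite"
  assumes env: "\<And>k. adapted (Suc k) (env k)" and act: "\<And>k. adapted (Suc k) (act k)"
    and ok: "agent_ok brt \<tau> \<theta> kn" and step: "step_ok brt \<alpha>" and \<beta>: "\<not> brt \<Longrightarrow> step_ok False \<beta>"
    and q: "\<And>k w. q k w = qseq \<alpha> R \<tau> kn q0 (\<lambda>t. fst (env t w)) (\<lambda>t. act t w) (\<lambda>t. snd (snd (env t w))) k"
    and law: "\<And>k w0 e x. w0 \<in> space M \<Longrightarrow>
      prob {w \<in> space M. H k w = H k w0 \<and> env k w = e \<and> act k w = x}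
       = bern \<theta> (fst e) * c k w0 e * policy brt \<tau> (q k w0) (sel k w0) x"
  shows "AE w in M. (\<lambda>k. l2norm (\<lambda>a. q k w a - mv R (empseq \<alpha> \<pi>0 (\<lambda>t. snd (snd (env t w))) k) a)) \<longlonglongrightarrow> 0"
    and "AE w in M. \<forall>z. (\<lambda>k. empseq \<beta> \<pi>0' (\<lambda>t. act t w) k z
      - average \<beta> \<pi>0' (\<lambda>k. strat brt \<tau> (q k w) (act k w)) k z) \<longlonglongrightarrow> 0"
proof -
  have "(AE w in M. \<forall>a. (\<lambda>k. q k w a - mv R (empseq \<alpha> \<pi>0 (\<lambda>t. snd (snd (env t w))) k) a) \<longlonglongrightarrow> 0)
    \<and> (AE w in M. \<forall>z. (\<lambda>k. empseq \<beta> \<pi>0' (\<lambda>t. act t w) k z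
      - average \<beta> \<pi>0' (\<lambda>k. strat brt \<tau> (q k w) (act k w)) k z) \<longlonglongrightarrow> 0)"
  proof (cases brt)
    case True
    then have \<theta>: "\<theta> = 1" and kn: kn using ok by (auto simp: agent_ok_def)
    have "AE w in M. \<not> \<not> fst (fst (env k w, act k w))" for k
    proof (rule AE_of_null_transitions[where Q = "\<lambda>t. \<not> fst (fst t)"])
      show "adapted (Suc k) (\<lambda>w. (env k w, act k w))" by (rule adapted_comp2[OF env act])
      fix w0 and t :: "(bool \<times> bool \<times> 'b) \<times> 'a"
      assume w0: "w0 \<in> space M" and t: "\<not> fst (fst t)"
      have "{w \<in> space M. H k w = H k w0 \<and> (env k w, act k w) = t}
          = {w \<in> space M. H k w = H k w0 \<and> env k w = fst t \<and> act k w = snd t}" by (cases t) auto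
      then show "prob {w \<in> space M. H k w = H k w0 \<and> (env k w, act k w) = t} = 0"
        using law[OF w0, of k "fst t" "snd t"] t \<theta> by (simp add: bern_def)
    qed
    then have "AE w in M. \<forall>k. fst (env k w)" unfolding AE_all_countable by simp
    then have "AE w in M. \<forall>a. (\<lambda>k. q k w a - mv R (empseq \<alpha> \<pi>0 (\<lambda>t. snd (snd (env t w))) k) a) \<longlonglongrightarrow> 0"
    proof eventually_elim
      case (elim w)
      show ?case unfolding q
      proof (intro allI informed_estimate_tendsto)
        show "0 \<le> \<alpha> k" "\<alpha> k \<le> 1" for k using step by (auto simp: step_ok_def less_imp_le)
      qed (use elim kn step in \<open>auto simp: step_ok_def\<close>)
    qed
    \<comment> \<open>The strategy of this type is the played vertex, so the two averages
      coincide.\<close>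
    moreover have "empseq \<beta> \<pi>0' (\<lambda>t. act t w) k z - average \<beta> \<pi>0' (\<lambda>k. strat brt \<tau> (q k w) (act k w)) k z = 0" for w k z
      using True by (simp add: empseq_eq_average strat_def)
    ultimately show ?thesis by simp
  next
    case False
    interpret learner M H env act "\<lambda>k w. sbr \<tau> (q k w)" \<alpha> R \<tau> kn q0 q
    proof
      show "adapted (Suc k) (env k)" "adapted (Suc k) (act k)" for k by (fact env act)+
      show "\<exists>c'. \<forall>e x. prob {w \<in> space M. H k w = H k w0 \<and> env k w = e \<and> act k w = x} = c' e * sbr \<tau> (q k w0) x"
        if "w0 \<in> space M" for w0 k
        using law[OF that, of k] False by (intro exI[of _ "\<lambda>e. bern \<theta> (fst e) * c k w0 e"]) (simp add: policy_def)
      show "0 < \<tau>" using ok False by (simp add: agent_ok_def)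
      show "step_ok False \<alpha>" using step False by simp
    qed (fact q refl)+
    have "strat brt \<tau> p x = sbr \<tau> p" for p and x :: 'a using False by (simp add: strat_def)
    then show ?thesis using estimate_tendsto[of \<pi>0] empirical_average_tendsto[OF \<beta>[OF False], of \<pi>0'] by simp
  qed
  then show "AE w in M. (\<lambda>k. l2norm (\<lambda>a. q k w a - mv R (empseq \<alpha> \<pi>0 (\<lambda>t. snd (snd (env t w))) k) a)) \<longlonglongrightarrow> 0"
    and "AE w in M. \<forall>z. (\<lambda>k. empseq \<beta> \<pi>0' (\<lambda>t. act t w) k z
      - average \<beta> \<pi>0' (\<lambda>k. strat brt \<tau> (q k w) (act k w)) k z) \<longlonglongrightarrow> 0"
    unfolding l2norm_tendsto_zero_iff by blast+
qed

end

section \<open>Histories of the game and the final assembly\<close>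

lemma hist_Suc: "hist acc1 acc2 a1 a2 (Suc k) w = hist acc1 acc2 a1 a2 k w @ [(acc1 k w, acc2 k w, a1 k w, a2 k w)]"
  by (simp add: hist_def)

lemma finite_history_hist:
  fixes a1 :: "nat \<Rightarrow> 'm \<Rightarrow> 'a::finite" and a2 :: "nat \<Rightarrow> 'm \<Rightarrow> 'b::finite"
  assumes "prob_space M"
    and m: "\<And>k. acc1 k \<in> measurable M (count_space UNIV)" "\<And>k. acc2 k \<in> measurable M (count_space UNIV)"
      "\<And>k. a1 k \<in> measurable M (count_space UNIV)" "\<And>k. a2 k \<in> measurable M (count_space UNIV)"
  shows "finite_history M (hist acc1 acc2 a1 a2)"
proof -
  interpret prob_space M by fact
  let ?H = "hist acc1 acc2 a1 a2"
  show ?thesis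
  proof
    fix k
    have "?H k ` space M \<subseteq> {xs. set xs \<subseteq> UNIV \<and> length xs = k}" by (auto simp: hist_def)
    then show "finite (?H k ` space M)" by (rule finite_subset) (intro finite_lists_length_eq finite)
  next
    fix k h
    show "{w \<in> space M. ?H k w = h} \<in> events"
    proof (induction k arbitrary: h)
      case 0 then show ?case by (cases "h = []") (auto simp: hist_def)
    next
      case (Suc k)
      show ?case
      proof (cases h rule: rev_exhaust)
        case Nil then show ?thesis by (simp add: hist_Suc)
      next
        case (snoc g t)
        obtain b1 b2 x y where t: "t = (b1, b2, x, y)" by (cases t)
        have "{w \<in> space M. ?H (Suc k) w = h} = {w \<in> space M. ?H k w = g}
           \<inter> (acc1 k -` {b1} \<inter> space M) \<inter> (acc2 k -` {b2} \<inter> space M) \<inter> (a1 k -` {x} \<inter> space M) \<inter> (a2 k -` {y} \<inter> space M)"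
          by (auto simp: hist_Suc snoc t)
        also have "\<dots> \<in> events" by (intro sets.Int Suc measurable_sets[OF m(1)] measurable_sets[OF m(2)]
            measurable_sets[OF m(3)] measurable_sets[OF m(4)]) auto
        finally show ?thesis .
      qed
    qed
  next
    fix w w' k assume "?H (Suc k) w = ?H (Suc k) w'"
    then show "?H k w = ?H k w'" by (simp add: hist_Suc)
  qed
qed

text \<open>An agent's actions are averaged with the opponent's steps, whose square summability is
  assumed only if the opponent is smoothed; the convergent ratio transfers it.\<close>

lemma summable_square_of_ratio:
  fixes \<alpha> \<beta> :: "nat \<Rightarrow> real"
  assumes "summable (\<lambda>k. (\<alpha> k)\<^sup>2)" and \<alpha>: "\<And>k. 0 < \<alpha> k" and \<beta>: "\<And>k. 0 < \<beta> k"
    and lim: "(\<lambda>k. \<beta> k / \<alpha> k) \<longlonglongrightarrow> d"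
  shows "summable (\<lambda>k. (\<beta> k)\<^sup>2)"
proof (rule summable_comparison_test_ev)
  have "\<forall>\<^sub>F k in sequentially. \<beta> k / \<alpha> k < d + 1" by (rule order_tendstoD(2)[OF lim]) simp
  then show "\<forall>\<^sub>F k in sequentially. norm ((\<beta> k)\<^sup>2) \<le> (d + 1)\<^sup>2 * (\<alpha> k)\<^sup>2"
  proof eventually_elim
    case (elim k)
    then have "\<beta> k \<le> (d + 1) * \<alpha> k" using \<alpha>[of k] by (simp add: field_simps)
    then show ?case using power_mono[of "\<beta> k" "(d + 1) * \<alpha> k" 2] \<beta>[of k] by (simp add: power_mult_distrib)
  qed
  show "summable (\<lambda>k. (d + 1)\<^sup>2 * (\<alpha> k)\<^sup>2)" using assms(1) by (rule summable_mult)
qed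

theorem theorem1:
  fixes M :: "'m measure"
    and R1 :: "'a1::finite \<Rightarrow> 'a2::finite \<Rightarrow> real" and R2 :: "'a2 \<Rightarrow> 'a1 \<Rightarrow> real"
    and brt1 brt2 kn1 kn2 :: bool and \<tau>1 \<tau>2 \<theta>1 \<theta>2 d lam :: real
    and \<alpha>1 \<alpha>2 :: "nat \<Rightarrow> real"
    and q10 \<pi>10 :: "'a1 \<Rightarrow> real" and q20 \<pi>20 :: "'a2 \<Rightarrow> real"
    and acc1 acc2 :: "nat \<Rightarrow> 'm \<Rightarrow> bool"
    and a1 :: "nat \<Rightarrow> 'm \<Rightarrow> 'a1" and a2 :: "nat \<Rightarrow> 'm \<Rightarrow> 'a2"
    and sel1 :: "nat \<Rightarrow> 'm \<Rightarrow> 'a1 \<Rightarrow> real" and sel2 :: "nat \<Rightarrow> 'm \<Rightarrow> 'a2 \<Rightarrow> real"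
  defines "q1 \<equiv> qproc \<alpha>1 R1 \<tau>1 kn1 q10 acc1 a1 a2"
    and "q2 \<equiv> qproc \<alpha>2 R2 \<tau>2 kn2 q20 acc2 a2 a1"
    and "\<pi>1 \<equiv> empproc \<alpha>2 \<pi>10 a1"
    and "\<pi>2 \<equiv> empproc \<alpha>1 \<pi>20 a2"
    and "H \<equiv> hist acc1 acc2 a1 a2"
    and "c \<equiv> lam * maxnorm (\<lambda>x y. R1 x y + R2 y x) - (sval \<tau>1 \<tau>2 R1 + sval \<tau>2 \<tau>1 R2)"
  assumes "prob_space M"
    and "agent_ok brt1 \<tau>1 \<theta>1 kn1" and "agent_ok brt2 \<tau>2 \<theta>2 kn2"
    and "step_ok brt1 \<alpha>1" and "step_ok brt2 \<alpha>2"
    and "(\<lambda>k. \<alpha>1 k / \<alpha>2 k) \<longlonglongrightarrow> d" and "0 < d" and "d \<le> 1"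
    and "\<pi>10 \<in> prob_simplex" and "\<pi>20 \<in> prob_simplex"
    and "1 < lam"
    and "\<And>k. acc1 k \<in> measurable M (count_space UNIV)"
    and "\<And>k. acc2 k \<in> measurable M (count_space UNIV)"
    and "\<And>k. a1 k \<in> measurable M (count_space UNIV)"
    and "\<And>k. a2 k \<in> measurable M (count_space UNIV)"
    and "brt1 \<Longrightarrow> \<forall>k. \<forall>\<omega>\<in>space M. sel1 k \<omega> \<in> prob_simplex \<and> a1 k \<omega> \<in> br_set (q1 k \<omega>)
           \<and> (\<forall>x. 0 < sel1 k \<omega> x \<longrightarrow> x \<in> br_set (q1 k \<omega>))
           \<and> (\<forall>\<omega>'\<in>space M. H k \<omega>' = H k \<omega> \<longrightarrow> sel1 k \<omega>' = sel1 k \<omega>)"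
    and "brt2 \<Longrightarrow> \<forall>k. \<forall>\<omega>\<in>space M. sel2 k \<omega> \<in> prob_simplex \<and> a2 k \<omega> \<in> br_set (q2 k \<omega>)
           \<and> (\<forall>x. 0 < sel2 k \<omega> x \<longrightarrow> x \<in> br_set (q2 k \<omega>))
           \<and> (\<forall>\<omega>'\<in>space M. H k \<omega>' = H k \<omega> \<longrightarrow> sel2 k \<omega>' = sel2 k \<omega>)"
    and "\<And>k \<omega>0 b1 b2 x y. \<omega>0 \<in> space M \<Longrightarrow>
           measure M {\<omega>\<in>space M. H k \<omega> = H k \<omega>0 \<and> acc1 k \<omega> = b1 \<and> acc2 k \<omega> = b2
                                   \<and> a1 k \<omega> = x \<and> a2 k \<omega> = y}
         = measure M {\<omega>\<in>space M. H k \<omega> = H k \<omega>0}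
           * bern \<theta>1 b1 * bern \<theta>2 b2
           * policy brt1 \<tau>1 (q1 k \<omega>0) (sel1 k \<omega>0) x
           * policy brt2 \<tau>2 (q2 k \<omega>0) (sel2 k \<omega>0) y"
  shows "(AE \<omega> in M.
            (\<lambda>k. l2norm (\<lambda>x. q1 k \<omega> x - mv R1 (\<pi>2 k \<omega>) x)) \<longlonglongrightarrow> 0
          \<and> (\<lambda>k. l2norm (\<lambda>x. q2 k \<omega> x - mv R2 (\<pi>1 k \<omega>) x)) \<longlonglongrightarrow> 0
          \<and> limsup (\<lambda>k. ereal
               (delta \<tau>1 \<tau>2 R1 (strat brt1 \<tau>1 (q1 k \<omega>) (a1 k \<omega>)) (q1 k \<omega>) (\<pi>2 k \<omega>)
                + d * delta \<tau>2 \<tau>1 R2 (strat brt2 \<tau>2 (q2 k \<omega>) (a2 k \<omega>)) (q2 k \<omega>) (\<pi>1 k \<omega>)))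
             \<le> ereal c)
       \<and> (\<forall>\<omega>\<in>space M. \<forall>k.
            delta \<tau>1 \<tau>2 R1 (strat brt1 \<tau>1 (q1 k \<omega>) (a1 k \<omega>)) (q1 k \<omega>) (\<pi>2 k \<omega>)
              \<ge> - l2norm (\<lambda>x. q1 k \<omega> x - mv R1 (\<pi>2 k \<omega>) x)
          \<and> delta \<tau>2 \<tau>1 R2 (strat brt2 \<tau>2 (q2 k \<omega>) (a2 k \<omega>)) (q2 k \<omega>) (\<pi>1 k \<omega>)
              \<ge> - l2norm (\<lambda>x. q2 k \<omega> x - mv R2 (\<pi>1 k \<omega>) x))"
proof -
  interpret prob_space M by fact
  interpret finite_history M H unfolding H_def by (rule finite_history_hist) fact+
  have ok: "agent_ok brt1 \<tau>1 \<theta>1 kn1" "agent_ok brt2 \<tau>2 \<theta>2 kn2" by fact+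
  have step: "step_ok brt1 \<alpha>1" "step_ok brt2 \<alpha>2" by fact+
  have ratio: "(\<lambda>k. \<alpha>1 k / \<alpha>2 k) \<longlonglongrightarrow> d" "0 < d" "d \<le> 1" by fact+
  have init: "\<pi>10 \<in> prob_simplex" "\<pi>20 \<in> prob_simplex" by fact+
  have s1: "0 < \<alpha>1 k" "\<alpha>1 k < 1" "0 \<le> \<alpha>1 k" "\<alpha>1 k \<le> 1" and s2: "0 < \<alpha>2 k" "\<alpha>2 k < 1" "0 \<le> \<alpha>2 k" "\<alpha>2 k \<le> 1" for k
    using step by (auto simp: step_ok_def less_imp_le)
  note \<tau> = ok[THEN agent_temp_nonneg]
  have ratio': "(\<lambda>k. \<alpha>2 k / \<alpha>1 k) \<longlonglongrightarrow> inverse d"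
    using tendsto_inverse[OF ratio(1)] ratio(2) by simp
  \<comment> \<open>Numbered by the steps: agent 1's actions are averaged with
    \<open>\<alpha>2\<close>.\<close>
  have \<beta>2: "step_ok False \<alpha>2" if "\<not> brt1"
    using step that summable_square_of_ratio[OF _ s1(1) s2(1) ratio'] by (simp add: step_ok_def)
  have \<beta>1: "step_ok False \<alpha>1" if "\<not> brt2"
    using step that summable_square_of_ratio[OF _ s2(1) s1(1) ratio(1)] by (simp add: step_ok_def)
  have obs: "adapted (Suc k) (acc1 k)" "adapted (Suc k) (acc2 k)" "adapted (Suc k) (a1 k)" "adapted (Suc k) (a2 k)" for k
    unfolding adapted_def by (simp_all add: H_def hist_Suc)
  \<comment> \<open>Each agent's view lists own access, opponent's access, opponent's action; the
    two views regroup the same joint law.\<close>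
  define env1 where "env1 k w = (acc1 k w, acc2 k w, a2 k w)" for k w
  define env2 where "env2 k w = (acc2 k w, acc1 k w, a1 k w)" for k w
  have env1: "adapted (Suc k) (env1 k)" for k
    unfolding env1_def by (rule adapted_comp2[OF obs(1) adapted_comp2[OF obs(2,4)]])
  have env2: "adapted (Suc k) (env2 k)" for k
    unfolding env2_def by (rule adapted_comp2[OF obs(2) adapted_comp2[OF obs(1,3)]])
  have q1: "q1 k w = qseq \<alpha>1 R1 \<tau>1 kn1 q10 (\<lambda>t. fst (env1 t w)) (\<lambda>t. a1 t w) (\<lambda>t. snd (snd (env1 t w))) k" for k w
    by (simp add: q1_def qproc_def env1_def)
  have q2: "q2 k w = qseq \<alpha>2 R2 \<tau>2 kn2 q20 (\<lambda>t. fst (env2 t w)) (\<lambda>t. a2 t w) (\<lambda>t. snd (snd (env2 t w))) k" for k w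
    by (simp add: q2_def qproc_def env2_def)
  have law: "prob {w \<in> space M. H k w = H k w0 \<and> acc1 k w = b1 \<and> acc2 k w = b2 \<and> a1 k w = x \<and> a2 k w = y}
      = prob {w \<in> space M. H k w = H k w0} * bern \<theta>1 b1 * bern \<theta>2 b2
        * policy brt1 \<tau>1 (q1 k w0) (sel1 k w0) x * policy brt2 \<tau>2 (q2 k w0) (sel2 k w0) y"
    if "w0 \<in> space M" for k w0 b1 b2 x y
    using that by fact
  have law1: "prob {w \<in> space M. H k w = H k w0 \<and> env1 k w = e \<and> a1 k w = x} = bern \<theta>1 (fst e)
      * (prob {w \<in> space M. H k w = H k w0} * bern \<theta>2 (fst (snd e)) * policy brt2 \<tau>2 (q2 k w0) (sel2 k w0) (snd (snd e)))
      * policy brt1 \<tau>1 (q1 k w0) (sel1 k w0) x" if "w0 \<in> space M" for k w0 e x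
  proof -
    have "{w \<in> space M. H k w = H k w0 \<and> env1 k w = e \<and> a1 k w = x}
        = {w \<in> space M. H k w = H k w0 \<and> acc1 k w = fst e \<and> acc2 k w = fst (snd e) \<and> a1 k w = x \<and> a2 k w = snd (snd e)}"
      by (cases e) (auto simp: env1_def)
    then show ?thesis by (simp only: law[OF that] mult.assoc mult.commute mult.left_commute)
  qed
  have law2: "prob {w \<in> space M. H k w = H k w0 \<and> env2 k w = e \<and> a2 k w = y} = bern \<theta>2 (fst e)
      * (prob {w \<in> space M. H k w = H k w0} * bern \<theta>1 (fst (snd e)) * policy brt1 \<tau>1 (q1 k w0) (sel1 k w0) (snd (snd e)))
      * policy brt2 \<tau>2 (q2 k w0) (sel2 k w0) y" if "w0 \<in> space M" for k w0 e y
  proof -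
    have "{w \<in> space M. H k w = H k w0 \<and> env2 k w = e \<and> a2 k w = y}
        = {w \<in> space M. H k w = H k w0 \<and> acc1 k w = fst (snd e) \<and> acc2 k w = fst e \<and> a1 k w = snd (snd e) \<and> a2 k w = y}"
      by (cases e) (auto simp: env2_def)
    then show ?thesis by (simp only: law[OF that] mult.assoc mult.commute mult.left_commute)
  qed
  have \<pi>1: "\<pi>1 k w = empseq \<alpha>2 \<pi>10 (\<lambda>t. a1 t w) k" and \<pi>2: "\<pi>2 k w = empseq \<alpha>1 \<pi>20 (\<lambda>t. a2 t w) k" for k w
    by (simp_all add: \<pi>1_def \<pi>2_def empproc_def)
  have \<pi>s: "\<pi>1 k w \<in> prob_simplex" "\<pi>2 k w \<in> prob_simplex" for k w
    unfolding \<pi>1 \<pi>2 using init s1 s2 by (auto intro!: empseq_simplex)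
  have br1: "a1 k w \<in> br_set (q1 k w)" if "w \<in> space M" "brt1" for k w
    using \<open>brt1 \<Longrightarrow> \<forall>k. \<forall>\<omega>\<in>space M. sel1 k \<omega> \<in> prob_simplex \<and> a1 k \<omega> \<in> br_set (q1 k \<omega>)
           \<and> (\<forall>x. 0 < sel1 k \<omega> x \<longrightarrow> x \<in> br_set (q1 k \<omega>))
           \<and> (\<forall>\<omega>'\<in>space M. H k \<omega>' = H k \<omega> \<longrightarrow> sel1 k \<omega>' = sel1 k \<omega>)\<close> that by blast
  have br2: "a2 k w \<in> br_set (q2 k w)" if "w \<in> space M" "brt2" for k w
    using \<open>brt2 \<Longrightarrow> \<forall>k. \<forall>\<omega>\<in>space M. sel2 k \<omega> \<in> prob_simplex \<and> a2 k \<omega> \<in> br_set (q2 k \<omega>)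
           \<and> (\<forall>x. 0 < sel2 k \<omega> x \<longrightarrow> x \<in> br_set (q2 k \<omega>))
           \<and> (\<forall>\<omega>'\<in>space M. H k \<omega>' = H k \<omega> \<longrightarrow> sel2 k \<omega>' = sel2 k \<omega>)\<close> that by blast
  note conv1 = agent_converges[OF env1 obs(3) ok(1) step(1) \<beta>2 q1 law1]
  note conv2 = agent_converges[OF env2 obs(4) ok(2) step(2) \<beta>1 q2 law2]
  have est1: "AE w in M. (\<lambda>k. l2norm (\<lambda>a. q1 k w a - mv R1 (\<pi>2 k w) a)) \<longlonglongrightarrow> 0"
    using conv1(1)[of \<pi>20] by (simp add: \<pi>2 env1_def)
  have est2: "AE w in M. (\<lambda>k. l2norm (\<lambda>a. q2 k w a - mv R2 (\<pi>1 k w) a)) \<longlonglongrightarrow> 0"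
    using conv2(1)[of \<pi>10] by (simp add: \<pi>1 env2_def)
  have emp1: "AE w in M. \<forall>z. (\<lambda>k. \<pi>1 k w z - average \<alpha>2 \<pi>10 (\<lambda>k. strat brt1 \<tau>1 (q1 k w) (a1 k w)) k z) \<longlonglongrightarrow> 0"
    using conv1(2)[of \<pi>10] by (simp add: \<pi>1)
  have emp2: "AE w in M. \<forall>z. (\<lambda>k. \<pi>2 k w z - average \<alpha>1 \<pi>20 (\<lambda>k. strat brt2 \<tau>2 (q2 k w) (a2 k w)) k z) \<longlonglongrightarrow> 0"
    using conv2(2)[of \<pi>20] by (simp add: \<pi>2)
  let ?\<Delta> = "\<lambda>k w. delta \<tau>1 \<tau>2 R1 (strat brt1 \<tau>1 (q1 k w) (a1 k w)) (q1 k w) (\<pi>2 k w)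
                + d * delta \<tau>2 \<tau>1 R2 (strat brt2 \<tau>2 (q2 k w) (a2 k w)) (q2 k w) (\<pi>1 k w)"
  have "AE w in M. (\<lambda>k. l2norm (\<lambda>a. q1 k w a - mv R1 (\<pi>2 k w) a)) \<longlonglongrightarrow> 0
      \<and> (\<lambda>k. l2norm (\<lambda>a. q2 k w a - mv R2 (\<pi>1 k w) a)) \<longlonglongrightarrow> 0
      \<and> limsup (\<lambda>k. ereal (?\<Delta> k w)) \<le> ereal c"
    using est1 est2 emp1 emp2 AE_space
  proof eventually_elim
    case (elim w)
    have "limsup (\<lambda>k. ereal (?\<Delta> k w)) \<le> ereal c"
    proof (rule ereal_le_epsilon2)
      fix \<delta> :: real assume \<delta>: "0 < \<delta>"
      show "limsup (\<lambda>k. ereal (?\<Delta> k w)) \<le> ereal c + ereal \<delta>"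
      proof (rule Limsup_bounded)
        have nonsummable: "\<alpha>2 \<longlonglongrightarrow> 0" "\<not> summable \<alpha>2" using step by (auto simp: step_ok_def)
        have "\<forall>\<^sub>F k in sequentially. ?\<Delta> k w
            \<le> maxnorm (\<lambda>x y. R1 x y + R2 y x) - (sval \<tau>1 \<tau>2 R1 + sval \<tau>2 \<tau>1 R2) + \<delta>"
          by (rule pathwise_limsup[OF ok s1(1,2) s2(1,2) nonsummable ratio init br1[OF elim(5)] br2[OF elim(5)] \<pi>s elim(1,2)
                refl refl elim(3)[THEN spec] elim(4)[THEN spec] \<delta>])
        \<comment> \<open>The pathwise bound has factor 1 on the norm, which is nonnegative, so
          \<open>lam\<close> only enlarges it.\<close>
        moreover have "maxnorm (\<lambda>x y. R1 x y + R2 y x) - (sval \<tau>1 \<tau>2 R1 + sval \<tau>2 \<tau>1 R2) \<le> c"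
          using mult_right_mono[of 1 lam "maxnorm (\<lambda>x y. R1 x y + R2 y x)"] 
            maxnorm_nonneg[of "\<lambda>x y. R1 x y + R2 y x"] \<open>1 < lam\<close> by (simp add: c_def)
        ultimately show "\<forall>\<^sub>F k in sequentially. ereal (?\<Delta> k w) \<le> ereal c + ereal \<delta>"
          by (auto elim!: eventually_mono)
      qed
    qed
    then show ?case using elim by blast
  qed
  moreover have "delta \<tau>1 \<tau>2 R1 (strat brt1 \<tau>1 (q1 k w) (a1 k w)) (q1 k w) (\<pi>2 k w)
              \<ge> - l2norm (\<lambda>x. q1 k w x - mv R1 (\<pi>2 k w) x)
          \<and> delta \<tau>2 \<tau>1 R2 (strat brt2 \<tau>2 (q2 k w) (a2 k w)) (q2 k w) (\<pi>1 k w)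
              \<ge> - l2norm (\<lambda>x. q2 k w x - mv R2 (\<pi>1 k w) x)" if "w \<in> space M" for k w
    using delta_ge[OF ok(1) br1[OF that] \<pi>s(2) \<tau>(2)] delta_ge[OF ok(2) br2[OF that] \<pi>s(1) \<tau>(1)] by blast
  ultimately show ?thesis by blast
qed

end
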